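(* Let $2<p<\infty$ and let $g$ be an analytic function in the unit disc $\mathbb{D}$. Then: (i) If the generalized Hilbert operator $\mathcal{H}_g$ is bounded from $H^p$ to $H^p$, then $g\in\Lambda\left(p,\frac1p\right)$. (ii) If $g\in\Lambda\left(q,\frac1q\right)$ for some $q$ with $1<q<p$, then $\mathcal{H}_g$ is bounded from $H^p$ to $H^p$.
   Context: $\mathbb{D}$ is the open unit disc and $\mathcal{H}ol(\mathbb{D})$ the space of analytic functions in $\mathbb{D}$. For $f\in\mathcal{H}ol(\mathbb{D})$, $0<r<1$, $0<p<\infty$, $M_p(r,f)=\left(\frac1{2\pi}\int_0^{2\pi}|f(re^{it})|^p\,dt\right)^{1/p}$, and $H^p$ is the Hardy space of $f\in\mathcal{H}ol(\mathbb{D})$ with $\|f\|_{H^p}=\sup_{0<r<1}M_p(r,f)<\infty$. Given $g\in\mathcal{H}ol(\mathbb{D})$, the generalized Hilbert operator is $\mathcal{H}_g(f)(z)=\int_0^1 f(t)g'(tz)\,dt$, $z\in\mathbb{D}$, defined for $f\in \mathcal{H}ol(\mathbb{D})$ with $\int_0^1|f(t)|\,dt<\infty$ (in particular for every $f\in H^1$); then $\mathcal{H}_g(f)\in\mathcal{H}ol(\mathbb{D})$. Mean Lipschitz spaces: for $1\le p<\infty$ and $0<\alpha\le1$, $\Lambda(p,\alpha)$ is the set of $g\in H^p$ whose boundary function satisfies $\omega_p(g,t)=O(t^\alpha)$ as $t\to0$, where $\omega_p(g,t)=\sup_{0<h\le t}\left(\int_0^{2\pi}|g(e^{i(\theta+h)})-g(e^{i\theta})|^p\frac{d\theta}{2\pi}\right)^{1/p}$.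 Equivalently (Hardy–Littlewood), $\Lambda(p,\alpha)=\{g\in H^p: M_p(r,g')=O((1-r)^{\alpha-1}),\ r\to1^-\}$. *)

theory Defs
  imports "HOL-Complex_Analysis.Complex_Analysis" "HOL-Library.Landau_Symbols"
begin

text \<open>
  Analytic functions on the unit disc are functions on all of \<^typ>\<open>complex\<close> that are
  holomorphic on \<^term>\<open>ball 0 1\<close>; no definition below depends on their values elsewhere.
\<close>

definition integral_mean :: "real \<Rightarrow> real \<Rightarrow> (complex \<Rightarrow> complex) \<Rightarrow> real" where
  "integral_mean p r f =
     (1 / (2 * pi) * (LINT t|lebesgue_on {0..2*pi}. norm (f (of_real r * cis t)) powr p))
       powr (1 / p)"

definition hardy :: "real \<Rightarrow> (complex \<Rightarrow> complex) set" where
  "hardy p = {f. f holomorphic_on ball 0 1 \<and>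
                 bdd_above ((\<lambda>r. integral_mean p r f) ` {0<..<1})}"

definition hardy_norm :: "real \<Rightarrow> (complex \<Rightarrow> complex) \<Rightarrow> real" where
  "hardy_norm p f = (SUP r\<in>{0<..<1}. integral_mean p r f)"

text \<open>
  The Bochner integral is total, but for \<open>f\<close> in a Hardy space with exponent at least 1 it is
  a genuine absolutely convergent integral at every point \<open>z\<close> of the disc: \<open>f\<close> is integrable
  on \<open>(0,1)\<close> by the Fejer--Riesz inequality, and \<open>t \<mapsto> g'(tz)\<close> is bounded.
\<close>

definition hilbert_op :: "(complex \<Rightarrow> complex) \<Rightarrow> (complex \<Rightarrow> complex) \<Rightarrow> complex \<Rightarrow> complex" where
  "hilbert_op g f z =
     (LINT t|lebesgue_on {0<..<1}. f (of_real t) * deriv g (of_real t * z))"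

definition bounded_on_hardy ::
    "real \<Rightarrow> ((complex \<Rightarrow> complex) \<Rightarrow> complex \<Rightarrow> complex) \<Rightarrow> bool" where
  "bounded_on_hardy p T \<longleftrightarrow>
     (\<exists>C. \<forall>f\<in>hardy p. T f \<in> hardy p \<and> hardy_norm p (T f) \<le> C * hardy_norm p f)"

definition boundary_fun :: "(complex \<Rightarrow> complex) \<Rightarrow> complex \<Rightarrow> complex" where
  "boundary_fun g \<zeta> = Lim (at_left 1) (\<lambda>r::real. g (of_real r * \<zeta>))"

definition has_radial_limit :: "(complex \<Rightarrow> complex) \<Rightarrow> complex \<Rightarrow> bool" where
  "has_radial_limit g \<zeta> \<longleftrightarrow> (\<exists>l. ((\<lambda>r::real. g (of_real r * \<zeta>)) \<longlongrightarrow> l) (at_left 1))"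

definition modulus_of_continuity :: "real \<Rightarrow> (complex \<Rightarrow> complex) \<Rightarrow> real \<Rightarrow> real" where
  "modulus_of_continuity p g t =
     (SUP h\<in>{0<..t}.
        (1 / (2 * pi) * (LINT \<theta>|lebesgue_on {0..2*pi}.
            norm (boundary_fun g (cis (\<theta> + h)) - boundary_fun g (cis \<theta>)) powr p)) powr (1 / p))"

text \<open>
  The almost-everywhere clause says that the boundary function exists, so that the values
  of \<^const>\<open>Lim\<close> are true radial limits off a null set. By Fatou's lemma the boundary function of
  a member of \<^term>\<open>hardy p\<close> is then in \<open>L\<^sup>p\<close>, so no integral in
  \<^const>\<open>modulus_of_continuity\<close> diverges and each supremum is over a bounded set.
\<close>

definition mean_lipschitz :: "real \<Rightarrow> real \<Rightarrow> (complex \<Rightarrow> complex) set" where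
  "mean_lipschitz p \<alpha> = {g \<in> hardy p.
     (AE \<theta> in lebesgue_on {0..2*pi}. has_radial_limit g (cis \<theta>)) \<and>
     modulus_of_continuity p g \<in> O[at_right 0](\<lambda>t. t powr \<alpha>)}"

end

theory Submission
  imports Defs
begin

text \<open>
  Both parts go through the growth condition \<open>M\<^sub>p(r, g') = O((1 - r)\<^bsup>1/p-1\<^esup>)\<close>.

  (i) Apply the operator to \<open>f(z) = \<Sum>\<^bsub>N \<le> k < 2N\<^esub> z\<^sup>k\<close>, whose norm is at most
  \<open>N\<^bsup>1-1/p\<^esup>\<close> (interpolate between the sup norm and Parseval; this uses \<open>p > 2\<close>). The moments
  \<open>h\<^sub>k(z) = \<integral>\<^sub>0\<^sup>1 t\<^sup>k g'(tz) dt\<close> satisfy \<open>z h\<^sub>k' = g' - (k + 1) h\<^sub>k\<close>, so with \<open>H = \<Sum> h\<^sub>k\<close> the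
  function \<open>N g'\<close> equals \<open>z H' + \<gamma> H\<close> up to the error \<open>\<Sum> (k + 1 - \<gamma>) h\<^sub>k\<close>. For \<open>\<gamma> = 4N/3\<close> and
  \<open>N\<close> of the order of \<open>1/(1 - r)\<close> the error is at most a third of the a priori bound for \<open>g'\<close> and
  is absorbed. Radial and tangential integration of \<open>g'\<close> then give the Lipschitz condition.

  (ii) Writing \<open>g'\<close> as a Cauchy integral of the differences \<open>g(e\<^bsup>i(t+\<theta>)\<^esup>) - g(e\<^bsup>it\<^esup>)\<close> gives the
  growth condition with exponent \<open>q\<close>, hence with every larger exponent. Since
  \<open>f \<mapsto> f|\<^bsub>(0,1)\<^esub>\<close> maps \<open>H\<^sup>p\<close> to \<open>L\<^sup>p(0, 1)\<close> (Fejer--Riesz), it remains to interpolate between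
  two exponents on either side of \<open>p\<close>, which is reduced to Hardy's inequality.
\<close>

section \<open>Integral inequalities\<close>

text \<open>In (i), the operator applied to a block acts on the Taylor coefficients of g' as a
  multiplier, and dividing by it in H^p would call for a multiplier theorem. The differential
  equation of the moments avoids the division: passing from H to H' costs 2 / (1 - r) by Cauchy's
  formula, the same order as N. Absorption presupposes a finite supremum, so it is carried out on
  radii in (0, a] for fixed a < 1, with a constant independent of a. In (ii), Minkowski at the
  exponent p itself would leave the integral of |f(t)| (1 - t)^(1/p - 1), and this weight just
  misses the dual of L^p: its p/(p - 1)-th power is 1 / (1 - t). This logarithmic divergence is why
  some q < p is assumed and exponents on both sides of p are played against each other. Estimates
  are made on circles of radius less than 1 and on truncated segments, uniformly, so that Fatou's
  lemma reaches the limit. Norms are replaced by positive upper bounds, which removes the cases of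
  vanishing and infinite norms.\<close>

lemma young_powr:
  fixes p :: real
  assumes "1 < p" "0 \<le> x" "0 \<le> c"
  shows "p * (c powr (p - 1) * x) \<le> x powr p + (p - 1) * c powr p"
proof -
  define q where "q = p / (p - 1)"
  have q: "1 < q" "1 / p + 1 / q = 1" "(p - 1) * q = p"
    using assms by (auto simp: q_def field_simps)
  have "x * c powr (p - 1) \<le> x powr p / p + (c powr (p - 1)) powr q / q"
    using assms q by (intro Youngs_inequality) auto
  then have "x * c powr (p - 1) \<le> x powr p / p + c powr p / q"
    by (simp add: powr_powr q(3))
  then have "p * (x * c powr (p - 1)) \<le> p * (x powr p / p + c powr p / q)"
    using assms by (intro mult_left_mono) auto
  also have "\<dots> = x powr p + (p - 1) * c powr p"
    using assms by (simp add: q_def field_simps)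
  finally show ?thesis by (simp add: mult_ac)
qed

text \<open>The tangent of x powr p at a point c lies below the graph (\<open>young_powr\<close>);
  this is applied to F / B and integrated against B. With a tangent nothing has to be normalised: an
  upper bound for the mass of B and a lower bound for the integral of F suffice.\<close>

lemma jensen_powr:
  fixes F B :: "'a \<Rightarrow> real"
  assumes p: "1 < p" and b: "0 < b" and G: "0 \<le> G"
    and [measurable]: "F \<in> borel_measurable M" "B \<in> borel_measurable M" "S \<in> sets M"
    and F: "\<And>x. x \<in> S \<Longrightarrow> 0 \<le> F x" and B: "\<And>x. x \<in> S \<Longrightarrow> 0 < B x"
    and GF: "ennreal G \<le> (\<integral>\<^sup>+x\<in>S. ennreal (F x) \<partial>M)"
    and Bb: "(\<integral>\<^sup>+x\<in>S. ennreal (B x) \<partial>M) \<le> ennreal b"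
  shows "ennreal (G powr p) \<le>
    ennreal (b powr (p - 1)) * (\<integral>\<^sup>+x\<in>S. ennreal (F x powr p * B x powr (1 - p)) \<partial>M)"
    (is "_ \<le> _ * ?I")
proof (cases "G = 0")
  case True
  then show ?thesis by simp
next
  case False
  then have G0: "0 < G" using G by simp
  \<comment> \<open>The tangent point plays the role of the mean value of F / B. With G = c * b the
    main term exceeds the correction (p - 1) * c powr p * b by exactly c powr p * b.\<close>
  define c where "c = G / b"
  have c: "0 < c" using G0 b by (simp add: c_def)
  have pt: "p * c powr (p - 1) * F x \<le> F x powr p * B x powr (1 - p) + (p - 1) * c powr p * B x"
    if "x \<in> S" for x
  proof -
    have "p * (c powr (p - 1) * (F x / B x)) * B x
        \<le> ((F x / B x) powr p + (p - 1) * c powr p) * B x"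
      using young_powr[of p "F x / B x" c] p F[OF that] B[OF that] c
      by (intro mult_right_mono) auto
    moreover have "(F x / B x) powr p * B x = F x powr p * B x powr (1 - p)"
      using F[OF that] B[OF that] by (simp add: powr_divide powr_diff)
    ultimately show ?thesis using B[OF that] by (simp add: algebra_simps)
  qed
  have "ennreal (p * c powr (p - 1)) * ennreal G
      \<le> ennreal (p * c powr (p - 1)) * (\<integral>\<^sup>+x\<in>S. ennreal (F x) \<partial>M)"
    by (rule mult_left_mono[OF GF]) simp
  also have "\<dots> = (\<integral>\<^sup>+x. ennreal (p * c powr (p - 1)) * (ennreal (F x) * indicator S x) \<partial>M)"
    by (rule nn_integral_cmult[symmetric]) measurable
  also have "\<dots> \<le> (\<integral>\<^sup>+x. ennreal (F x powr p * B x powr (1 - p)) * indicator S x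
       + ennreal ((p - 1) * c powr p) * (ennreal (B x) * indicator S x) \<partial>M)"
  proof (rule nn_integral_mono)
    fix x
    show "ennreal (p * c powr (p - 1)) * (ennreal (F x) * indicator S x)
      \<le> ennreal (F x powr p * B x powr (1 - p)) * indicator S x
       + ennreal ((p - 1) * c powr p) * (ennreal (B x) * indicator S x)"
      using pt[of x] F[of x] B[of x] p c
      by (auto simp: indicator_def simp flip: ennreal_mult ennreal_plus intro!: ennreal_leI)
  qed
  also have "\<dots> = ?I + ennreal ((p - 1) * c powr p) * (\<integral>\<^sup>+x\<in>S. ennreal (B x) \<partial>M)"
    by (subst nn_integral_add) (simp_all add: nn_integral_cmult)
  also have "\<dots> \<le> ?I + ennreal ((p - 1) * c powr p) * ennreal b"
    by (intro add_left_mono mult_left_mono Bb) simp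
  finally have *: "ennreal (p * c powr (p - 1) * G) \<le> ?I + ennreal ((p - 1) * c powr p * b)"
    using p c G b by (simp add: ennreal_mult')
  have Gcb: "G = c * b" using b by (simp add: c_def)
  have cp: "c powr (p - 1) * c = c powr p" using c by (simp add: powr_diff)
  have eq: "p * c powr (p - 1) * G = c powr p * b + (p - 1) * c powr p * b"
    unfolding Gcb cp[symmetric] by (simp add: algebra_simps)
  \<comment> \<open>The correction term can be subtracted only when the integral is finite;
    otherwise the claim is trivial.\<close>
  have le: "ennreal (c powr p * b) \<le> ?I"
  proof (cases "?I = \<infinity>")
    case False
    then obtain i where i: "?I = ennreal i" "0 \<le> i" by (cases ?I) auto
    have "p * c powr (p - 1) * G \<le> i + (p - 1) * c powr p * b"
      using * i p c b by (subst (asm) i) (simp flip: ennreal_plus add: ennreal_le_iff)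
    then show ?thesis unfolding i(1) eq by (intro ennreal_leI) simp
  qed simp
  have "G powr p = b powr (p - 1) * (c powr p * b)"
    unfolding Gcb using c b by (simp add: powr_mult powr_diff)
  then have "ennreal (G powr p) = ennreal (b powr (p - 1)) * ennreal (c powr p * b)"
    using b c by (simp add: ennreal_mult')
  also have "\<dots> \<le> ennreal (b powr (p - 1)) * ?I"
    by (intro mult_left_mono le) simp
  finally show ?thesis .
qed

text \<open>Minkowski's integral inequality, with a strictly positive majorant \<open>B\<close> of
  \<open>x \<mapsto> \<parallel>F(x, \<cdot>)\<parallel>\<^sub>p\<close>: Jensen's inequality for the measure \<open>B dx\<close> reduces it to Tonelli.\<close>

lemma minkowski_powr:
  fixes F :: "'a \<Rightarrow> 'b \<Rightarrow> real" and B :: "'a \<Rightarrow> real"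
  assumes "sigma_finite_measure M" "sigma_finite_measure N"
    and p: "1 < p" and b: "0 < b"
    and Fm[measurable]: "(\<lambda>(x, y). F x y) \<in> borel_measurable (M \<Otimes>\<^sub>M N)"
    and [measurable]: "B \<in> borel_measurable M" "S \<in> sets M" "T \<in> sets N"
    and F: "\<And>x y. x \<in> S \<Longrightarrow> y \<in> T \<Longrightarrow> 0 \<le> F x y" and B: "\<And>x. x \<in> S \<Longrightarrow> 0 < B x"
    and FB: "\<And>x. x \<in> S \<Longrightarrow> (\<integral>\<^sup>+y\<in>T. ennreal (F x y powr p) \<partial>N) \<le> ennreal (B x powr p)"
    and Bb: "(\<integral>\<^sup>+x\<in>S. ennreal (B x) \<partial>M) \<le> ennreal b"
    and G: "\<And>y. y \<in> T \<Longrightarrow> 0 \<le> G y"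
    and GF: "\<And>y. y \<in> T \<Longrightarrow> ennreal (G y) \<le> (\<integral>\<^sup>+x\<in>S. ennreal (F x y) \<partial>M)"
  shows "(\<integral>\<^sup>+y\<in>T. ennreal (G y powr p) \<partial>N) \<le> ennreal (b powr p)"
proof -
  interpret pair_sigma_finite M N using assms(1,2) by (simp add: pair_sigma_finite_def)
  have TN: "y \<in> space N" if "y \<in> T" for y
    using that sets.sets_into_space[OF \<open>T \<in> sets N\<close>] by auto
  have SM: "x \<in> space M" if "x \<in> S" for x
    using that sets.sets_into_space[OF \<open>S \<in> sets M\<close>] by auto
  have pt: "ennreal (G y powr p) * indicator T y \<le> ennreal (b powr (p - 1)) *
     (\<integral>\<^sup>+x. (ennreal (F x y powr p * B x powr (1 - p)) * indicator S x) * indicator T y \<partial>M)" for y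
  proof (cases "y \<in> T")
    case True
    have [measurable]: "(\<lambda>x. F x y) \<in> borel_measurable M"
      using TN[OF True] by measurable
    have "ennreal (G y powr p) \<le> ennreal (b powr (p - 1)) *
       (\<integral>\<^sup>+x\<in>S. ennreal (F x y powr p * B x powr (1 - p)) \<partial>M)"
      by (rule jensen_powr[OF p b]) (use True G GF F B Bb in auto)
    then show ?thesis using True by simp
  qed simp
  have "(\<integral>\<^sup>+y\<in>T. ennreal (G y powr p) \<partial>N) \<le> (\<integral>\<^sup>+y. ennreal (b powr (p - 1)) *
     (\<integral>\<^sup>+x. (ennreal (F x y powr p * B x powr (1 - p)) * indicator S x) * indicator T y \<partial>M) \<partial>N)"
    by (rule nn_integral_mono) (rule pt)
  also have "\<dots> = ennreal (b powr (p - 1)) * (\<integral>\<^sup>+y.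
     (\<integral>\<^sup>+x. (ennreal (F x y powr p * B x powr (1 - p)) * indicator S x) * indicator T y \<partial>M) \<partial>N)"
    by (rule nn_integral_cmult) measurable
  also have "(\<integral>\<^sup>+y. (\<integral>\<^sup>+x. (ennreal (F x y powr p * B x powr (1 - p)) * indicator S x) * indicator T y \<partial>M) \<partial>N)
     = (\<integral>\<^sup>+x. (\<integral>\<^sup>+y. (ennreal (F x y powr p * B x powr (1 - p)) * indicator S x) * indicator T y \<partial>N) \<partial>M)"
    by (rule Fubini') measurable
  \<comment> \<open>For fixed x the weight B powr (1 - p) cancels the bound B powr p down to a
    single factor B, so the inner integral is at most B x.\<close>
  also have "\<dots> \<le> (\<integral>\<^sup>+x\<in>S. ennreal (B x) \<partial>M)"
  proof (rule nn_integral_mono)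
    fix x assume "x \<in> space M"
    show "(\<integral>\<^sup>+y. (ennreal (F x y powr p * B x powr (1 - p)) * indicator S x) * indicator T y \<partial>N)
       \<le> ennreal (B x) * indicator S x"
    proof (cases "x \<in> S")
      case True
      have [measurable]: "(\<lambda>y. F x y) \<in> borel_measurable N"
        using SM[OF True] by measurable
      have "(\<integral>\<^sup>+y. (ennreal (F x y powr p * B x powr (1 - p)) * indicator S x) * indicator T y \<partial>N)
        = (\<integral>\<^sup>+y. ennreal (B x powr (1 - p)) * (ennreal (F x y powr p) * indicator T y) \<partial>N)"
        using True by (intro nn_integral_cong) (simp add: ennreal_mult mult_ac)
      also have "\<dots> = ennreal (B x powr (1 - p)) * (\<integral>\<^sup>+y\<in>T. ennreal (F x y powr p) \<partial>N)"
        by (rule nn_integral_cmult) measurable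
      also have "\<dots> \<le> ennreal (B x powr (1 - p)) * ennreal (B x powr p)"
        by (intro mult_left_mono FB True) simp
      also have "\<dots> = ennreal (B x)"
        using B[OF True] by (simp add: powr_add[symmetric] flip: ennreal_mult)
      finally show ?thesis using True by simp
    qed simp
  qed
  also have "\<dots> \<le> ennreal b" by (rule Bb)
  finally have "(\<integral>\<^sup>+y\<in>T. ennreal (G y powr p) \<partial>N) \<le> ennreal (b powr (p - 1)) * ennreal b"
    by (simp add: mult_left_mono)
  also have "\<dots> = ennreal (b powr p)"
    using b by (simp add: powr_diff flip: ennreal_mult)
  finally show ?thesis .
qed

text \<open>Young's inequality for u / X and v / Y, integrated. X and Y are positive bounds for the
  two norms, not the norms themselves, so the division is always legitimate.\<close>

lemma hoelder_powr:
  fixes u v :: "'a \<Rightarrow> real"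
  assumes ab: "1 < a" "1 < b" "1 / a + 1 / b = 1" and XY: "0 < X" "0 < Y"
    and [measurable]: "u \<in> borel_measurable M" "v \<in> borel_measurable M" "S \<in> sets M"
    and uv: "\<And>x. x \<in> S \<Longrightarrow> 0 \<le> u x" "\<And>x. x \<in> S \<Longrightarrow> 0 \<le> v x"
    and u: "(\<integral>\<^sup>+x\<in>S. ennreal (u x powr a) \<partial>M) \<le> ennreal (X powr a)"
    and v: "(\<integral>\<^sup>+x\<in>S. ennreal (v x powr b) \<partial>M) \<le> ennreal (Y powr b)"
  shows "(\<integral>\<^sup>+x\<in>S. ennreal (u x * v x) \<partial>M) \<le> ennreal (X * Y)"
proof -
  have pt: "u x * v x \<le> (X * Y * X powr (-a) / a) * u x powr a + (X * Y * Y powr (-b) / b) * v x powr b"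
    if "x \<in> S" for x
  proof -
    have "(u x / X) * (v x / Y) \<le> (u x / X) powr a / a + (v x / Y) powr b / b"
      using ab XY uv[OF that] by (intro Youngs_inequality) auto
    then have "X * Y * ((u x / X) * (v x / Y)) \<le> X * Y * ((u x / X) powr a / a + (v x / Y) powr b / b)"
      using XY by (intro mult_left_mono) auto
    then show ?thesis using XY uv[OF that] 
      by (simp add: powr_divide powr_minus field_simps)
  qed
  have "(\<integral>\<^sup>+x\<in>S. ennreal (u x * v x) \<partial>M) \<le>
     (\<integral>\<^sup>+x. ennreal (X * Y * X powr (-a) / a) * (ennreal (u x powr a) * indicator S x)
        + ennreal (X * Y * Y powr (-b) / b) * (ennreal (v x powr b) * indicator S x) \<partial>M)"
  proof (rule nn_integral_mono)
    fix x
    show "ennreal (u x * v x) * indicator S x \<le> 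
      ennreal (X * Y * X powr (-a) / a) * (ennreal (u x powr a) * indicator S x)
        + ennreal (X * Y * Y powr (-b) / b) * (ennreal (v x powr b) * indicator S x)"
    proof (cases "x \<in> S")
      case True
      show ?thesis using pt[OF True] True XY ab uv[OF True]
        by (simp flip: ennreal_mult ennreal_plus) 
    qed simp
  qed
  also have "\<dots> = ennreal (X * Y * X powr (-a) / a) * (\<integral>\<^sup>+x\<in>S. ennreal (u x powr a) \<partial>M)
        + ennreal (X * Y * Y powr (-b) / b) * (\<integral>\<^sup>+x\<in>S. ennreal (v x powr b) \<partial>M)"
    by (simp add: nn_integral_add nn_integral_cmult)
  also have "\<dots> \<le> ennreal (X * Y * X powr (-a) / a) * ennreal (X powr a)
        + ennreal (X * Y * Y powr (-b) / b) * ennreal (Y powr b)"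
    by (intro add_mono mult_left_mono u v) auto
  also have "\<dots> = ennreal (X * Y * (1 / a + 1 / b))"
    using XY ab by (simp flip: ennreal_mult ennreal_plus add: powr_minus field_simps)
  finally show ?thesis using ab by simp
qed

section \<open>Means over circles and Cauchy integrals\<close>

abbreviation nnint :: "real set \<Rightarrow> (real \<Rightarrow> real) \<Rightarrow> ennreal" where
  "nnint S u \<equiv> (\<integral>\<^sup>+t\<in>S. ennreal (u t) \<partial>lborel)"

text \<open>A function holomorphic on the disc is arbitrary elsewhere and hence not measurable as a
  function on the plane. Cutting by 0 gives a Borel function that may be composed freely with maps
  of two variables in Tonelli arguments.\<close>

definition disc_cut :: "(complex \<Rightarrow> complex) \<Rightarrow> complex \<Rightarrow> complex" where
  "disc_cut f z = (if z \<in> ball 0 1 then f z else 0)"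

lemma disc_cut_eq [simp]: "norm z < 1 \<Longrightarrow> disc_cut f z = f z"
  by (simp add: disc_cut_def)

lemma borel_measurable_disc_cut:
  assumes "continuous_on (ball 0 1) f"
  shows "disc_cut f \<in> borel_measurable borel"
  unfolding disc_cut_def
  by (intro borel_measurable_continuous_on_if assms) auto

lemma borel_measurable_cis [measurable]: "cis \<in> borel_measurable borel"
  by (intro borel_measurable_continuous_onI) (auto intro!: continuous_intros)

lemma nn_integral_Icc_continuous:
  fixes h :: "real \<Rightarrow> real"
  assumes "continuous_on {a..b} h" "\<And>t. t \<in> {a..b} \<Longrightarrow> 0 \<le> h t"
  shows "nnint {a..b} (\<lambda>t. h t) = ennreal (integral {a..b} h)"
  using assms by (intro nn_integral_has_integral_lebesgue' integrable_integral
      integrable_continuous_interval) auto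

lemma norm_integral_le_nn_integral:
  fixes f :: "real \<Rightarrow> complex"
  assumes f: "continuous_on {a..b} f"
  shows "ennreal (norm (integral {a..b} f)) \<le> nnint {a..b} (\<lambda>t. norm (f t))"
proof -
  have "continuous_on {a..b} (\<lambda>t. norm (f t))" by (intro continuous_intros f)
  then show ?thesis
    by (subst nn_integral_Icc_continuous)
       (auto intro!: ennreal_leI integral_norm_bound_integral integrable_continuous_interval f)
qed

lemma continuous_on_circle:
  assumes "continuous_on (ball 0 1) f" "\<bar>r\<bar> < 1"
  shows "continuous_on A (\<lambda>t. f (of_real r * cis t))"
  using assms by (intro continuous_on_compose2[OF assms(1)] continuous_intros)
    (auto simp: norm_mult)

lemma integral_mean_eq:
  assumes f: "continuous_on (ball 0 1) f" and r: "\<bar>r\<bar> < 1" and p: "0 < p"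
  shows "integral_mean p r f =
    (1 / (2 * pi) * integral {0..2*pi} (\<lambda>t. norm (f (of_real r * cis t)) powr p)) powr (1 / p)"
proof -
  have c: "continuous_on {0..2*pi} (\<lambda>t. norm (f (of_real r * cis t)) powr p)"
    using p by (intro continuous_intros continuous_on_powr' continuous_on_circle f r) auto
  show ?thesis
    unfolding integral_mean_def
    by (subst lebesgue_integral_eq_integral) (auto intro!: continuous_imp_integrable_real c)
qed

lemma normalized_root_le_iff:
  fixes I K p :: real
  assumes I0: "0 \<le> I" and p: "0 < p" and K: "0 \<le> K"
  shows "(1 / (2 * pi) * I) powr (1 / p) \<le> K \<longleftrightarrow> ennreal I \<le> ennreal (2 * pi * K powr p)"
proof -
  have "(1 / (2 * pi) * I) powr (1 / p) \<le> K \<longleftrightarrow> 1 / (2 * pi) * I \<le> K powr p"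
  proof
    assume "(1 / (2 * pi) * I) powr (1 / p) \<le> K"
    then have "((1 / (2 * pi) * I) powr (1 / p)) powr p \<le> K powr p"
      using p by (intro powr_mono2) auto
    then show "1 / (2 * pi) * I \<le> K powr p" using p I0 by (simp add: powr_powr)
  next
    assume "1 / (2 * pi) * I \<le> K powr p"
    then have "(1 / (2 * pi) * I) powr (1 / p) \<le> (K powr p) powr (1 / p)"
      using p I0 by (intro powr_mono2) auto
    then show "(1 / (2 * pi) * I) powr (1 / p) \<le> K" using p K by (simp add: powr_powr)
  qed
  also have "\<dots> \<longleftrightarrow> I \<le> 2 * pi * K powr p" by (simp add: field_simps)
  also have "\<dots> \<longleftrightarrow> ennreal I \<le> ennreal (2 * pi * K powr p)"
    using I0 by (subst ennreal_le_iff) auto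
  finally show ?thesis .
qed

text \<open>The dictionary for all later estimates: they are made on the right-hand side, where
  integrals always exist and Tonelli applies, and the mean on the left is recovered at the
  end.\<close>

lemma integral_mean_le_iff:
  assumes f: "continuous_on (ball 0 1) f" and r: "\<bar>r\<bar> < 1" and p: "0 < p" and K: "0 \<le> K"
  shows "integral_mean p r f \<le> K \<longleftrightarrow>
    nnint {0..2*pi} (\<lambda>t. norm (f (of_real r * cis t)) powr p)
      \<le> ennreal (2 * pi * K powr p)"
proof -
  have c: "continuous_on {0..2*pi} (\<lambda>t. norm (f (of_real r * cis t)) powr p)"
    using p by (intro continuous_intros continuous_on_powr' continuous_on_circle f r) auto
  then have I0: "0 \<le> integral {0..2*pi} (\<lambda>t. norm (f (of_real r * cis t)) powr p)"
    by (intro integral_nonneg integrable_continuous_interval) auto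
  show ?thesis
    unfolding integral_mean_eq[OF f r p] normalized_root_le_iff[OF I0 p K]
    by (subst nn_integral_Icc_continuous[OF c]) auto
qed

lemma integral_mean_nonneg [simp]: "0 \<le> integral_mean p r f"
  by (simp add: integral_mean_def)

section \<open>Rotation invariance of integrals over the circle\<close>

lemma nn_integral_periodic_shift:
  fixes u :: "real \<Rightarrow> ennreal"
  assumes [measurable]: "u \<in> borel_measurable borel"
    and per: "\<And>t. u (t + 2 * pi) = u t" and h: "0 \<le> h" "h \<le> 2 * pi"
  shows "(\<integral>\<^sup>+t\<in>{0..2*pi}. u (t + h) \<partial>lborel) = (\<integral>\<^sup>+t\<in>{0..2*pi}. u t \<partial>lborel)"
proof -
  have sh: "(\<integral>\<^sup>+t\<in>A. v t \<partial>lborel) = (\<integral>\<^sup>+t. v (c + t) * indicator A (c + t) \<partial>lborel)"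
    if [measurable]: "v \<in> borel_measurable borel" "A \<in> sets borel"
    for v :: "real \<Rightarrow> ennreal" and A c
    by (subst nn_integral_real_affine[where c = 1 and t = c]) auto
  have "(\<integral>\<^sup>+t\<in>{0..2*pi}. u (t + h) \<partial>lborel) = (\<integral>\<^sup>+t\<in>{h..h+2*pi}. u t \<partial>lborel)"
    by (subst sh[where c = h]) (auto simp: indicator_def add_ac intro!: nn_integral_cong)
  also have "\<dots> = (\<integral>\<^sup>+t. u t * indicator {h..2*pi} t + u t * indicator {2*pi<..2*pi+h} t \<partial>lborel)"
    using h by (intro nn_integral_cong) (auto simp: indicator_def)
  also have "\<dots> = (\<integral>\<^sup>+t\<in>{h..2*pi}. u t \<partial>lborel) + (\<integral>\<^sup>+t\<in>{2*pi<..2*pi+h}. u t \<partial>lborel)"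
    by (rule nn_integral_add) auto
  also have "(\<integral>\<^sup>+t\<in>{2*pi<..2*pi+h}. u t \<partial>lborel) = (\<integral>\<^sup>+t\<in>{0<..h}. u t \<partial>lborel)"
    using per by (subst sh[where c = "2*pi"]) (auto simp: indicator_def add_ac intro!: nn_integral_cong)
  \<comment> \<open>The piece moved back by one period is open at 0 and closed at h. To be joined to
    {h..2*pi} without overlap it has to be open at h; the change affects only a null set.\<close>
  also have "\<dots> = (\<integral>\<^sup>+t\<in>{0..<h}. u t \<partial>lborel)"
    by (rule nn_integral_cong_AE)
       (use AE_lborel_singleton[of 0] AE_lborel_singleton[of h] in eventually_elim, auto simp: indicator_def)
  also have "(\<integral>\<^sup>+t\<in>{h..2*pi}. u t \<partial>lborel) + (\<integral>\<^sup>+t\<in>{0..<h}. u t \<partial>lborel)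
      = (\<integral>\<^sup>+t. u t * indicator {h..2*pi} t + u t * indicator {0..<h} t \<partial>lborel)"
    by (rule nn_integral_add[symmetric]) auto
  also have "\<dots> = (\<integral>\<^sup>+t\<in>{0..2*pi}. u t \<partial>lborel)"
    using h by (intro nn_integral_cong) (auto simp: indicator_def)
  finally show ?thesis .
qed

lemma cis_periodic: "cis (t + 2 * pi) = cis t"
  by (simp add: complex_eq_iff)

lemma nn_integral_circle_shift:
  fixes u :: "complex \<Rightarrow> ennreal"
  assumes [measurable]: "(\<lambda>t. u (cis t)) \<in> borel_measurable borel" and h: "0 \<le> h" "h \<le> 2 * pi"
  shows "(\<integral>\<^sup>+t\<in>{0..2*pi}. u (cis (t + h)) \<partial>lborel) = (\<integral>\<^sup>+t\<in>{0..2*pi}. u (cis t) \<partial>lborel)"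
  using nn_integral_periodic_shift[of "\<lambda>t. u (cis t)" h] h by (simp add: cis_periodic)

section \<open>Integrals of powers and homogeneous kernels\<close>

lemma nn_integral_powr_Ioo:
  assumes "-1 < a" "0 \<le> c"
  shows "nnint {0<..<c} (\<lambda>x. x powr a) = ennreal (c powr (a + 1) / (a + 1))"
proof -
  have "nnint {0<..<c} (\<lambda>x. x powr a) = nnint {0..c} (\<lambda>x. x powr a)"
    by (rule nn_integral_cong_AE)
       (use AE_lborel_singleton[of 0] AE_lborel_singleton[of c] in eventually_elim, auto simp: indicator_def)
  then show ?thesis
    using nn_integral_has_integral_lebesgue'[OF _ has_integral_powr_from_0[OF assms]] by auto
qed

lemma nn_integral_powr_atLeast:
  assumes "a < -1" "0 < c"
  shows "nnint {c..} (\<lambda>x. x powr a) = ennreal (- (c powr (a + 1)) / (a + 1))"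
  using nn_integral_has_integral_lebesgue'[OF _ has_integral_powr_to_inf[OF assms]] by auto

lemma nn_integral_one_minus_powr:
  assumes "-1 < a" "\<rho> \<le> 1"
  shows "nnint {\<rho><..<1} (\<lambda>x. (1 - x) powr a) = ennreal ((1 - \<rho>) powr (a + 1) / (a + 1))"
proof -
  have "nnint {\<rho><..<1} (\<lambda>x. (1 - x) powr a)
     = nnint {0<..<1-\<rho>} (\<lambda>x. x powr a)"
    by (subst nn_integral_real_affine[where c = "-1" and t = 1])
       (auto simp: indicator_def intro!: nn_integral_cong)
  then show ?thesis using nn_integral_powr_Ioo[of a "1 - \<rho>"] assms by simp
qed

text \<open>The kernel is dominated by u powr a near 0 and by u powr (a - 2) at infinity, whence the
  two summands of the constant. It is used with a = 1/q for the Cauchy kernel and with a = -1/p for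
  the Poisson kernel.\<close>

lemma nn_integral_powr_cauchy_kernel:
  assumes "-1 < a" "a < 1"
  obtains b where "0 < b" "nnint {0<..} (\<lambda>u. u powr a / (1 + u\<^sup>2)) \<le> ennreal b"
proof
  let ?b = "1 / (a + 1) + 1 / (1 - a)"
  show "0 < ?b" using assms by (simp add: add_pos_pos)
  have "nnint {0<..} (\<lambda>u. u powr a / (1 + u\<^sup>2)) \<le>
     (\<integral>\<^sup>+u. ennreal (u powr a) * indicator {0<..<1} u + ennreal (u powr (a - 2)) * indicator {1..} u \<partial>lborel)"
  proof (intro nn_integral_mono)
    fix u :: real
    consider "u \<le> 0" | "0 < u" "u < 1" | "1 \<le> u" by linarith
    then show "ennreal (u powr a / (1 + u\<^sup>2)) * indicator {0<..} u \<le>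
       ennreal (u powr a) * indicator {0<..<1} u + ennreal (u powr (a - 2)) * indicator {1..} u"
    proof cases
      case 2
      have "1 \<le> 1 + u\<^sup>2" by simp
      then have "u powr a / (1 + u\<^sup>2) \<le> u powr a / 1" by (intro divide_left_mono) (auto intro: add_pos_nonneg)
      then show ?thesis using 2 by (auto intro: ennreal_leI)
    next
      case 3
      have "u powr a / (1 + u\<^sup>2) \<le> u powr a / u powr 2"
        using 3 by (intro divide_left_mono) (auto intro!: mult_pos_pos add_pos_nonneg)
      then show ?thesis using 3 by (auto intro: ennreal_leI simp: powr_diff)
    qed auto
  qed
  also have "\<dots> = ennreal (1 / (a + 1)) + ennreal (- 1 / (a - 1))"
    using nn_integral_powr_Ioo[of a 1] nn_integral_powr_atLeast[of "a - 2" 1] assms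
    by (subst nn_integral_add) auto
  also have "- 1 / (a - 1) = 1 / (1 - a)" using assms by (simp add: field_simps)
  also have "ennreal (1 / (a + 1)) + ennreal (1 / (1 - a)) = ennreal ?b"
    using assms by (intro ennreal_plus[symmetric]) auto
  finally show "nnint {0<..} (\<lambda>u. u powr a / (1 + u\<^sup>2)) \<le> ennreal ?b" .
qed

text \<open>Minkowski's inequality over dilations: \<phi>(x u) as a function of x has norm u powr
  (-1/p) times that of \<phi>, so the operator norm is at most the integral of \<kappa> against this
  factor. Both Fejer-Riesz and Hardy's inequality are instances.\<close>

lemma homogeneous_kernel_bound:
  fixes \<phi> \<kappa> G :: "real \<Rightarrow> real"
  assumes p: "1 < p" and A: "0 < A" and b: "0 < b"
    and [measurable]: "\<phi> \<in> borel_measurable borel" "\<kappa> \<in> borel_measurable borel"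
      "U \<in> sets borel" "T \<in> sets borel"
    and U: "U \<subseteq> {0<..}" and T: "T \<subseteq> {0<..}"
    and \<phi>: "\<And>y. 0 \<le> \<phi> y" and \<kappa>: "\<And>u. u \<in> U \<Longrightarrow> 0 < \<kappa> u"
    and \<phi>A: "nnint {0<..} (\<lambda>y. \<phi> y powr p) \<le> ennreal (A powr p)"
    and \<kappa>b: "nnint U (\<lambda>u. \<kappa> u * u powr (- 1 / p)) \<le> ennreal b"
    and G: "\<And>x. x \<in> T \<Longrightarrow> 0 \<le> G x"
    and G\<phi>: "\<And>x. x \<in> T \<Longrightarrow> ennreal (G x) \<le> nnint U (\<lambda>u. \<phi> (x * u) * \<kappa> u)"
  shows "nnint T (\<lambda>x. G x powr p) \<le> ennreal ((b * A) powr p)"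
proof (rule minkowski_powr[where M = lborel and N = lborel and S = U and
      F = "\<lambda>u x. \<phi> (x * u) * \<kappa> u" and B = "\<lambda>u. \<kappa> u * u powr (- 1 / p) * A"])
  show "(\<lambda>(u, x). \<phi> (x * u) * \<kappa> u) \<in> borel_measurable (lborel \<Otimes>\<^sub>M lborel)"
    by measurable
  show "nnint U (\<lambda>u. \<kappa> u * u powr (- 1 / p) * A) \<le> ennreal (b * A)"
  proof -
    have "nnint U (\<lambda>u. \<kappa> u * u powr (- 1 / p) * A)
       = (\<integral>\<^sup>+u. ennreal (\<kappa> u * u powr (- 1 / p)) * indicator U u * ennreal A \<partial>lborel)"
      using \<kappa> A by (intro nn_integral_cong) (auto simp: indicator_def ennreal_mult'')
    also have "\<dots> = nnint U (\<lambda>u. \<kappa> u * u powr (- 1 / p)) * ennreal A"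
      by (rule nn_integral_multc) auto
    also have "\<dots> \<le> ennreal b * ennreal A" by (intro mult_right_mono \<kappa>b) auto
    finally show ?thesis using b A by (simp add: ennreal_mult')
  qed
  fix u assume u: "u \<in> U"
  then have u0: "0 < u" "0 < \<kappa> u" using U \<kappa> by auto
  show "nnint T (\<lambda>x. (\<phi> (x * u) * \<kappa> u) powr p)
      \<le> ennreal ((\<kappa> u * u powr (- 1 / p) * A) powr p)"
  proof -
    have "nnint T (\<lambda>x. (\<phi> (x * u) * \<kappa> u) powr p)
       \<le> (\<integral>\<^sup>+x. ennreal (\<kappa> u powr p) * (ennreal (\<phi> (0 + u * x) powr p) * indicator {0<..} (0 + u * x)) \<partial>lborel)"
      using u0 \<phi> T by (intro nn_integral_mono)
        (auto simp: indicator_def powr_mult ennreal_mult mult_ac zero_less_mult_iff)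
    also have "\<dots> = ennreal (\<kappa> u powr p) * (\<integral>\<^sup>+x. (ennreal (\<phi> (0 + u * x) powr p) * indicator {0<..} (0 + u * x)) \<partial>lborel)"
      by (rule nn_integral_cmult) measurable
    also have "(\<integral>\<^sup>+x. (ennreal (\<phi> (0 + u * x) powr p) * indicator {0<..} (0 + u * x)) \<partial>lborel)
      = ennreal (1 / u) * nnint {0<..} (\<lambda>y. \<phi> y powr p)"
      using u0 by (subst (2) nn_integral_real_affine[where c = u and t = 0])
        (auto simp: mult.assoc[symmetric] simp flip: ennreal_mult)
    also have "ennreal (\<kappa> u powr p) * (ennreal (1 / u) * nnint {0<..} (\<lambda>y. \<phi> y powr p))
      \<le> ennreal (\<kappa> u powr p) * (ennreal (1 / u) * ennreal (A powr p))"
      by (intro mult_left_mono \<phi>A) auto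
    also have "\<dots> = ennreal ((\<kappa> u * u powr (- 1 / p) * A) powr p)"
      using u0 A p by (simp add: powr_mult powr_divide powr_powr powr_minus_divide flip: ennreal_mult)
    finally show ?thesis .
  qed
qed (use p A b \<phi> \<kappa> U G G\<phi> in \<open>auto simp: less_imp_le intro!: sigma_finite_lborel mult_pos_pos\<close>)

section \<open>Cauchy and Poisson formulas on circles inside the disc\<close>

lemma has_integral_Cauchy_deriv_circle:
  fixes f :: "complex \<Rightarrow> complex" and w :: complex
  assumes f: "f holomorphic_on ball 0 1" and R: "R < 1" "norm w < R"
  shows "((\<lambda>t. f (of_real R * cis t) * (of_real R * cis t / (of_real R * cis t - w)\<^sup>2))
     has_integral (2 * pi * deriv f w)) {0..2*pi}"
proof -
  have "((\<lambda>u. f u / (u - w) ^ Suc 1) has_contour_integral (of_real (2 * pi) * \<i> / fact 1 * (deriv ^^ 1) f w)) (circlepath 0 R)"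
    using R f by (intro Cauchy_has_contour_integral_higher_derivative_circlepath holomorphic_on_imp_continuous_on)
      (auto intro: holomorphic_on_subset)
  then have "((\<lambda>t. f (of_real R * cis t) / (of_real R * cis t - w)\<^sup>2 * of_real R * \<i> * cis t) has_integral
     (2 * of_real pi * \<i> * deriv f w)) {0..2*pi}"
    unfolding circlepath_def by (subst (asm) has_contour_integral_part_circlepath_iff) (auto simp: numeral_2_eq_2)
  from has_integral_mult_right[OF this, of "- \<i>"] show ?thesis
    by (auto simp: mult_ac)
qed

lemma circle_minus_nonzero:
  assumes "\<bar>r\<bar> < R" shows "of_real R * cis t - complex_of_real r \<noteq> 0"
proof
  assume "of_real R * cis t - complex_of_real r = 0"
  then have "norm (of_real R * cis t) = norm (complex_of_real r)" by simp
  then show False using assms by (simp add: norm_mult)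
qed

lemma has_integral_Poisson:
  fixes f :: "complex \<Rightarrow> complex"
  assumes f: "f holomorphic_on ball 0 1" and R: "R < 1" "0 \<le> r" "r < R"
  shows "((\<lambda>t. f (of_real R * cis t) * of_real ((R\<^sup>2 - r\<^sup>2) / (norm (of_real R * cis t - r))\<^sup>2))
     has_integral (2 * pi * f r)) {0..2*pi}"
proof -
  define F where "F u = f u * of_real (R\<^sup>2 - r\<^sup>2) / (of_real (R\<^sup>2) - of_real r * u)" for u
  \<comment> \<open>The extra factor is holomorphic in the disc and equals 1 at \<open>r\<close>; on the circle
    \<open>\<bar>u\<bar> = R\<close> it turns the Cauchy kernel into the Poisson kernel.\<close>
  have nz: "of_real (R\<^sup>2) - of_real r * u \<noteq> 0" if "norm u < 1" "r * norm u < R\<^sup>2" for u :: complex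
  proof
    assume "of_real (R\<^sup>2) - of_real r * u = 0"
    then have "norm (of_real (R\<^sup>2) :: complex) = norm (of_real r * u)" by simp
    then show False using that R by (simp add: norm_mult norm_power)
  qed
  have RR: "r * R < R\<^sup>2" using R by (simp add: power2_eq_square)
  have le: "r * norm u < R\<^sup>2" if "norm u \<le> R" for u :: complex
    using RR mult_left_mono[OF that R(2)] by linarith
  have c: "continuous_on (cball 0 R) F" unfolding F_def
    using R by (intro continuous_intros holomorphic_on_imp_continuous_on
      holomorphic_on_subset[OF f]) (use nz le in force)+
  have h: "F holomorphic_on ball 0 R" unfolding F_def
    using R by (intro holomorphic_intros holomorphic_on_subset[OF f]) (use nz le in force)+
  have "((\<lambda>u. F u / (u - r)) has_contour_integral (2 * of_real pi * \<i> * F r)) (circlepath 0 R)"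
    using R by (intro Cauchy_integral_circlepath c h) auto
  moreover have "F r = f r"
  proof -
    have "(of_real (R\<^sup>2 - r\<^sup>2) :: complex) = of_real (R\<^sup>2) - of_real r * of_real r"
      by (simp add: power2_eq_square)
    moreover have "of_real (R\<^sup>2) - of_real r * of_real r \<noteq> (0 :: complex)"
      using nz[of "of_real r"] le[of "of_real r"] R by auto
    ultimately show ?thesis by (simp add: F_def)
  qed
  ultimately have "((\<lambda>t. F (of_real R * cis t) / (of_real R * cis t - r) * of_real R * \<i> * cis t) has_integral
     (2 * of_real pi * \<i> * f r)) {0..2*pi}"
    unfolding circlepath_def by (subst (asm) has_contour_integral_part_circlepath_iff) auto
  from has_integral_mult_right[OF this, of "- \<i>"]
  have "((\<lambda>t. F (of_real R * cis t) * (of_real R * cis t / (of_real R * cis t - r))) has_integral (2 * pi * f r)) {0..2*pi}"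
    by (auto simp: mult_ac)
  moreover have "F (of_real R * cis t) * (of_real R * cis t / (of_real R * cis t - r))
     = f (of_real R * cis t) * of_real ((R\<^sup>2 - r\<^sup>2) / (norm (of_real R * cis t - r))\<^sup>2)" for t
  proof -
    define u where "u = of_real R * cis t"
    have uc: "u * cnj u = of_real (R\<^sup>2)"
      unfolding u_def by (simp add: power2_eq_square cis_cnj cis_mult)
    have nr: "u - r \<noteq> 0" unfolding u_def using R by (intro circle_minus_nonzero) auto
    have u0: "u \<noteq> 0" using R by (simp add: u_def)
    have "of_real ((norm (u - r))\<^sup>2) = (u - r) * cnj (u - r)"
      by (rule complex_norm_square)
    also have "\<dots> * u = (u - r) * (u * cnj u - r * u)" by (simp add: algebra_simps)
    finally have eq: "of_real ((norm (u - r))\<^sup>2) * u = (u - r) * (of_real (R\<^sup>2) - r * u)"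
      unfolding uc .
    have nn: "of_real (R\<^sup>2) - r * u \<noteq> 0"
      using nz[of u] le[of u] R by (auto simp: u_def norm_mult)
    have n2: "complex_of_real ((norm (u - r))\<^sup>2) \<noteq> 0" using nr by simp
    have "of_real (R\<^sup>2 - r\<^sup>2) / (of_real (R\<^sup>2) - of_real r * u) * (u / (u - r))
       = of_real (R\<^sup>2 - r\<^sup>2) / of_real ((norm (u - r))\<^sup>2)"
      using eq nn nr n2 by (simp add: divide_eq_eq eq_divide_eq) (metis mult.commute mult.assoc)
    then have "f u * (of_real (R\<^sup>2 - r\<^sup>2) / (of_real (R\<^sup>2) - of_real r * u) * (u / (u - r)))
       = f u * (of_real (R\<^sup>2 - r\<^sup>2) / of_real ((norm (u - r))\<^sup>2))" by (rule arg_cong)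
    then show ?thesis unfolding F_def u_def[symmetric] of_real_divide
      by (simp only: times_divide_eq_right times_divide_eq_left mult.assoc)
  qed
  ultimately show ?thesis by simp
qed

text \<open>Minkowski's integral inequality over the two-point space \<open>bool\<close> with
  counting measure; the majorant B takes the two values X and Y, which is why both are
  positive.\<close>

lemma triangle_powr:
  fixes u v w :: "'a \<Rightarrow> real"
  assumes "sigma_finite_measure N" and p: "1 < p" and XY: "0 < X" "0 < Y"
    and [measurable]: "u \<in> borel_measurable N" "v \<in> borel_measurable N" "T \<in> sets N"
    and uv: "\<And>x. x \<in> T \<Longrightarrow> 0 \<le> u x" "\<And>x. x \<in> T \<Longrightarrow> 0 \<le> v x"
    and u: "(\<integral>\<^sup>+x\<in>T. ennreal (u x powr p) \<partial>N) \<le> ennreal (X powr p)"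
    and v: "(\<integral>\<^sup>+x\<in>T. ennreal (v x powr p) \<partial>N) \<le> ennreal (Y powr p)"
    and w: "\<And>x. x \<in> T \<Longrightarrow> 0 \<le> w x" "\<And>x. x \<in> T \<Longrightarrow> w x \<le> u x + v x"
  shows "(\<integral>\<^sup>+x\<in>T. ennreal (w x powr p) \<partial>N) \<le> ennreal ((X + Y) powr p)"
proof (rule minkowski_powr[where M = "count_space (UNIV :: bool set)" and N = N and S = UNIV and
      F = "\<lambda>b x. if b then u x else v x" and B = "\<lambda>b. if b then X else Y"])
  show "sigma_finite_measure (count_space (UNIV :: bool set))"
    by (intro sigma_finite_measure_count_space_finite) auto
  show "(\<lambda>(b, x). if b then u x else v x) \<in> borel_measurable (count_space UNIV \<Otimes>\<^sub>M N)"
    by measurable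
  show "(\<integral>\<^sup>+b\<in>UNIV. ennreal (if b then X else Y) \<partial>count_space (UNIV :: bool set)) \<le> ennreal (X + Y)"
    using XY by (simp add: nn_integral_count_space_finite UNIV_bool add.commute flip: ennreal_plus)
  fix x assume x: "x \<in> T"
  show "ennreal (w x) \<le> (\<integral>\<^sup>+b\<in>UNIV. ennreal (if b then u x else v x) \<partial>count_space (UNIV :: bool set))"
    using uv[OF x] w(2)[OF x]
    by (simp add: nn_integral_count_space_finite UNIV_bool add.commute ennreal_leI flip: ennreal_plus)
qed (use p XY uv u v w(1) assms(1) in auto)

lemma deriv_rotate:
  assumes "f holomorphic_on ball 0 1" "norm w < 1"
  shows "deriv (\<lambda>z. f (cis t * z)) w = cis t * deriv f (cis t * w)"
proof -
  have "(f has_field_derivative deriv f (cis t * w)) (at (cis t * w))"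
    using assms by (intro holomorphic_derivI[of f "ball 0 1"]) (auto simp: norm_mult)
  then have "((f \<circ> (\<lambda>z. cis t * z)) has_field_derivative deriv f (cis t * w) * cis t) (at w)"
    by (rule DERIV_chain) (auto intro!: derivative_eq_intros)
  then show ?thesis by (auto simp: o_def mult_ac intro!: DERIV_imp_deriv)
qed

lemma holomorphic_on_rotate:
  assumes "f holomorphic_on ball 0 1"
  shows "(\<lambda>z. f (cis t * z)) holomorphic_on ball 0 1"
proof -
  have "(f \<circ> (\<lambda>z. cis t * z)) holomorphic_on ball 0 1"
    by (intro holomorphic_on_compose_gen[OF _ assms] holomorphic_intros) (auto simp: norm_mult)
  then show ?thesis by (simp add: o_def)
qed

text \<open>Poisson's formula for the constant function 1.\<close>

lemma nn_integral_circle_kernel: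
  assumes "0 \<le> r" "r < R" "R < 1"
  shows "nnint {0..2*pi} (\<lambda>t. 1 / (norm (of_real R * cis t - complex_of_real r))\<^sup>2)
     = ennreal (2 * pi / (R\<^sup>2 - r\<^sup>2))"
proof -
  have pos: "0 < R\<^sup>2 - r\<^sup>2" using assms by (simp add: power_strict_mono)
  have "((\<lambda>t. (1::complex) * of_real ((R\<^sup>2 - r\<^sup>2) / (norm (of_real R * cis t - complex_of_real r))\<^sup>2))
     has_integral (2 * pi * 1)) {0..2*pi}"
    using has_integral_Poisson[of "\<lambda>_. 1" R r] assms by simp
  from has_integral_linear[OF this bounded_linear_Re]
  have "((\<lambda>t. (R\<^sup>2 - r\<^sup>2) / (norm (of_real R * cis t - complex_of_real r))\<^sup>2) has_integral (2 * pi)) {0..2*pi}"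
    by (simp add: o_def del: of_real_divide of_real_diff of_real_power)
  from has_integral_mult_right[OF this, of "1 / (R\<^sup>2 - r\<^sup>2)"] pos
  have "((\<lambda>t. 1 / (norm (of_real R * cis t - complex_of_real r))\<^sup>2) has_integral (2 * pi / (R\<^sup>2 - r\<^sup>2))) {0..2*pi}"
    by simp
  then show ?thesis by (intro nn_integral_has_integral_lebesgue') auto
qed

abbreviation circle_powr :: "real \<Rightarrow> real \<Rightarrow> (complex \<Rightarrow> complex) \<Rightarrow> ennreal" where
  "circle_powr p r f \<equiv> (nnint {0..2*pi} (\<lambda>t. norm (f (of_real r * cis t)) powr p))"

lemma circle_powr_shift:
  assumes f: "continuous_on (ball 0 1) f" and r: "\<bar>r\<bar> < 1" and h: "0 \<le> h" "h \<le> 2 * pi"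
  shows "nnint {0..2*pi} (\<lambda>t. norm (f (of_real r * cis (t + h))) powr p) = circle_powr p r f"
proof -
  have [measurable]: "(\<lambda>t. f (of_real r * cis t)) \<in> borel_measurable borel"
    by (intro borel_measurable_continuous_onI continuous_on_circle f r)
  show ?thesis
    by (rule nn_integral_circle_shift[of "\<lambda>z. ennreal (norm (f (of_real r * z)) powr p)"])
       (use h in auto)
qed

text \<open>Cauchy's formula writes f' on the circle of radius a as a superposition of rotations of
  f on the circle of radius R. All rotations have the same mean, so Minkowski leaves the total mass
  of the kernel.\<close>

lemma circle_powr_deriv_le:
  assumes f: "f holomorphic_on ball 0 1" and p: "1 < p" and K: "0 < K"
    and fK: "\<And>r. 0 < r \<Longrightarrow> r < 1 \<Longrightarrow> circle_powr p r f \<le> ennreal (2 * pi * K powr p)"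
    and a: "0 < a" "a < 1"
  shows "circle_powr p a (deriv f) \<le> ennreal (2 * pi * (2 * K / (1 - a)) powr p)"
proof -
  \<comment> \<open>The midpoint between a and 1: the mass of the kernel is at most 1 / (R - a) = 2
    / (1 - a), the source of the factor 2.\<close>
  define R where "R = (1 + a) / 2"
  have R: "0 < R" "a < R" "R < 1" using a by (auto simp: R_def)
  \<comment> \<open>The modulus of the Cauchy kernel for the derivative, divided by 2 * pi.\<close>
  define k where "k \<theta> = R / (2 * pi * (norm (of_real R * cis \<theta> - complex_of_real a))\<^sup>2)" for \<theta>
  \<comment> \<open>The L^p norm of the constant 1 on the unnormalised circle. Means are normalised
    and integrals over {0..2*pi} are not; a constant of this kind converts between them here and in
    the later lemmas.\<close>
  define c where "c = (2 * pi) powr (1 / p)"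
  have c: "0 < c" "c powr p = 2 * pi" using p by (auto simp: c_def powr_powr)
  have fc: "continuous_on (ball 0 1) f" using f by (rule holomorphic_on_imp_continuous_on)
  have [measurable]: "disc_cut f \<in> borel_measurable borel" by (rule borel_measurable_disc_cut[OF fc])
  have nz: "of_real R * cis \<theta> - complex_of_real a \<noteq> 0" for \<theta>
    by (intro circle_minus_nonzero) (use R a in auto)
  have k0: "0 < k \<theta>" for \<theta> using R nz[of \<theta>] by (simp add: k_def)
  have km[measurable]: "k \<in> borel_measurable borel" unfolding k_def by measurable
  have kint: "nnint {0..2*pi} (\<lambda>\<theta>. k \<theta>) \<le> ennreal (2 / (1 - a))"
  proof -
    have "nnint {0..2*pi} (\<lambda>\<theta>. k \<theta>) = (\<integral>\<^sup>+\<theta>. ennreal (R / (2 * pi)) *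
       (ennreal (1 / (norm (of_real R * cis \<theta> - complex_of_real a))\<^sup>2) * indicator {0..2*pi} \<theta>) \<partial>lborel)"
      using R by (intro nn_integral_cong) (auto simp: k_def indicator_def simp flip: ennreal_mult)
    also have "\<dots> = ennreal (R / (2 * pi)) * nnint {0..2*pi} (\<lambda>\<theta>. 1 / (norm (of_real R * cis \<theta> - complex_of_real a))\<^sup>2)"
      by (rule nn_integral_cmult) measurable
    also have "\<dots> = ennreal (R / (2 * pi)) * ennreal (2 * pi / (R\<^sup>2 - a\<^sup>2))"
      using R a by (subst nn_integral_circle_kernel) auto
    also have "\<dots> = ennreal (R / (R\<^sup>2 - a\<^sup>2))"
      using R a by (subst ennreal_mult[symmetric]) (auto simp: power_mono)
    also have "\<dots> \<le> ennreal (2 / (1 - a))"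
    proof (rule ennreal_leI)
      have eq: "R\<^sup>2 - a\<^sup>2 = (R - a) * (R + a)" by (simp add: power2_eq_square algebra_simps)
      have "R / (R\<^sup>2 - a\<^sup>2) \<le> (R + a) / (R\<^sup>2 - a\<^sup>2)" using R a unfolding eq by (intro divide_right_mono) auto
      also have "\<dots> = 1 / (R - a)" unfolding eq using R a by simp
      also have "\<dots> = 2 / (1 - a)" using a by (simp add: R_def field_simps)
      finally show "R / (R\<^sup>2 - a\<^sup>2) \<le> 2 / (1 - a)" .
    qed
    finally show ?thesis .
  qed
  have "nnint {0..2*pi} (\<lambda>t. norm (deriv f (of_real a * cis t)) powr p)
     \<le> ennreal ((c * K * (2 / (1 - a))) powr p)"
  proof (rule minkowski_powr[where M = lborel and N = lborel and S = "{0..2*pi}" and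
        F = "\<lambda>\<theta> t. norm (disc_cut f (of_real R * cis (t + \<theta>))) * k \<theta>" and B = "\<lambda>\<theta>. c * K * k \<theta>"])
    show "(\<lambda>(\<theta>, t). norm (disc_cut f (of_real R * cis (t + \<theta>))) * k \<theta>) \<in> borel_measurable (lborel \<Otimes>\<^sub>M lborel)"
      by measurable
    have "nnint {0..2*pi} (\<lambda>\<theta>. c * K * k \<theta>)
      = (\<integral>\<^sup>+\<theta>. ennreal (c * K) * (ennreal (k \<theta>) * indicator {0..2*pi} \<theta>) \<partial>lborel)"
      using c K k0 by (intro nn_integral_cong) (auto simp: indicator_def less_imp_le simp flip: ennreal_mult)
    also have "\<dots> = ennreal (c * K) * nnint {0..2*pi} (\<lambda>\<theta>. k \<theta>)"
      by (rule nn_integral_cmult) measurable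
    also have "\<dots> \<le> ennreal (c * K) * ennreal (2 / (1 - a))" by (intro mult_left_mono kint) auto
    also have "\<dots> = ennreal (c * K * (2 / (1 - a)))" using c K a by (intro ennreal_mult[symmetric]) auto
    finally show "nnint {0..2*pi} (\<lambda>\<theta>. c * K * k \<theta>) \<le> ennreal (c * K * (2 / (1 - a)))" .
  next
    fix \<theta> assume \<theta>: "\<theta> \<in> {0..2*pi}"
    have "nnint {0..2*pi} (\<lambda>t. (norm (disc_cut f (of_real R * cis (t + \<theta>))) * k \<theta>) powr p)
      = (\<integral>\<^sup>+t. ennreal (k \<theta> powr p) * (ennreal (norm (disc_cut f (of_real R * cis (t + \<theta>))) powr p) * indicator {0..2*pi} t) \<partial>lborel)"
      using k0[of \<theta>] by (intro nn_integral_cong) (auto simp: indicator_def powr_mult mult_ac simp flip: ennreal_mult)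
    also have "\<dots> = ennreal (k \<theta> powr p) * nnint {0..2*pi} (\<lambda>t. norm (disc_cut f (of_real R * cis (t + \<theta>))) powr p)"
      by (rule nn_integral_cmult) measurable
    also have "nnint {0..2*pi} (\<lambda>t. norm (disc_cut f (of_real R * cis (t + \<theta>))) powr p) = circle_powr p R f"
      using R \<theta> by (subst circle_powr_shift[OF fc, symmetric, of R \<theta>]) (auto simp: norm_mult)
    also have "ennreal (k \<theta> powr p) * circle_powr p R f \<le> ennreal (k \<theta> powr p) * ennreal (2 * pi * K powr p)"
      using R by (intro mult_left_mono fK) auto
    also have "\<dots> = ennreal ((c * K * k \<theta>) powr p)"
      using c K k0[of \<theta>] by (simp add: powr_mult mult_ac flip: ennreal_mult)
    finally show "nnint {0..2*pi} (\<lambda>t. (norm (disc_cut f (of_real R * cis (t + \<theta>))) * k \<theta>) powr p)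
      \<le> ennreal ((c * K * k \<theta>) powr p)" .
  next
    fix t
    let ?ft = "\<lambda>z. f (cis t * z)"
    let ?ker = "\<lambda>\<theta>. of_real R * cis \<theta> / (of_real R * cis \<theta> - complex_of_real a)\<^sup>2"
    have hol: "?ft holomorphic_on ball 0 1" by (rule holomorphic_on_rotate[OF f])
    have hi: "((\<lambda>\<theta>. ?ft (of_real R * cis \<theta>) * ?ker \<theta>) has_integral (2 * pi * deriv ?ft a)) {0..2*pi}"
      by (rule has_integral_Cauchy_deriv_circle[OF hol]) (use R a in auto)
    have cont: "continuous_on {0..2*pi} (\<lambda>\<theta>. ?ft (of_real R * cis \<theta>) * ?ker \<theta>)"
      using nz R by (intro continuous_intros continuous_on_circle holomorphic_on_imp_continuous_on[OF hol]) auto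
    have "deriv ?ft a = cis t * deriv f (cis t * a)"
      by (rule deriv_rotate[OF f]) (use a in auto)
    then have "2 * pi * norm (deriv f (of_real a * cis t)) = norm (2 * pi * deriv ?ft a)"
      by (simp only: norm_mult) (simp add: mult.commute)
    also have "2 * pi * deriv ?ft a = integral {0..2*pi} (\<lambda>\<theta>. ?ft (of_real R * cis \<theta>) * ?ker \<theta>)"
      using hi by (simp add: integral_unique)
    finally have e: "2 * pi * norm (deriv f (of_real a * cis t)) = norm (integral {0..2*pi} (\<lambda>\<theta>. ?ft (of_real R * cis \<theta>) * ?ker \<theta>))" .
    have "ennreal (2 * pi) * ennreal (norm (deriv f (of_real a * cis t))) = ennreal (2 * pi * norm (deriv f (of_real a * cis t)))"
      by (simp add: ennreal_mult)
    also have "\<dots> \<le> nnint {0..2*pi} (\<lambda>\<theta>. norm (?ft (of_real R * cis \<theta>) * ?ker \<theta>))"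
      unfolding e by (rule norm_integral_le_nn_integral[OF cont])
    also have "\<dots> = (\<integral>\<^sup>+\<theta>. ennreal (2 * pi) * (ennreal (norm (disc_cut f (of_real R * cis (t + \<theta>))) * k \<theta>) * indicator {0..2*pi} \<theta>) \<partial>lborel)"
    proof (intro nn_integral_cong)
      fix \<theta>
      have 1: "cis t * (of_real R * cis \<theta>) = of_real R * cis (t + \<theta>)" by (simp add: cis_mult[symmetric] mult_ac)
      have 2: "norm (?ker \<theta>) = 2 * pi * k \<theta>" using R by (simp add: k_def norm_mult norm_divide norm_power)
      have 3: "norm (?ft (of_real R * cis \<theta>) * ?ker \<theta>) = norm (disc_cut f (of_real R * cis (t + \<theta>))) * (2 * pi * k \<theta>)"
        using R by (subst norm_mult, simp only: 1 2) (simp add: norm_mult)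
      show "ennreal (norm (?ft (of_real R * cis \<theta>) * ?ker \<theta>)) * indicator {0..2*pi} \<theta> = ennreal (2 * pi) * (ennreal (norm (disc_cut f (of_real R * cis (t + \<theta>))) * k \<theta>) * indicator {0..2*pi} \<theta>)"
        unfolding 3 using k0[of \<theta>]
        by (auto simp: indicator_def mult_ac simp flip: ennreal_mult)
    qed
    also have "\<dots> = ennreal (2 * pi) * nnint {0..2*pi} (\<lambda>\<theta>. norm (disc_cut f (of_real R * cis (t + \<theta>))) * k \<theta>)"
      by (rule nn_integral_cmult) measurable
    finally show "ennreal (norm (deriv f (of_real a * cis t))) \<le> nnint {0..2*pi} (\<lambda>\<theta>. norm (disc_cut f (of_real R * cis (t + \<theta>))) * k \<theta>)"
      by (subst (asm) ennreal_mult_le_mult_iff) auto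
  qed (use p c K a k0 in \<open>auto intro!: sigma_finite_lborel mult_pos_pos simp: less_imp_le\<close>)
  also have "(c * K * (2 / (1 - a))) powr p = 2 * pi * (2 * K / (1 - a)) powr p"
    using c K a by (simp add: powr_mult powr_divide)
  finally show ?thesis .
qed

section \<open>Parseval's identity and the norm of a block of monomials\<close>

lemma has_integral_cis_of_int:
  "((\<lambda>t. cis (of_int m * t)) has_integral (if m = 0 then of_real (2 * pi) else 0)) {0..2*pi}"
proof (cases "m = 0")
  case True
  then show ?thesis using has_integral_const_real[of "1::complex" 0 "2*pi"] by (simp add: scaleR_conv_of_real)
next
  case False
  have "((\<lambda>t. cis (of_int m * t)) has_integral
     cis (of_int m * (2 * pi)) / (\<i> * of_int m) - cis (of_int m * 0) / (\<i> * of_int m)) {0..2*pi}"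
  proof (rule fundamental_theorem_of_calculus)
    fix t :: real
    have "((\<lambda>z. exp (\<i> * of_int m * z) / (\<i> * of_int m)) has_field_derivative exp (\<i> * of_int m * of_real t)) (at (of_real t))"
      using False by (auto intro!: derivative_eq_intros)
    from has_vector_derivative_real_field[OF this]
    show "((\<lambda>t. cis (of_int m * t) / (\<i> * of_int m)) has_vector_derivative cis (of_int m * t)) (at t within {0..2*pi})"
      by (simp add: cis_conv_exp mult.assoc)
  qed simp
  moreover have "cis (of_int m * (2 * pi)) = 1"
    by (metis Ints_of_int cis_multiple_2pi mult.commute mult.left_commute)
  ultimately show ?thesis using False by simp
qed

lemma integral_norm_square_polynomial:
  fixes r :: real
  assumes "finite J"
  shows "((\<lambda>t. (norm (\<Sum>k\<in>J. (of_real r * cis t) ^ k))\<^sup>2) has_integral (2 * pi * (\<Sum>k\<in>J. (r ^ k)\<^sup>2))) {0..2*pi}"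
proof -
  have pt: "of_real ((norm (\<Sum>k\<in>J. (of_real r * cis t) ^ k))\<^sup>2) =
     (\<Sum>j\<in>J. \<Sum>k\<in>J. of_real (r ^ j * r ^ k) * cis (of_int (int j - int k) * t))" for t
  proof -
    have "of_real ((norm (\<Sum>k\<in>J. (of_real r * cis t) ^ k))\<^sup>2) =
      (\<Sum>j\<in>J. (of_real r * cis t) ^ j) * cnj (\<Sum>k\<in>J. (of_real r * cis t) ^ k)"
      by (rule complex_norm_square)
    also have "\<dots> = (\<Sum>j\<in>J. \<Sum>k\<in>J. (of_real r * cis t) ^ j * cnj ((of_real r * cis t) ^ k))"
      by (simp only: cnj_sum sum_product)
    also have "\<dots> = (\<Sum>j\<in>J. \<Sum>k\<in>J. of_real (r ^ j * r ^ k) * cis (of_int (int j - int k) * t))"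
    proof (intro sum.cong refl)
      fix j k
      have "cis t ^ j * cnj (cis t) ^ k = cis (of_int (int j - int k) * t)"
        by (simp add: Complex.DeMoivre cis_cnj cis_mult algebra_simps)
      then show "(of_real r * cis t) ^ j * cnj ((of_real r * cis t) ^ k) = of_real (r ^ j * r ^ k) * cis (of_int (int j - int k) * t)"
        by (simp add: power_mult_distrib mult_ac)
    qed
    finally show ?thesis .
  qed
  have "((\<lambda>t. of_real ((norm (\<Sum>k\<in>J. (of_real r * cis t) ^ k))\<^sup>2) :: complex) has_integral
     (\<Sum>j\<in>J. \<Sum>k\<in>J. of_real (r ^ j * r ^ k) * (if int j - int k = 0 then complex_of_real (2 * pi) else 0))) {0..2*pi}"
    unfolding pt by (intro has_integral_sum assms has_integral_mult_right has_integral_cis_of_int)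
  from has_integral_linear[OF this bounded_linear_Re]
  have *: "((\<lambda>t. (norm (\<Sum>k\<in>J. (of_real r * cis t) ^ k))\<^sup>2) has_integral
     Re (\<Sum>j\<in>J. \<Sum>k\<in>J. of_real (r ^ j * r ^ k) * (if int j - int k = 0 then complex_of_real (2 * pi) else 0))) {0..2*pi}"
    by (simp add: o_def del: of_real_power)
  have "(\<Sum>j\<in>J. \<Sum>k\<in>J. of_real (r ^ j * r ^ k) * (if int j - int k = 0 then complex_of_real (2 * pi) else 0))
    = (\<Sum>j\<in>J. \<Sum>k\<in>J. if j = k then complex_of_real (2 * pi * (r ^ j)\<^sup>2) else 0)"
    by (intro sum.cong refl) (auto simp: power2_eq_square)
  also have "\<dots> = (\<Sum>j\<in>J. complex_of_real (2 * pi * (r ^ j)\<^sup>2))"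
    using assms by (intro sum.cong refl) (simp add: sum.delta)
  also have "Re \<dots> = 2 * pi * (\<Sum>k\<in>J. (r ^ k)\<^sup>2)"
    by (simp add: sum_distrib_left)
  finally show ?thesis using * by simp
qed

lemma circle_powr_geometric_block:
  assumes p: "2 \<le> p" and J: "finite J" and r: "0 \<le> r" "r \<le> 1"
  shows "circle_powr p r (\<lambda>z. \<Sum>k\<in>J. z ^ k) \<le> ennreal (2 * pi * real (card J) powr (p - 1))"
proof -
  let ?f = "\<lambda>t. norm (\<Sum>k\<in>J. (of_real r * cis t) ^ k)"
  have fN: "?f t \<le> card J" for t
  proof -
    have "?f t \<le> (\<Sum>k\<in>J. norm ((of_real r * cis t) ^ k))" by (rule norm_sum)
    also have "\<dots> \<le> (\<Sum>k\<in>J. 1)" using r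
      by (intro sum_mono) (simp add: norm_mult norm_power power_le_one)
    finally show ?thesis by simp
  qed
  have pt: "?f t powr p \<le> real (card J) powr (p - 2) * (?f t)\<^sup>2" for t
  proof (cases "?f t = 0")
    case False
    then have f0: "0 < ?f t" by simp
    have "?f t powr p = ?f t powr ((p - 2) + 2)" by simp
    also have "\<dots> = ?f t powr (p - 2) * ?f t powr 2" by (rule powr_add)
    also have "\<dots> \<le> real (card J) powr (p - 2) * ?f t powr 2"
      using fN[of t] p by (intro mult_right_mono powr_mono2) auto
    finally show ?thesis using f0 by simp
  qed simp
  have "circle_powr p r (\<lambda>z. \<Sum>k\<in>J. z ^ k) \<le> nnint {0..2*pi} (\<lambda>t. real (card J) powr (p - 2) * (?f t)\<^sup>2)"
    using pt by (intro nn_integral_mono) (auto simp: indicator_def intro!: ennreal_leI)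
  also have "\<dots> = ennreal (real (card J) powr (p - 2) * (2 * pi * (\<Sum>k\<in>J. (r ^ k)\<^sup>2)))"
    by (intro nn_integral_has_integral_lebesgue' has_integral_mult_right integral_norm_square_polynomial J) auto
  also have "\<dots> \<le> ennreal (2 * pi * real (card J) powr (p - 1))"
  proof (rule ennreal_leI)
    have "(\<Sum>k\<in>J. (r ^ k)\<^sup>2) \<le> (\<Sum>k\<in>J. 1)" using r
      by (intro sum_mono) (simp add: power_le_one)
    then have "real (card J) powr (p - 2) * (2 * pi * (\<Sum>k\<in>J. (r ^ k)\<^sup>2)) \<le> real (card J) powr (p - 2) * (2 * pi * card J)"
      by (intro mult_left_mono) auto
    also have "\<dots> = 2 * pi * (real (card J) powr (p - 2) * real (card J) powr 1)" by simp
    also have "real (card J) powr (p - 2) * real (card J) powr 1 = real (card J) powr (p - 2 + 1)"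
      by (rule powr_add[symmetric])
    finally show "real (card J) powr (p - 2) * (2 * pi * (\<Sum>k\<in>J. (r ^ k)\<^sup>2)) \<le> 2 * pi * real (card J) powr (p - 1)" by simp
  qed
  finally show ?thesis .
qed

section \<open>From boundedness to the growth of the derivative\<close>

lemma integral_mean_le_hardy_norm:
  assumes "f \<in> hardy p" "0 < r" "r < 1"
  shows "integral_mean p r f \<le> hardy_norm p f"
  unfolding hardy_norm_def using assms by (intro cSUP_upper) (auto simp: hardy_def)

lemma hardy_norm_nonneg:
  assumes "f \<in> hardy p" shows "0 \<le> hardy_norm p f"
  using integral_mean_le_hardy_norm[OF assms, of "1/2"] integral_mean_nonneg[of p "1/2" f] by linarith

lemma hardyI:
  assumes "f holomorphic_on ball 0 1" "\<And>r. 0 < r \<Longrightarrow> r < 1 \<Longrightarrow> integral_mean p r f \<le> K"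
  shows "f \<in> hardy p" "hardy_norm p f \<le> K"
  using assms unfolding hardy_def hardy_norm_def
  by (auto intro!: bdd_aboveI[of _ K] cSUP_least)

lemma holomorphic_on_deriv_disc:
  assumes "g holomorphic_on ball 0 1"
  shows "deriv g holomorphic_on ball 0 1" "continuous_on (ball 0 1) (deriv g)"
  using holomorphic_deriv[OF assms] holomorphic_on_imp_continuous_on by auto

lemma norm_ray_less_1:
  fixes z :: complex
  assumes "norm z < 1" "0 \<le> t" "t \<le> 1"
  shows "norm (of_real t * z) < 1"
  using assms by (auto simp: norm_mult intro: order_le_less_trans[OF mult_left_le_one_le])

lemma continuous_on_ray:
  fixes z :: complex
  assumes "continuous_on (ball 0 1) G" "norm z < 1" "S \<subseteq> {0..1}"
  shows "continuous_on S (\<lambda>t. G (of_real t * z))"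
  by (intro continuous_on_compose2[OF assms(1)] continuous_intros)
     (use assms norm_ray_less_1 in auto)

lemma hilbert_op_continuous:
  assumes g: "g holomorphic_on ball 0 1" and z: "norm z < 1"
    and f: "continuous_on {0..1} (\<lambda>t. f (of_real t))"
  shows "hilbert_op g f z = integral {0..1} (\<lambda>t. f (of_real t) * deriv g (of_real t * z))"
proof -
  let ?F = "\<lambda>t. f (of_real t) * deriv g (of_real t * z)"
  have c: "continuous_on {0..1} ?F"
    by (intro continuous_intros f continuous_on_ray holomorphic_on_deriv_disc[OF g] z order_refl)
  have "?F absolutely_integrable_on {0<..<1}"
    by (rule set_integrable_subset[OF absolutely_integrable_continuous_real[OF c]]) auto
  then have "integrable (lebesgue_on {0<..<1}) ?F"
    by (intro absolutely_integrable_imp_integrable) auto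
  then have "hilbert_op g f z = integral {0<..<1} ?F"
    unfolding hilbert_op_def by (intro lebesgue_integral_eq_integral) auto
  then show ?thesis by (simp add: integral_open_interval_real)
qed

definition power_moment :: "(complex \<Rightarrow> complex) \<Rightarrow> nat \<Rightarrow> complex \<Rightarrow> complex" where
  "power_moment g k z = integral {0..1} (\<lambda>t. of_real t ^ k * deriv g (of_real t * z))"

text \<open>The substitution u = t w shows that w^(k+1) times the k-th moment at w is \<Phi>(w) -
  \<Phi>(0) for a primitive \<Phi> of w^k g'(w). Dividing and using the quotient rule avoids
  differentiation under the integral; the division is where z \<noteq> 0 enters.\<close>

lemma power_moment_deriv:
  assumes g: "g holomorphic_on ball 0 1" and z: "z \<noteq> 0" "norm z < 1"
  shows "(power_moment g k has_field_derivative (deriv g z - of_nat (k + 1) * power_moment g k z) / z) (at z)"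
proof -
  have "(\<lambda>w. w ^ k * deriv g w) holomorphic_on ball 0 1"
    by (intro holomorphic_intros holomorphic_on_deriv_disc g)
  from holomorphic_convex_primitive'[OF _ _ this]
  obtain \<Phi> where \<Phi>: "\<And>w. w \<in> ball 0 1 \<Longrightarrow> (\<Phi> has_field_derivative (w ^ k * deriv g w)) (at w within ball 0 1)"
    by auto
  then have \<Phi>: "(\<Phi> has_field_derivative (w ^ k * deriv g w)) (at w)" if "norm w < 1" for w
    using that at_within_open[of w "ball 0 1"] by (metis mem_ball_0 open_ball)
  have eq: "w ^ (k + 1) * power_moment g k w = \<Phi> w - \<Phi> 0" if w: "norm w < 1" for w
  proof -
    have "((\<lambda>t. (of_real t * w) ^ k * deriv g (of_real t * w) * w) has_integral \<Phi> (of_real 1 * w) - \<Phi> (of_real 0 * w)) {0..1}"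
    proof (rule fundamental_theorem_of_calculus)
      fix t :: real assume t: "t \<in> {0..1}"
      have "norm (of_real t * w) < 1"
        using t w by (simp add: norm_ray_less_1)
      then have "((\<lambda>s. \<Phi> (s * w)) has_field_derivative (of_real t * w) ^ k * deriv g (of_real t * w) * w) (at (of_real t))"
        by (intro DERIV_chain2[OF \<Phi>]) (auto intro!: derivative_eq_intros)
      from has_vector_derivative_real_field[OF this]
      show "((\<lambda>t. \<Phi> (of_real t * w)) has_vector_derivative (of_real t * w) ^ k * deriv g (of_real t * w) * w) (at t within {0..1})" .
    qed simp
    then have "((\<lambda>t. w ^ (k + 1) * (of_real t ^ k * deriv g (of_real t * w))) has_integral \<Phi> w - \<Phi> 0) {0..1}"
      by (simp add: power_mult_distrib mult_ac)
    then have "integral {0..1} (\<lambda>t. w ^ (k + 1) * (of_real t ^ k * deriv g (of_real t * w))) = \<Phi> w - \<Phi> 0"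
      by (rule integral_unique)
    then show ?thesis unfolding power_moment_def by (subst (asm) integral_mult_right)
  qed
  have "((\<lambda>w. (\<Phi> w - \<Phi> 0) / w ^ (k + 1)) has_field_derivative
     (z ^ k * deriv g z * z ^ (k + 1) - (\<Phi> z - \<Phi> 0) * (of_nat (k + 1) * z ^ k)) / (z ^ (k + 1) * z ^ (k + 1))) (at z)"
  proof (rule DERIV_divide)
    show "((\<lambda>w. \<Phi> w - \<Phi> 0) has_field_derivative z ^ k * deriv g z) (at z)"
      using \<Phi>[OF z(2)] by (auto intro!: derivative_eq_intros)
    show "((\<lambda>w. w ^ (k + 1)) has_field_derivative of_nat (k + 1) * z ^ k) (at z)"
      using DERIV_power_Suc[OF DERIV_ident, of k z UNIV] by simp
  qed (use z in auto)
  also have "(z ^ k * deriv g z * z ^ (k + 1) - (\<Phi> z - \<Phi> 0) * (of_nat (k + 1) * z ^ k)) / (z ^ (k + 1) * z ^ (k + 1))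
     = (deriv g z - of_nat (k + 1) * power_moment g k z) / z"
    unfolding eq[OF z(2), symmetric] using z by (simp add: field_simps)
  finally show ?thesis
  proof (rule has_field_derivative_transform_within_open)
    show "open (ball 0 1 - {0 :: complex})" by auto
    fix w :: complex assume "w \<in> ball 0 1 - {0}"
    then show "(\<Phi> w - \<Phi> 0) / w ^ (k + 1) = power_moment g k w"
      using eq[of w] by (auto simp: field_simps)
  qed (use z in auto)
qed

text \<open>The choice \<open>\<gamma> = 4 N / 3\<close> makes \<open>\<bar>k + 1 - \<gamma>\<bar> \<le> (k + 1) / 3\<close> on the whole
  block \<open>N \<le> k < 2 N\<close>, so that the error term is at most a third of the main term.\<close>

lemma hilbert_op_block:
  fixes N :: nat
  defines "f \<equiv> \<lambda>z::complex. \<Sum>k\<in>{N..<2*N}. z ^ k"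
  assumes g: "g holomorphic_on ball 0 1" and z: "z \<noteq> 0" "norm z < 1"
  shows "real N * norm (deriv g z) \<le> norm (deriv (hilbert_op g f) z) + 4 * real N / 3 * norm (hilbert_op g f z)
     + integral {0..1} (\<lambda>t. (\<Sum>k\<in>{N..<2*N}. (real k + 1) / 3 * t ^ k) * norm (deriv g (of_real t * z)))"
proof -
  let ?J = "{N..<2*N}"
  let ?h = "\<lambda>k. power_moment g k z"
  have Gc: "continuous_on (ball 0 1) (deriv g)" by (rule holomorphic_on_deriv_disc[OF g])
  have H: "hilbert_op g f w = (\<Sum>k\<in>?J. power_moment g k w)" if w: "norm w < 1" for w
  proof -
    have "hilbert_op g f w = integral {0..1} (\<lambda>t. f (of_real t) * deriv g (of_real t * w))"
      unfolding f_def by (intro hilbert_op_continuous[OF g w] continuous_intros)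
    also have "\<dots> = integral {0..1} (\<lambda>t. \<Sum>k\<in>?J. of_real t ^ k * deriv g (of_real t * w))"
      by (simp add: f_def sum_distrib_right)
    also have "\<dots> = (\<Sum>k\<in>?J. power_moment g k w)"
      unfolding power_moment_def
      by (intro integral_sum integrable_continuous_interval continuous_intros continuous_on_ray[OF Gc w]) auto
    finally show ?thesis .
  qed
  have "((\<lambda>w. \<Sum>k\<in>?J. power_moment g k w) has_field_derivative (\<Sum>k\<in>?J. (deriv g z - of_nat (k + 1) * ?h k) / z)) (at z)"
    by (intro DERIV_sum power_moment_deriv g z)
  then have "(hilbert_op g f has_field_derivative (\<Sum>k\<in>?J. (deriv g z - of_nat (k + 1) * ?h k) / z)) (at z)"
    by (rule has_field_derivative_transform_within_open[where S = "ball 0 1"]) (use z H in auto)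
  then have "deriv (hilbert_op g f) z = (\<Sum>k\<in>?J. (deriv g z - of_nat (k + 1) * ?h k) / z)"
    by (rule DERIV_imp_deriv)
  then have "z * deriv (hilbert_op g f) z = (\<Sum>k\<in>?J. deriv g z - of_nat (k + 1) * ?h k)"
    using z by (simp flip: sum_divide_distrib)
  also have "\<dots> = of_nat N * deriv g z - (\<Sum>k\<in>?J. of_nat (k + 1) * ?h k)"
    by (simp add: sum_subtractf)
  finally have "of_nat N * deriv g z = z * deriv (hilbert_op g f) z + (\<Sum>k\<in>?J. of_nat (k + 1) * ?h k)"
    by simp
  \<comment> \<open>With one common weight in place of k + 1 the sum of the moments is the image
    function itself, whose norm is controlled by assumption; only the deviations of the weights go
    into the error.\<close>
  also have "(\<Sum>k\<in>?J. of_nat (k + 1) * ?h k) = of_real (4 * N / 3) * hilbert_op g f z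
      + (\<Sum>k\<in>?J. of_real (real k + 1 - 4 * N / 3) * ?h k)"
    unfolding H[OF z(2)] sum_distrib_left sum.distrib[symmetric]
    by (intro sum.cong refl) (simp add: algebra_simps)
  finally have "norm (of_nat N * deriv g z) = norm (z * deriv (hilbert_op g f) z + (of_real (4 * N / 3) * hilbert_op g f z
      + (\<Sum>k\<in>?J. of_real (real k + 1 - 4 * N / 3) * ?h k)))" by simp
  also have "\<dots> \<le> norm (z * deriv (hilbert_op g f) z) + (norm (of_real (4 * N / 3) * hilbert_op g f z)
      + norm (\<Sum>k\<in>?J. of_real (real k + 1 - 4 * N / 3) * ?h k))"
    by (intro order_trans[OF norm_triangle_ineq] add_left_mono norm_triangle_ineq)
  also have "norm (z * deriv (hilbert_op g f) z) \<le> norm (deriv (hilbert_op g f) z)"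
    using z by (simp add: norm_mult mult_left_le_one_le)
  also have "norm (of_real (4 * N / 3) * hilbert_op g f z) = 4 * N / 3 * norm (hilbert_op g f z)"
    by (simp add: norm_mult norm_divide)
  also have "norm (\<Sum>k\<in>?J. of_real (real k + 1 - 4 * N / 3) * ?h k) \<le>
      (\<Sum>k\<in>?J. (real k + 1) / 3 * integral {0..1} (\<lambda>t. t ^ k * norm (deriv g (of_real t * z))))"
  proof (rule order_trans[OF norm_sum], rule sum_mono)
    fix k assume k: "k \<in> ?J"
    then have "real N \<le> real k" "real (k + 1) \<le> real (2 * N)"
      by (simp_all only: of_nat_le_iff) auto
    then have 1: "\<bar>real k + 1 - 4 * N / 3\<bar> \<le> (real k + 1) / 3" by (simp add: abs_if field_simps)
    have 2: "norm (?h k) \<le> integral {0..1} (\<lambda>t. t ^ k * norm (deriv g (of_real t * z)))"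
      unfolding power_moment_def
      by (intro integral_norm_bound_integral integrable_continuous_interval continuous_intros continuous_on_ray[OF Gc z(2)])
         (auto simp: norm_mult norm_power)
    have "norm (of_real (real k + 1 - 4 * N / 3) * ?h k) = \<bar>real k + 1 - 4 * N / 3\<bar> * norm (?h k)"
      by (simp only: norm_mult norm_of_real)
    also have "\<dots> \<le> (real k + 1) / 3 * integral {0..1} (\<lambda>t. t ^ k * norm (deriv g (of_real t * z)))"
      by (intro mult_mono 1 2) auto
    finally show "norm (of_real (real k + 1 - 4 * N / 3) * ?h k) \<le> (real k + 1) / 3 * integral {0..1} (\<lambda>t. t ^ k * norm (deriv g (of_real t * z)))" .
  qed
  also have "(\<Sum>k\<in>?J. (real k + 1) / 3 * integral {0..1} (\<lambda>t. t ^ k * norm (deriv g (of_real t * z))))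
     = integral {0..1} (\<lambda>t. \<Sum>k\<in>?J. (real k + 1) / 3 * (t ^ k * norm (deriv g (of_real t * z))))"
    by (subst integral_sum)
       (auto intro!: integrable_continuous_interval continuous_intros continuous_on_ray[OF Gc z(2)])
  finally show ?thesis by (simp add: norm_mult sum_distrib_right mult.assoc)
qed

lemma deriv_bound_step:
  fixes N :: nat
  assumes p: "2 < p" and g: "g holomorphic_on ball 0 1" and C: "0 < C" and L: "0 < L"
    and bd: "\<And>f. f \<in> hardy p \<Longrightarrow> hilbert_op g f \<in> hardy p \<and> hardy_norm p (hilbert_op g f) \<le> C * hardy_norm p f"
    and GL: "\<And>s. 0 < s \<Longrightarrow> s \<le> a \<Longrightarrow> integral_mean p s (deriv g) \<le> L * (1 - s) powr (1 / p - 1)"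
    and a: "0 < a" "a < 1"
  shows "integral_mean p a (deriv g) \<le> (20 * C / 3 + L / 3) * (1 - a) powr (1 / p - 1)"
proof -
  \<comment> \<open>The lower bound N \<ge> 1 / (1 - a) makes the cost of differentiating the image
    at most 2 N; the upper bound N \<le> 2 / (1 - a) makes N powr (1 - 1/p), the norm of the block,
    at most twice (1 - a) powr (1/p - 1).\<close>
  define N where "N = nat \<lceil>1 / (1 - a)\<rceil>"
  have a1: "1 \<le> 1 / (1 - a)" using a by simp
  have N1: "1 / (1 - a) \<le> real N" using a by (simp add: N_def) 
  have N2: "real N \<le> 2 / (1 - a)"
  proof -
    have "real N \<le> 1 / (1 - a) + 1" using a by (simp add: N_def)
    also have "\<dots> \<le> 2 / (1 - a)" using a1 by (simp add: field_simps)
    finally show ?thesis .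
  qed
  have N0: "0 < real N" using N1 a1 by linarith
  define f where "f = (\<lambda>z::complex. \<Sum>k\<in>{N..<2*N}. z ^ k)"
  define H where "H = hilbert_op g f"
  define K where "K = C * real N powr (1 - 1 / p)"
  have K0: "0 < K" using C N0 by (simp add: K_def)
  define c where "c = (2 * pi) powr (1 / p)"
  have c: "0 < c" "c powr p = 2 * pi" using p by (auto simp: c_def powr_powr)
  define \<psi> where "\<psi> t = (\<Sum>k\<in>{N..<2*N}. (real k + 1) / 3 * t ^ k)" for t :: real
  have \<psi>0: "0 < \<psi> t" if "0 < t" for t
    unfolding \<psi>_def using that N0 by (intro sum_pos) auto
  define G where "G = deriv g"
  have Gh: "G holomorphic_on ball 0 1" and Gc: "continuous_on (ball 0 1) G"
    unfolding G_def by (rule holomorphic_on_deriv_disc[OF g])+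
  have [measurable]: "disc_cut G \<in> borel_measurable borel" by (rule borel_measurable_disc_cut[OF Gc])
  have fhol: "f holomorphic_on ball 0 1" unfolding f_def by (intro holomorphic_intros)
  have fm: "integral_mean p r f \<le> real N powr (1 - 1 / p)" if "0 < r" "r < 1" for r
  proof -
    have "circle_powr p r f \<le> ennreal (2 * pi * real (card {N..<2*N}) powr (p - 1))"
      unfolding f_def using that p by (intro circle_powr_geometric_block) auto
    also have "real (card {N..<2*N}) powr (p - 1) = (real N powr (1 - 1 / p)) powr p"
      using p by (simp add: powr_powr algebra_simps)
    finally show ?thesis using that p
      by (subst integral_mean_le_iff) (auto intro: holomorphic_on_imp_continuous_on[OF fhol])
  qed
  have fH: "f \<in> hardy p" "hardy_norm p f \<le> real N powr (1 - 1 / p)" using hardyI[OF fhol fm] by auto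
  have HH: "H \<in> hardy p" and Hn: "hardy_norm p H \<le> C * hardy_norm p f" unfolding H_def using bd[OF fH(1)] by auto
  have Hhol: "H holomorphic_on ball 0 1" using HH by (simp add: hardy_def)
  have Hc: "continuous_on (ball 0 1) H" by (rule holomorphic_on_imp_continuous_on[OF Hhol])
  have H'c: "continuous_on (ball 0 1) (deriv H)" by (rule holomorphic_on_deriv_disc[OF Hhol])
  have Hm: "circle_powr p r H \<le> ennreal (2 * pi * K powr p)" if "0 < r" "r < 1" for r
  proof -
    have "integral_mean p r H \<le> hardy_norm p H" by (rule integral_mean_le_hardy_norm[OF HH that])
    also have "\<dots> \<le> C * hardy_norm p f" by (rule Hn)
    also have "\<dots> \<le> K" unfolding K_def using fH C by (intro mult_left_mono) auto
    finally show ?thesis using that p K0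
      by (subst (asm) integral_mean_le_iff) (auto intro: Hc)
  qed
  have H'm: "circle_powr p a (deriv H) \<le> ennreal (2 * pi * (2 * K / (1 - a)) powr p)"
    by (rule circle_powr_deriv_le[OF Hhol _ K0 Hm a]) (use p in auto)
  have m1[measurable]: "(\<lambda>t. H (of_real a * cis t)) \<in> borel_measurable borel"
    "(\<lambda>t. deriv H (of_real a * cis t)) \<in> borel_measurable borel"
    "(\<lambda>t. G (of_real a * cis t)) \<in> borel_measurable borel"
    by (intro borel_measurable_continuous_onI continuous_on_circle Hc H'c Gc, use a in simp)+
  define u1 u2 where "u1 t = norm (deriv H (of_real a * cis t))" "u2 t = 4 * real N / 3 * norm (H (of_real a * cis t))" for t
  define w where "w t = real N * norm (G (of_real a * cis t))" for t
  \<comment> \<open>Defined as the defect of the first two terms, cut off at 0: only an upper bound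
    for it is required, and w \<le> u1 + u2 + u3 then holds by construction.\<close>
  define u3 where "u3 t = max 0 (w t - u1 t - u2 t)" for t
  have [measurable]: "u1 \<in> borel_measurable borel" "u2 \<in> borel_measurable borel" "u3 \<in> borel_measurable borel"
    unfolding u3_def w_def u1_u2_def by measurable
  \<comment> \<open>The assumed bound at the largest radius a. As the exponent is negative, it also
    dominates the bounds at all radii s * a with 0 < s < 1, so that a single number serves under the
    integral over s.\<close>
  define D where "D = L * (1 - a) powr (1 / p - 1)"
  have D0: "0 < D" using L a by (simp add: D_def)
  have I1: "nnint {0..2*pi} (\<lambda>t. u1 t powr p) \<le> ennreal ((c * (2 * K / (1 - a))) powr p)"
    using H'm c a K0 by (simp add: u1_u2_def powr_mult powr_divide)
  have I2: "nnint {0..2*pi} (\<lambda>t. u2 t powr p) \<le> ennreal ((c * (4 * real N / 3 * K)) powr p)"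
  proof -
    have u2p: "u2 t powr p = (4 * real N / 3) powr p * norm (H (of_real a * cis t)) powr p" for t
      unfolding u1_u2_def by (subst powr_mult) auto
    have "nnint {0..2*pi} (\<lambda>t. u2 t powr p) =
      (\<integral>\<^sup>+t. ennreal ((4 * real N / 3) powr p) * (ennreal (norm (H (of_real a * cis t)) powr p) * indicator {0..2*pi} t) \<partial>lborel)"
      unfolding u2p by (intro nn_integral_cong) (auto simp: indicator_def simp flip: ennreal_mult)
    also have "\<dots> = ennreal ((4 * real N / 3) powr p) * circle_powr p a H"
      by (rule nn_integral_cmult) measurable
    also have "\<dots> \<le> ennreal ((4 * real N / 3) powr p) * ennreal (2 * pi * K powr p)"
      by (intro mult_left_mono Hm a) auto
    also have "\<dots> = ennreal (c powr p * ((4 * real N / 3) powr p * K powr p))"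
      using c by (simp add: mult_ac flip: ennreal_mult)
    also have "(4 * real N / 3) powr p * K powr p = (4 * real N / 3 * K) powr p"
      using K0 by (subst powr_mult) auto
    also have "c powr p * (4 * real N / 3 * K) powr p = (c * (4 * real N / 3 * K)) powr p"
      using K0 c by (subst powr_mult) auto
    finally show ?thesis .
  qed
  have I3: "nnint {0..2*pi} (\<lambda>t. u3 t powr p) \<le> ennreal ((c * D * (real N / 3)) powr p)"
  proof (rule minkowski_powr[where M = lborel and N = lborel and S = "{0<..<1}" and
        F = "\<lambda>s t. \<psi> s * norm (disc_cut G (of_real s * (of_real a * cis t)))" and B = "\<lambda>s. c * D * \<psi> s"])
    have [measurable]: "\<psi> \<in> borel_measurable borel" unfolding \<psi>_def by measurable
    show "(\<lambda>s. c * D * \<psi> s) \<in> borel_measurable lborel" by measurable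
    show "(\<lambda>(s, t). \<psi> s * norm (disc_cut G (of_real s * (of_real a * cis t)))) \<in> borel_measurable (lborel \<Otimes>\<^sub>M lborel)"
      by measurable
    have \<psi>c: "continuous_on S \<psi>" for S unfolding \<psi>_def by (intro continuous_intros)
    \<comment> \<open>The integral of (k + 1) * t^k over the unit interval is 1, so the N terms of
      \<psi> have total mass N / 3. This third is what makes absorption possible.\<close>
    have "(\<psi> has_integral (\<Sum>k\<in>{N..<2*N}. (real k + 1) / 3 * (1 ^ Suc k / real (Suc k) - 0 ^ Suc k / real (Suc k)))) {0..1}"
      unfolding \<psi>_def
    proof (intro has_integral_sum has_integral_mult_right)
      fix k
      show "((\<lambda>x. x ^ k) has_integral 1 ^ Suc k / real (Suc k) - 0 ^ Suc k / real (Suc k)) {0..1::real}"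
      proof (rule fundamental_theorem_of_calculus)
        fix x :: real
        have "((\<lambda>x. x ^ Suc k / real (Suc k)) has_real_derivative x ^ k) (at x within {0..1})"
          using DERIV_cdivide[OF DERIV_power_Suc[OF DERIV_ident, of k x "{0..1}"], of "real (Suc k)"]
          by (simp add: add_pos_nonneg add_nonneg_eq_0_iff)
        then show "((\<lambda>x. x ^ Suc k / real (Suc k)) has_vector_derivative x ^ k) (at x within {0..1})"
          by (simp add: has_real_derivative_iff_has_vector_derivative)
      qed simp
    qed auto
    also have "(\<Sum>k\<in>{N..<2*N}. (real k + 1) / 3 * (1 ^ Suc k / real (Suc k) - 0 ^ Suc k / real (Suc k))) = (\<Sum>k\<in>{N..<2*N}. 1 / 3)"
      by (intro sum.cong refl) (simp add: add_ac add_pos_nonneg)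
    also have "\<dots> = real N / 3" by simp
    finally have \<psi>i: "((\<lambda>s. c * D * \<psi> s) has_integral c * D * (real N / 3)) {0..1}" by (rule has_integral_mult_right)
    have "nnint {0<..<1} (\<lambda>s. c * D * \<psi> s) \<le> nnint {0..1} (\<lambda>s. c * D * \<psi> s)"
      by (intro nn_integral_mono) (auto simp: indicator_def)
    also have "\<dots> = ennreal (c * D * (real N / 3))"
      using c D0 by (intro nn_integral_has_integral_lebesgue' \<psi>i) (auto simp: \<psi>_def intro!: mult_nonneg_nonneg sum_nonneg)
    finally show "nnint {0<..<1} (\<lambda>s. c * D * \<psi> s) \<le> ennreal (c * D * (real N / 3))" .
  next
    fix s :: real assume s: "s \<in> {0<..<1}"
    have sa: "0 < s * a" "s * a \<le> a" "s * a < 1" using s a by (auto simp: mult_less_cancel_right2 intro: order_le_less_trans[of _ a])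
    have [measurable]: "disc_cut G \<in> borel_measurable borel" by (rule borel_measurable_disc_cut[OF Gc])
    have "nnint {0..2*pi} (\<lambda>t. (\<psi> s * norm (disc_cut G (of_real s * (of_real a * cis t)))) powr p)
      = (\<integral>\<^sup>+t. ennreal (\<psi> s powr p) * (ennreal (norm (disc_cut G (of_real (s * a) * cis t)) powr p) * indicator {0..2*pi} t) \<partial>lborel)"
      using \<psi>0[of s] s by (intro nn_integral_cong) (auto simp: indicator_def powr_mult mult_ac simp flip: ennreal_mult)
    also have "\<dots> = ennreal (\<psi> s powr p) * circle_powr p (s * a) (disc_cut G)"
      by (rule nn_integral_cmult) measurable
    also have "circle_powr p (s * a) (disc_cut G) = circle_powr p (s * a) G"
      using sa by (simp add: norm_mult)
    also have "ennreal (\<psi> s powr p) * circle_powr p (s * a) G \<le> ennreal (\<psi> s powr p) * ennreal (2 * pi * D powr p)"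
    proof (rule mult_left_mono)
      have "integral_mean p (s * a) G \<le> L * (1 - s * a) powr (1 / p - 1)" using GL sa by (simp add: G_def)
      also have "\<dots> \<le> D" unfolding D_def using L sa a p by (intro mult_left_mono powr_mono2') auto
      finally show "circle_powr p (s * a) G \<le> ennreal (2 * pi * D powr p)" 
        using sa D0 p by (subst (asm) integral_mean_le_iff) (auto intro: Gc)
    qed simp
    also have "\<dots> = ennreal ((c * D * \<psi> s) powr p)"
      using c D0 \<psi>0[of s] s by (simp add: powr_mult mult_ac flip: ennreal_mult)
    finally show "nnint {0..2*pi} (\<lambda>t. (\<psi> s * norm (disc_cut G (of_real s * (of_real a * cis t)))) powr p)
       \<le> ennreal ((c * D * \<psi> s) powr p)" .
  next
    fix t :: real
    let ?z = "of_real a * cis t"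
    have z: "?z \<noteq> 0" "norm ?z < 1" using a by (auto simp: norm_mult)
    have cc: "continuous_on {0..1} (\<lambda>s. \<psi> s * norm (G (of_real s * ?z)))"
      unfolding \<psi>_def by (intro continuous_intros continuous_on_ray[OF Gc z(2)]) auto
    have nn: "0 \<le> \<psi> s * norm (G (of_real s * ?z))" if "s \<in> {0..1}" for s
      using that by (auto simp: \<psi>_def intro!: mult_nonneg_nonneg sum_nonneg)
    have "u3 t \<le> integral {0..1} (\<lambda>s. \<psi> s * norm (G (of_real s * ?z)))"
      using hilbert_op_block[OF g z, of N] integral_nonneg[OF integrable_continuous_interval[OF cc] nn]
      unfolding u3_def w_def u1_u2_def H_def f_def \<psi>_def G_def by simp
    then have "ennreal (u3 t) \<le> ennreal (integral {0..1} (\<lambda>s. \<psi> s * norm (G (of_real s * ?z))))" by (rule ennreal_leI)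
    also have "\<dots> = nnint {0..1} (\<lambda>s. \<psi> s * norm (G (of_real s * ?z)))"
      by (rule nn_integral_Icc_continuous[OF cc nn, symmetric])
    also have "\<dots> = nnint {0<..<1} (\<lambda>s. \<psi> s * norm (disc_cut G (of_real s * ?z)))"
    proof (rule nn_integral_cong_AE, use AE_lborel_singleton[of 0] AE_lborel_singleton[of 1] in eventually_elim)
      case (elim s)
      then show ?case using a 
        by (auto simp: indicator_def norm_mult disc_cut_def intro: order_le_less_trans[OF mult_left_le_one_le])
    qed
    finally show "ennreal (u3 t) \<le> nnint {0<..<1} (\<lambda>s. \<psi> s * norm (disc_cut G (of_real s * ?z)))" .
    show "0 \<le> u3 t" by (simp add: u3_def)
  qed (use p c D0 N0 \<psi>0 in \<open>auto intro!: sigma_finite_lborel mult_pos_pos simp: less_imp_le\<close>)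
  have I12: "nnint {0..2*pi} (\<lambda>t. (u1 t + u2 t) powr p)
     \<le> ennreal ((c * (2 * K / (1 - a)) + c * (4 * real N / 3 * K)) powr p)"
    by (rule triangle_powr[OF sigma_finite_lborel _ _ _ _ _ _ _ _ I1 I2])
       (use p c K0 N0 a in \<open>auto simp: u1_u2_def\<close>)
  have Iw: "nnint {0..2*pi} (\<lambda>t. w t powr p)
     \<le> ennreal ((c * (2 * K / (1 - a)) + c * (4 * real N / 3 * K) + c * D * (real N / 3)) powr p)"
    by (rule triangle_powr[OF sigma_finite_lborel _ _ _ _ _ _ _ _ I12 I3])
       (use p c K0 N0 a D0 in \<open>auto simp: u1_u2_def u3_def w_def intro!: add_pos_pos\<close>)
  define X where "X = 2 * K / (1 - a) + 4 * real N / 3 * K + D * (real N / 3)"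
  have X0: "0 < X" using K0 N0 a D0 by (auto simp: X_def intro!: add_pos_pos)
  have "c * (2 * K / (1 - a)) + c * (4 * real N / 3 * K) + c * D * (real N / 3) = c * X"
    by (simp add: X_def algebra_simps)
  with Iw have Iw: "nnint {0..2*pi} (\<lambda>t. w t powr p) \<le> ennreal ((c * X) powr p)" by simp
  have "circle_powr p a G = (\<integral>\<^sup>+t. ennreal (1 / real N powr p) * (ennreal (w t powr p) * indicator {0..2*pi} t) \<partial>lborel)"
    using N0 by (intro nn_integral_cong) (auto simp: w_def indicator_def powr_mult simp flip: ennreal_mult)
  also have "\<dots> = ennreal (1 / real N powr p) * nnint {0..2*pi} (\<lambda>t. w t powr p)"
    unfolding w_def by (rule nn_integral_cmult) measurable
  also have "\<dots> \<le> ennreal (1 / real N powr p) * ennreal ((c * X) powr p)" by (intro mult_left_mono Iw) auto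
  also have "\<dots> = ennreal (2 * pi * (X / real N) powr p)"
    using c X0 N0 by (simp add: powr_mult powr_divide flip: ennreal_mult)
  finally have "integral_mean p a G \<le> X / real N"
    using a p X0 N0 by (subst integral_mean_le_iff) (auto intro: Gc)
  also have "\<dots> \<le> 10 / 3 * K + D / 3"
  proof -
    \<comment> \<open>Derivative and function contribute 2 K N and 4 N K / 3, together 10 N K / 3;
      the factor 2 in the bound for K below turns 10 / 3 into 20 / 3.\<close>
    have "2 * K / (1 - a) \<le> 2 * K * real N" using mult_left_mono[OF N1, of "2 * K"] K0 by simp
    then have "X \<le> 2 * K * real N + 4 * real N / 3 * K + D * (real N / 3)"
      unfolding X_def by (intro add_right_mono)
    also have "\<dots> = (10 / 3 * K + D / 3) * real N" by (simp add: algebra_simps)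
    finally have "X \<le> (10 / 3 * K + D / 3) * real N" .
    then show ?thesis using N0 by (simp add: divide_le_eq)
  qed
  also have "K \<le> C * (2 * (1 - a) powr (1 / p - 1))"
  proof -
    have e: "(1 - a) powr (1 / p - 1) = 1 / (1 - a) powr (1 - 1 / p)"
      by (simp add: powr_minus_divide[symmetric])
    have "real N powr (1 - 1 / p) \<le> (2 / (1 - a)) powr (1 - 1 / p)" using N2 p by (intro powr_mono2) auto
    also have "\<dots> = 2 powr (1 - 1 / p) * (1 - a) powr (1 / p - 1)"
      using a by (simp add: powr_divide e)
    also have "2 powr (1 - 1 / p) \<le> (2::real) powr 1" using p by (intro powr_mono) auto
    finally show ?thesis unfolding K_def using C by (intro mult_left_mono) (auto simp: mult_right_mono)
  qed
  finally show ?thesis unfolding D_def G_def by (simp add: algebra_simps)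
qed

text \<open>The best constant S on (0, a] satisfies S \<le> 20 C / 3 + S / 3 unless S < C; in both
  cases S \<le> 10 C, which no longer depends on a.\<close>

lemma deriv_bound_of_bounded:
  assumes p: "2 < p" and g: "g holomorphic_on ball 0 1" and bd: "bounded_on_hardy p (hilbert_op g)"
  obtains C where "0 < C" "\<And>a. 0 < a \<Longrightarrow> a < 1 \<Longrightarrow> integral_mean p a (deriv g) \<le> C * (1 - a) powr (1 / p - 1)"
proof -
  from bd obtain C0 where C0: "\<And>f. f \<in> hardy p \<Longrightarrow> hilbert_op g f \<in> hardy p \<and> hardy_norm p (hilbert_op g f) \<le> C0 * hardy_norm p f"
    unfolding bounded_on_hardy_def by blast
  define C where "C = max C0 1"
  have C: "0 < C" by (simp add: C_def)
  have CC: "hilbert_op g f \<in> hardy p \<and> hardy_norm p (hilbert_op g f) \<le> C * hardy_norm p f" if "f \<in> hardy p" for f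
  proof -
    have "C0 * hardy_norm p f \<le> C * hardy_norm p f"
      using hardy_norm_nonneg[OF that] by (intro mult_right_mono) (auto simp: C_def)
    then show ?thesis using C0[OF that] by auto
  qed
  define G where "G = deriv g"
  have Gc: "continuous_on (ball 0 1) G" unfolding G_def by (rule holomorphic_on_deriv_disc[OF g])
  have "integral_mean p a G \<le> 10 * C * (1 - a) powr (1 / p - 1)" if a: "0 < a" "a < 1" for a
  proof -
    let ?q = "\<lambda>s. integral_mean p s G * (1 - s) powr (1 - 1 / p)"
    \<comment> \<open>Compactness makes the supremum over (0, a] finite; without this, S could not
      be subtracted in the final comparison.\<close>
    have "compact (G ` cball 0 a)" using a by (intro compact_continuous_image continuous_on_subset[OF Gc]) auto
    then obtain M where M: "\<And>z. z \<in> cball 0 a \<Longrightarrow> norm (G z) \<le> M" "0 < M"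
      by (metis bounded_pos compact_imp_bounded imageI)
    have qM: "?q s \<le> M" if s: "0 < s" "s \<le> a" for s
    proof -
      have "circle_powr p s G \<le> nnint {0..2*pi} (\<lambda>t. M powr p)"
        using M s p by (intro nn_integral_mono) (auto simp: indicator_def norm_mult intro!: ennreal_leI powr_mono2)
      also have "\<dots> = ennreal (2 * pi * M powr p)"
        by (simp add: nn_integral_cmult mult.commute flip: ennreal_mult)
      finally have 1: "integral_mean p s G \<le> M"
        using s a p M by (subst integral_mean_le_iff) (auto intro: Gc)
      have "(1 - s) powr (1 - 1 / p) \<le> 1" using s a p by (intro powr_le1) auto
      then have "?q s \<le> M * 1" using 1 M by (intro mult_mono) auto
      then show ?thesis by simp
    qed
    define S where "S = (SUP s\<in>{0<..a}. ?q s)"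
    have qS: "?q s \<le> S" if "0 < s" "s \<le> a" for s
      unfolding S_def using that qM by (intro cSUP_upper bdd_aboveI2[of _ _ M]) auto
    have mono: "integral_mean p s G \<le> L * (1 - s) powr (1 / p - 1) \<longleftrightarrow> ?q s \<le> L" if "0 < s" "s \<le> a" for s L
    proof -
      have "(1 - s) powr (1 / p - 1) = 1 / (1 - s) powr (1 - 1 / p)"
        by (simp add: powr_minus_divide[symmetric])
      then show ?thesis using that a by (simp add: pos_le_divide_eq)
    qed
    \<comment> \<open>\<open>deriv_bound_step\<close> asks for a strictly positive constant, while S
      is 0 for constant g.\<close>
    define L where "L = max S C"
    have L: "0 < L" "S \<le> L" "C \<le> L" using C by (auto simp: L_def)
    have "?q s \<le> 20 * C / 3 + L / 3" if s: "0 < s" "s \<le> a" for s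
    proof -
      have "integral_mean p s G \<le> (20 * C / 3 + L / 3) * (1 - s) powr (1 / p - 1)"
        unfolding G_def
      proof (rule deriv_bound_step[OF p g C L(1) CC])
        fix r assume r: "0 < r" "r \<le> s"
        show "integral_mean p r (deriv g) \<le> L * (1 - r) powr (1 / p - 1)"
          using mono[of r L] qS[of r] r s L unfolding G_def by auto
      qed (use s a in auto)
      then show ?thesis using mono[OF s] by simp
    qed
    then have "S \<le> 20 * C / 3 + L / 3" unfolding S_def using a by (intro cSUP_least) auto
    then have "S \<le> 10 * C" using C unfolding L_def by (auto simp: max_def split: if_splits)
    then show ?thesis using mono[of a "10 * C"] qS[of a] a by auto
  qed
  then show thesis using that[of "10 * C"] C by (auto simp: G_def)
qed

section \<open>From the growth of the derivative to the Lipschitz condition\<close>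

lemma nn_integral_fatou_le:
  fixes u :: "nat \<Rightarrow> real \<Rightarrow> real" and v :: "real \<Rightarrow> real"
  assumes [measurable]: "\<And>n. u n \<in> borel_measurable borel" "S \<in> sets borel"
    and lim: "AE x in lborel. x \<in> S \<longrightarrow> (\<lambda>n. u n x) \<longlonglongrightarrow> v x"
    and le: "eventually (\<lambda>n. nnint S (\<lambda>x. u n x) \<le> A) sequentially"
  shows "nnint S (\<lambda>x. v x) \<le> A"
proof -
  have "nnint S (\<lambda>x. v x) = (\<integral>\<^sup>+x. liminf (\<lambda>n. ennreal (u n x) * indicator S x) \<partial>lborel)"
  proof (rule nn_integral_cong_AE, use lim in eventually_elim)
    case (elim x)
    have "(\<lambda>n. ennreal (u n x) * indicator S x) \<longlonglongrightarrow> ennreal (v x) * indicator S x"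
      using elim by (cases "x \<in> S") (auto intro!: tendsto_ennrealI)
    then show ?case by (rule lim_imp_Liminf[OF sequentially_bot, symmetric])
  qed
  also have "\<dots> \<le> liminf (\<lambda>n. \<integral>\<^sup>+x\<in>S. ennreal (u n x) \<partial>lborel)"
    by (rule nn_integral_liminf) measurable
  also have "\<dots> \<le> limsup (\<lambda>n. \<integral>\<^sup>+x\<in>S. ennreal (u n x) \<partial>lborel)"
    by (rule Liminf_le_Limsup) simp
  also have "\<dots> \<le> A" by (rule Limsup_bounded[OF le])
  finally show ?thesis .
qed

lemma ex_cis_period:
  obtains k :: int where "0 \<le> t + 2 * pi * k" "t + 2 * pi * k \<le> 2 * pi"
proof
  let ?k = "- \<lfloor>t / (2 * pi)\<rfloor>"
  have 1: "of_int \<lfloor>t / (2 * pi)\<rfloor> \<le> t / (2 * pi)" and 2: "t / (2 * pi) < of_int \<lfloor>t / (2 * pi)\<rfloor> + 1" by linarith+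
  have "of_int \<lfloor>t / (2 * pi)\<rfloor> * (2 * pi) \<le> t" "t < (of_int \<lfloor>t / (2 * pi)\<rfloor> + 1) * (2 * pi)"
    using mult_right_mono[OF 1, of "2 * pi"] mult_strict_right_mono[OF 2, of "2 * pi"] by simp_all
  then show "0 \<le> t + 2 * pi * ?k" "t + 2 * pi * ?k \<le> 2 * pi" by (auto simp: algebra_simps)
qed

lemma cis_add_period: "cis (t + 2 * pi * of_int k) = cis t"
proof -
  have "cis (2 * pi * of_int k) = 1" by (intro cis_multiple_2pi) auto
  then show ?thesis by (simp flip: cis_mult)
qed

text \<open>The hypothesis speaks about one period only, whereas \<theta> + h leaves it. The
  exceptional set of angles is periodic, hence covered by countably many translates of its part in
  one period, and null sets are translation invariant.\<close>

lemma negligible_circle_shift: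
  assumes "AE \<theta> in lebesgue_on {0..2*pi}. P (cis \<theta>)"
  shows "negligible {\<theta>. \<not> P (cis (\<theta> + h))}"
proof -
  define E where "E = {\<theta>. \<not> P (cis \<theta>)}"
  have "AE \<theta> in lebesgue. \<theta> \<in> {0..2*pi} \<longrightarrow> P (cis \<theta>)"
    using assms by (subst (asm) AE_restrict_space_iff) auto
  then obtain N where "N \<in> null_sets lebesgue" "{\<theta>. \<not> (\<theta> \<in> {0..2*pi} \<longrightarrow> P (cis \<theta>))} \<subseteq> N"
    unfolding eventually_ae_filter by auto
  then have N: "negligible N" "E \<inter> {0..2*pi} \<subseteq> N"
    by (auto simp: negligible_iff_null_sets E_def)
  have E0: "negligible (E \<inter> {0..2*pi})" by (rule negligible_subset[OF N])
  have "E \<subseteq> (\<Union>k::int. (+) (2 * pi * of_int k) ` (E \<inter> {0..2*pi}))"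
  proof
    fix t assume t: "t \<in> E"
    obtain k :: int where k: "0 \<le> t + 2 * pi * k" "t + 2 * pi * k \<le> 2 * pi" by (rule ex_cis_period)
    have "t + 2 * pi * k \<in> E \<inter> {0..2*pi}" using t k by (simp add: E_def cis_add_period)
    moreover have "t = 2 * pi * of_int (- k) + (t + 2 * pi * k)" by simp
    ultimately show "t \<in> (\<Union>k::int. (+) (2 * pi * of_int k) ` (E \<inter> {0..2*pi}))" by blast
  qed
  moreover have "negligible (\<Union>k::int. (+) (2 * pi * of_int k) ` (E \<inter> {0..2*pi}))"
    using E0 by (intro negligible_countable_Union) (auto intro: negligible_translation)
  ultimately have "negligible E" by (rule negligible_subset[rotated])
  then have "negligible ((+) (-h) ` E)" by (rule negligible_translation)
  moreover have "{\<theta>. \<not> P (cis (\<theta> + h))} \<subseteq> (+) (-h) ` E"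
    by (auto simp: E_def intro!: image_eqI[where x = "_ + h"])
  ultimately show ?thesis by (rule negligible_subset)
qed

lemma AE_lborel_negligible:
  fixes P :: "real \<Rightarrow> bool"
  assumes "negligible {\<theta>. \<not> P \<theta>}" shows "AE \<theta> in lborel. P \<theta>"
proof -
  have "AE \<theta> in lebesgue. P \<theta>"
    using assms by (intro AE_I'[of "{\<theta>. \<not> P \<theta>}"]) (auto simp: negligible_iff_null_sets)
  then show ?thesis by (simp add: AE_completion_iff)
qed

text \<open>A fixed sequence in place of r tending to 1 from the left, as Fatou's lemma and
  measurability of limits require. The summand 2 keeps the first radius inside (0, 1).\<close>

definition approach_radius :: "nat \<Rightarrow> real" where
  "approach_radius n = 1 - 1 / (real n + 2)"

lemma approach_radius: "0 < approach_radius n" "approach_radius n < 1"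
  by (auto simp: approach_radius_def field_simps)

lemma approach_radius_tendsto: "approach_radius \<longlonglongrightarrow> 1"
proof -
  have "(\<lambda>n. 1 / (real n + 2)) \<longlonglongrightarrow> 0" by real_asymp
  from tendsto_diff[OF tendsto_const[of 1] this] show ?thesis
    unfolding approach_radius_def[abs_def] by simp
qed

lemma approach_radius_at_left: "filterlim approach_radius (at_left 1) sequentially"
  using approach_radius_tendsto approach_radius less_imp_neq[OF approach_radius(2)]
  by (auto simp: filterlim_at intro!: always_eventually)

text \<open>A Borel version of the boundary function: \<^const>\<open>boundary_fun\<close> itself is only
  Lebesgue measurable on the circle, which is not enough for composition with \<open>(t, \<theta>) \<mapsto> t + \<theta>\<close>.\<close>

definition boundary_lim :: "(complex \<Rightarrow> complex) \<Rightarrow> complex \<Rightarrow> complex" where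
  "boundary_lim g \<zeta> = lim (\<lambda>n. g (of_real (approach_radius n) * \<zeta>))"

lemma borel_measurable_circle:
  assumes "continuous_on (ball 0 1) g" "\<bar>r\<bar> < 1"
  shows "(\<lambda>t. g (of_real r * cis t)) \<in> borel_measurable borel"
  by (intro borel_measurable_continuous_onI continuous_on_circle assms)

lemma borel_measurable_boundary_lim:
  assumes "continuous_on (ball 0 1) g"
  shows "(\<lambda>t. boundary_lim g (cis t)) \<in> borel_measurable borel"
  unfolding boundary_lim_def
  by (intro borel_measurable_lim_metric borel_measurable_circle assms)
     (use approach_radius in \<open>simp add: abs_of_pos\<close>)

lemma has_radial_limitD:
  assumes "has_radial_limit g \<zeta>"
  shows "boundary_fun g \<zeta> = boundary_lim g \<zeta>"
    and "(\<lambda>n. g (of_real (approach_radius n) * \<zeta>)) \<longlonglongrightarrow> boundary_lim g \<zeta>"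
proof -
  obtain l where l: "((\<lambda>r::real. g (of_real r * \<zeta>)) \<longlongrightarrow> l) (at_left 1)"
    using assms by (auto simp: has_radial_limit_def)
  have 1: "boundary_fun g \<zeta> = l"
    unfolding boundary_fun_def by (rule tendsto_Lim[OF _ l]) simp
  have 2: "(\<lambda>n. g (of_real (approach_radius n) * \<zeta>)) \<longlonglongrightarrow> l"
    by (rule filterlim_compose[OF l approach_radius_at_left])
  then have "boundary_lim g \<zeta> = l" unfolding boundary_lim_def by (rule limI)
  then show "boundary_fun g \<zeta> = boundary_lim g \<zeta>"
    "(\<lambda>n. g (of_real (approach_radius n) * \<zeta>)) \<longlonglongrightarrow> boundary_lim g \<zeta>" using 1 2 by auto
qed

text \<open>Transfers an integral of a merely Lebesgue measurable k to a Borel function f that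
  agrees with it off a null set. Finiteness guarantees integrability; otherwise the Bochner integral
  would have the default value 0.\<close>

lemma LINT_lebesgue_on_eq_nn_integral:
  fixes f k :: "real \<Rightarrow> real"
  assumes [measurable]: "f \<in> borel_measurable borel" "S \<in> sets borel" and f0: "\<And>x. 0 \<le> f x"
    and fin: "nnint S (\<lambda>x. f x) < \<infinity>"
    and N: "negligible N" "\<And>x. x \<in> S - N \<Longrightarrow> k x = f x"
  shows "ennreal (LINT x|lebesgue_on S. k x) = nnint S (\<lambda>x. f x)"
proof -
  have eq: "nnint S (\<lambda>x. f x) = (\<integral>\<^sup>+x. ennreal (indicator S x *\<^sub>R f x) \<partial>lborel)"
    by (intro nn_integral_cong) (auto simp: indicator_def)
  have si: "set_integrable lborel S f"
    unfolding set_integrable_def using fin eq f0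
    by (intro integrableI_nonneg) (auto simp: indicator_def)
  have fi: "f integrable_on S" and LI: "(LINT x:S|lborel. f x) = integral S f"
    using set_borel_integral_eq_integral[OF si] by auto
  have "f absolutely_integrable_on S" by (rule nonnegative_absolutely_integrable_1[OF fi f0])
  then have "k absolutely_integrable_on S" by (rule absolutely_integrable_spike[OF _ N])
  then have "integrable (lebesgue_on S) k" by (intro absolutely_integrable_imp_integrable) auto
  then have "(LINT x|lebesgue_on S. k x) = integral S k" by (intro lebesgue_integral_eq_integral) auto
  also have "\<dots> = integral S f" using N by (intro integral_spike[of N]) auto
  also have "\<dots> = (LINT x|lborel. indicator S x *\<^sub>R f x)"
    using LI by (simp add: set_lebesgue_integral_def)
  also have "ennreal \<dots> = (\<integral>\<^sup>+x. ennreal (indicator S x *\<^sub>R f x) \<partial>lborel)"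
    using si f0 unfolding set_integrable_def by (intro nn_integral_eq_integral[symmetric]) auto
  finally show ?thesis using eq by simp
qed

text \<open>The integral inside \<open>modulus_of_continuity\<close>, taken of the Borel
  representative and with values in the extended nonnegative reals.\<close>

abbreviation shift_difference :: "real \<Rightarrow> (complex \<Rightarrow> complex) \<Rightarrow> real \<Rightarrow> ennreal" where
  "shift_difference p g h \<equiv> (\<integral>\<^sup>+\<theta>\<in>{0..2*pi}.
     ennreal (norm (boundary_lim g (cis (\<theta> + h)) - boundary_lim g (cis \<theta>)) powr p) \<partial>lborel)"

text \<open>The boundary counterpart of \<open>integral_mean_le_iff\<close>. For a divergent
  integral the left-hand side would read 0 \<le> K and hold for no good reason; the finiteness
  assumption excludes this.\<close>

lemma shift_mean_le_iff:
  assumes g: "continuous_on (ball 0 1) g" and p: "0 < p" and K: "0 \<le> K"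
    and AE: "AE \<theta> in lebesgue_on {0..2*pi}. has_radial_limit g (cis \<theta>)"
    and fin: "shift_difference p g h < \<infinity>"
  shows "(1 / (2 * pi) * (LINT \<theta>|lebesgue_on {0..2*pi}.
            norm (boundary_fun g (cis (\<theta> + h)) - boundary_fun g (cis \<theta>)) powr p)) powr (1 / p) \<le> K
      \<longleftrightarrow> shift_difference p g h \<le> ennreal (2 * pi * K powr p)"
proof -
  note borel_measurable_boundary_lim[OF g, measurable]
  define I where "I = (LINT \<theta>|lebesgue_on {0..2*pi}.
            norm (boundary_fun g (cis (\<theta> + h)) - boundary_fun g (cis \<theta>)) powr p)"
  have I0: "0 \<le> I" unfolding I_def by simp
  have bl[measurable]: "(\<lambda>\<theta>. boundary_lim g (cis (\<theta> + h))) \<in> borel_measurable borel"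
    using measurable_compose[OF _ borel_measurable_boundary_lim[OF g], of "\<lambda>\<theta>. \<theta> + h" borel] by simp
  have Ieq: "ennreal I = shift_difference p g h"
    unfolding I_def
  proof (rule LINT_lebesgue_on_eq_nn_integral)
    \<comment> \<open>Radial limits are needed at both ends of the increment; the unshifted end is
      treated as a shift by 0.\<close>
    show "negligible ({\<theta>. \<not> has_radial_limit g (cis (\<theta> + h))} \<union> {\<theta>. \<not> has_radial_limit g (cis (\<theta> + 0))})"
      by (intro negligible_Un negligible_circle_shift AE)
  qed (use fin in \<open>auto simp: has_radial_limitD\<close>)
  show ?thesis using normalized_root_le_iff[OF I0 p K] unfolding Ieq unfolding I_def .
qed

lemma circle_powr_boundary_le:
  assumes g: "continuous_on (ball 0 1) g" and p: "0 < p"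
    and AE: "AE \<theta> in lebesgue_on {0..2*pi}. has_radial_limit g (cis \<theta>)"
    and A: "\<And>r. 0 < r \<Longrightarrow> r < 1 \<Longrightarrow> circle_powr p r g \<le> A"
  shows "nnint {0..2*pi} (\<lambda>\<theta>. norm (boundary_lim g (cis \<theta>)) powr p) \<le> A"
proof (rule nn_integral_fatou_le[where u = "\<lambda>n t. norm (g (of_real (approach_radius n) * cis t)) powr p"])
  fix n
  have [measurable]: "(\<lambda>t. g (of_real (approach_radius n) * cis t)) \<in> borel_measurable borel"
    by (intro borel_measurable_circle g) (use approach_radius in \<open>simp add: abs_of_pos\<close>)
  show "(\<lambda>t. norm (g (of_real (approach_radius n) * cis t)) powr p) \<in> borel_measurable borel"
    by measurable
next
  have "AE \<theta> in lborel. has_radial_limit g (cis (\<theta> + 0))"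
    by (intro AE_lborel_negligible negligible_circle_shift AE)
  then show "AE \<theta> in lborel. \<theta> \<in> {0..2*pi} \<longrightarrow>
      (\<lambda>n. norm (g (of_real (approach_radius n) * cis \<theta>)) powr p) \<longlonglongrightarrow> norm (boundary_lim g (cis \<theta>)) powr p"
    by eventually_elim (use p in \<open>auto intro!: tendsto_powr' tendsto_intros has_radial_limitD\<close>)
qed (use A approach_radius in auto)

lemma real_circle_constant:
  assumes "0 < p" obtains c :: real where "0 < c" "c powr p = 2 * pi"
  using that[of "(2 * pi) powr (1 / p)"] assms by (auto simp: powr_powr)

section \<open>Boundary increments of a function with controlled derivative\<close>

context
  fixes p C :: real and g :: "complex \<Rightarrow> complex"
  assumes p: "1 < p" and g: "g holomorphic_on ball 0 1" and C: "0 < C"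
    and bd: "\<And>a. 0 < a \<Longrightarrow> a < 1 \<Longrightarrow> integral_mean p a (deriv g) \<le> C * (1 - a) powr (1 / p - 1)"
begin

private lemma gc: "continuous_on (ball 0 1) g" and Gc: "continuous_on (ball 0 1) (deriv g)"
  using holomorphic_on_imp_continuous_on[OF g] holomorphic_on_deriv_disc[OF g] by auto

private lemma deriv_circle:
  assumes "0 < a" "a < 1"
  shows "circle_powr p a (deriv g) \<le> ennreal (2 * pi * (C * (1 - a) powr (1 / p - 1)) powr p)"
  using bd[OF assms] assms p C by (subst (asm) integral_mean_le_iff) (auto intro: Gc)

text \<open>Integrating g' along the radius leaves the integral of (1 - s) powr (1/p - 1). It is
  extended from R up to 1, which makes the bound independent of R and allows R to tend to 1
  afterwards.\<close>

lemma radial_difference_le: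
  assumes r: "0 \<le> \<rho>" "\<rho> < R" "R < 1"
  shows "nnint {0..2*pi} (\<lambda>t. norm (g (of_real R * cis t) - g (of_real \<rho> * cis t)) powr p)
     \<le> ennreal (2 * pi * (C * p * (1 - \<rho>) powr (1 / p)) powr p)"
proof -
  obtain c where c: "0 < c" "c powr p = 2 * pi" using p real_circle_constant[of p] by auto
  have [measurable]: "disc_cut (deriv g) \<in> borel_measurable borel" by (rule borel_measurable_disc_cut[OF Gc])
  have "nnint {0..2*pi} (\<lambda>t. norm (g (of_real R * cis t) - g (of_real \<rho> * cis t)) powr p)
     \<le> ennreal ((c * C * (p * (1 - \<rho>) powr (1 / p))) powr p)"
  proof (rule minkowski_powr[where M = lborel and N = lborel and S = "{\<rho><..<1}" and
        F = "\<lambda>s t. norm (disc_cut (deriv g) (of_real s * cis t))" and B = "\<lambda>s. c * C * (1 - s) powr (1 / p - 1)"])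
    show "(\<lambda>(s, t). norm (disc_cut (deriv g) (of_real s * cis t))) \<in> borel_measurable (lborel \<Otimes>\<^sub>M lborel)"
      by measurable
    have "nnint {\<rho><..<1} (\<lambda>s. c * C * (1 - s) powr (1 / p - 1))
      = (\<integral>\<^sup>+s. ennreal (c * C) * (ennreal ((1 - s) powr (1 / p - 1)) * indicator {\<rho><..<1} s) \<partial>lborel)"
      using c C by (intro nn_integral_cong) (auto simp: indicator_def simp flip: ennreal_mult)
    also have "\<dots> = ennreal (c * C) * nnint {\<rho><..<1} (\<lambda>s. (1 - s) powr (1 / p - 1))"
      by (rule nn_integral_cmult) measurable
    also have "\<dots> = ennreal (c * C) * ennreal (p * (1 - \<rho>) powr (1 / p))"
      using p r by (subst nn_integral_one_minus_powr) (auto simp: mult.commute)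
    also have "\<dots> = ennreal (c * C * (p * (1 - \<rho>) powr (1 / p)))"
      using c C p by (intro ennreal_mult[symmetric]) auto
    finally show "nnint {\<rho><..<1} (\<lambda>s. c * C * (1 - s) powr (1 / p - 1)) \<le> ennreal (c * C * (p * (1 - \<rho>) powr (1 / p)))"
      by simp
  next
    fix s assume s: "s \<in> {\<rho><..<1}"
    then have "nnint {0..2*pi} (\<lambda>t. norm (disc_cut (deriv g) (of_real s * cis t)) powr p) = circle_powr p s (deriv g)"
      using r by (simp add: norm_mult)
    also have "\<dots> \<le> ennreal (2 * pi * (C * (1 - s) powr (1 / p - 1)) powr p)"
      using s r by (intro deriv_circle) auto
    also have "2 * pi * (C * (1 - s) powr (1 / p - 1)) powr p = (c * C * (1 - s) powr (1 / p - 1)) powr p"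
      unfolding mult.assoc[of c] using c C by (subst powr_mult[of c]) auto
    finally show "nnint {0..2*pi} (\<lambda>t. norm (disc_cut (deriv g) (of_real s * cis t)) powr p)
      \<le> ennreal ((c * C * (1 - s) powr (1 / p - 1)) powr p)" .
  next
    fix t :: real
    have ds: "((\<lambda>s. g (of_real s * cis t)) has_vector_derivative (deriv g (of_real s * cis t) * cis t)) (at s within {\<rho>..R})"
      if "s \<in> {\<rho>..R}" for s
    proof -
      have "norm (of_real s * cis t) < 1" using that r by (simp add: norm_mult)
      then have "(g has_field_derivative deriv g (of_real s * cis t)) (at (of_real s * cis t))"
        by (intro holomorphic_derivI[OF g]) auto
      then have "((\<lambda>z. g (z * cis t)) has_field_derivative deriv g (of_real s * cis t) * cis t) (at (of_real s))"
        by (rule DERIV_chain2) (auto intro!: derivative_eq_intros)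
      from has_vector_derivative_real_field[OF this] show ?thesis .
    qed
    have cont: "continuous_on {\<rho>..R} (\<lambda>s. deriv g (of_real s * cis t) * cis t)"
      using r by (intro continuous_intros continuous_on_ray[where S = "{\<rho>..R}"] continuous_on_compose2[OF Gc]) (auto simp: norm_mult)
    have "((\<lambda>s. deriv g (of_real s * cis t) * cis t) has_integral (g (of_real R * cis t) - g (of_real \<rho> * cis t))) {\<rho>..R}"
      using r by (intro fundamental_theorem_of_calculus ds) auto
    then have e: "g (of_real R * cis t) - g (of_real \<rho> * cis t) = integral {\<rho>..R} (\<lambda>s. deriv g (of_real s * cis t) * cis t)"
      by (rule integral_unique[symmetric])
    have "ennreal (norm (g (of_real R * cis t) - g (of_real \<rho> * cis t)))
      \<le> nnint {\<rho>..R} (\<lambda>s. norm (deriv g (of_real s * cis t) * cis t))"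
      unfolding e by (rule norm_integral_le_nn_integral[OF cont])
    also have "\<dots> \<le> nnint {\<rho><..<1} (\<lambda>s. norm (disc_cut (deriv g) (of_real s * cis t)))"
    proof (rule nn_integral_mono_AE, use AE_lborel_singleton[of \<rho>] in eventually_elim)
      case (elim s)
      then show ?case using r by (auto simp: indicator_def norm_mult)
    qed
    finally show "ennreal (norm (g (of_real R * cis t) - g (of_real \<rho> * cis t)))
      \<le> nnint {\<rho><..<1} (\<lambda>s. norm (disc_cut (deriv g) (of_real s * cis t)))" .
  qed (use p c C r in \<open>auto intro!: sigma_finite_lborel mult_pos_pos\<close>)
  also have "(c * C * (p * (1 - \<rho>) powr (1 / p))) powr p = 2 * pi * (C * p * (1 - \<rho>) powr (1 / p)) powr p"
    unfolding mult.assoc using c C p by (subst powr_mult[of c]) auto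
  finally show ?thesis .
qed

lemma hardy_of_deriv_bound: "g \<in> hardy p"
proof -
  obtain c where c: "0 < c" "c powr p = 2 * pi" using p real_circle_constant[of p] by auto
  \<comment> \<open>The summand 1 keeps the bound for the constant function g 0 positive, as
    \<open>triangle_powr\<close> demands.\<close>
  have "integral_mean p r g \<le> C * p + (norm (g 0) + 1)" if r: "0 < r" "r < 1" for r
  proof -
    have [measurable]: "(\<lambda>t. g (of_real r * cis t)) \<in> borel_measurable borel"
      using r by (intro borel_measurable_circle gc) auto
    have d: "nnint {0..2*pi} (\<lambda>t. norm (g (of_real r * cis t) - g 0) powr p) \<le> ennreal ((c * (C * p)) powr p)"
      using radial_difference_le[of 0 r] r C p c by (simp add: powr_mult)
    have k: "nnint {0..2*pi} (\<lambda>t. (norm (g 0) + 1) powr p) \<le> ennreal ((c * (norm (g 0) + 1)) powr p)"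
      using c by (simp add: nn_integral_cmult powr_mult mult.commute flip: ennreal_mult)
    have tri: "norm (g (of_real r * cis t)) \<le> norm (g (of_real r * cis t) - g 0) + (norm (g 0) + 1)" for t
      using norm_triangle_sub[of "g (of_real r * cis t)" "g 0"] by simp
    have "circle_powr p r g \<le> ennreal ((c * (C * p) + c * (norm (g 0) + 1)) powr p)"
      by (rule triangle_powr[OF sigma_finite_lborel p _ _ _ _ _ _ _ d k])
         (use c C p tri in \<open>auto intro!: mult_pos_pos add_nonneg_pos\<close>)
    also have "(c * (C * p) + c * (norm (g 0) + 1)) powr p = 2 * pi * (C * p + (norm (g 0) + 1)) powr p"
      unfolding distrib_left[symmetric] using c C p by (subst powr_mult[of c]) (auto intro!: add_nonneg_nonneg)
    finally show ?thesis using r p C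
      by (subst integral_mean_le_iff) (auto intro!: gc add_nonneg_nonneg)
  qed
  from hardyI[OF g this] show ?thesis by auto
qed

text \<open>Existence of radial limits is obtained directly from the growth condition: by Tonelli g'
  is integrable along almost every radius, since (1 - s) powr (1/p - 1) is integrable, and on such a
  radius g is g 0 plus an indefinite integral that is continuous up to the endpoint.\<close>

lemma AE_radial_limit: "AE \<theta> in lebesgue_on {0..2*pi}. has_radial_limit g (cis \<theta>)"
proof -
  obtain c where c: "0 < c" "c powr p = 2 * pi" using p real_circle_constant[of p] by auto
  define q where "q = p / (p - 1)"
  have q: "1 < q" "1 / p + 1 / q = 1" using p by (auto simp: q_def field_simps)
  obtain d where d: "0 < d" "d powr q = 2 * pi" using q real_circle_constant[of q] by auto
  define G where "G = disc_cut (deriv g)"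
  have [measurable]: "G \<in> borel_measurable borel" unfolding G_def by (rule borel_measurable_disc_cut[OF Gc])
  have inner: "nnint {0..2*pi} (\<lambda>t. norm (G (of_real s * cis t))) \<le> ennreal (c * C * d * (1 - s) powr (1 / p - 1))"
    if s: "0 < s" "s < 1" for s
  proof -
    have "nnint {0..2*pi} (\<lambda>t. norm (G (of_real s * cis t)) powr p) = circle_powr p s (deriv g)"
      using s by (simp add: norm_mult G_def)
    also have "\<dots> \<le> ennreal (2 * pi * (C * (1 - s) powr (1 / p - 1)) powr p)"
      using s by (intro deriv_circle) auto
    also have "2 * pi * (C * (1 - s) powr (1 / p - 1)) powr p = (c * (C * (1 - s) powr (1 / p - 1))) powr p"
      using c C by (subst powr_mult[of c]) auto
    finally have 1: "nnint {0..2*pi} (\<lambda>t. norm (G (of_real s * cis t)) powr p)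
      \<le> ennreal ((c * (C * (1 - s) powr (1 / p - 1))) powr p)" .
    \<comment> \<open>Hoelder against the constant 1 passes from the L^p mean to the L^1 mean of the
      derivative on the circle.\<close>
    have 2: "nnint {0..2*pi} (\<lambda>t. 1 powr q) \<le> ennreal (d powr q)" using d by simp
    have "nnint {0..2*pi} (\<lambda>t. norm (G (of_real s * cis t)) * 1) \<le> ennreal (c * (C * (1 - s) powr (1 / p - 1)) * d)"
      by (rule hoelder_powr[OF p q(1,2) _ _ _ _ _ _ _ 1 2]) (use c C d s in auto)
    then show ?thesis by (simp add: mult_ac)
  qed
  have "(\<integral>\<^sup>+t. (\<integral>\<^sup>+s. ennreal (norm (G (of_real s * cis t))) * indicator {0<..<1} s * indicator {0..2*pi} t \<partial>lborel) \<partial>lborel)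
     = (\<integral>\<^sup>+s. (\<integral>\<^sup>+t. ennreal (norm (G (of_real s * cis t))) * indicator {0<..<1} s * indicator {0..2*pi} t \<partial>lborel) \<partial>lborel)"
    by (rule lborel_pair.Fubini') measurable
  also have "\<dots> \<le> (\<integral>\<^sup>+s. ennreal (c * C * d) * (ennreal ((1 - s) powr (1 / p - 1)) * indicator {0<..<1} s) \<partial>lborel)"
  proof (rule nn_integral_mono)
    fix s :: real
    show "(\<integral>\<^sup>+t. ennreal (norm (G (of_real s * cis t))) * indicator {0<..<1} s * indicator {0..2*pi} t \<partial>lborel)
      \<le> ennreal (c * C * d) * (ennreal ((1 - s) powr (1 / p - 1)) * indicator {0<..<1} s)"
      using inner[of s] c C d by (cases "s \<in> {0<..<1}") (auto simp flip: ennreal_mult)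
  qed
  also have "\<dots> = ennreal (c * C * d) * nnint {0<..<1} (\<lambda>s. (1 - s) powr (1 / p - 1))"
    by (rule nn_integral_cmult) measurable
  also have "\<dots> < \<infinity>"
    using p by (subst nn_integral_one_minus_powr) (auto simp flip: ennreal_mult'')
  finally have fin: "(\<integral>\<^sup>+t. (\<integral>\<^sup>+s. ennreal (norm (G (of_real s * cis t))) * indicator {0<..<1} s * indicator {0..2*pi} t \<partial>lborel) \<partial>lborel) < \<infinity>" .
  have "AE t in lborel. (\<integral>\<^sup>+s. ennreal (norm (G (of_real s * cis t))) * indicator {0<..<1} s * indicator {0..2*pi} t \<partial>lborel) \<noteq> \<infinity>"
  proof (rule nn_integral_PInf_AE)
    show "(\<integral>\<^sup>+t. (\<integral>\<^sup>+s. ennreal (norm (G (of_real s * cis t))) * indicator {0<..<1} s * indicator {0..2*pi} t \<partial>lborel) \<partial>lborel) \<noteq> \<infinity>"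
      using fin by auto
  qed measurable
  then have "AE t in lborel. t \<in> {0..2*pi} \<longrightarrow> has_radial_limit g (cis t)"
  proof eventually_elim
    case (elim t)
    show ?case
    proof
      assume t: "t \<in> {0..2*pi}"
      define k where "k s = G (of_real s * cis t) * cis t" for s :: real
      have [measurable]: "k \<in> borel_measurable borel" unfolding k_def by measurable
      have nn: "(\<integral>\<^sup>+s. ennreal (norm (indicator {0<..<1} s *\<^sub>R k s)) \<partial>lborel) < \<infinity>"
      proof -
        have "(\<integral>\<^sup>+s. ennreal (norm (indicator {0<..<1} s *\<^sub>R k s)) \<partial>lborel) = 
          (\<integral>\<^sup>+s. ennreal (norm (G (of_real s * cis t))) * indicator {0<..<1} s * indicator {0..2*pi} t \<partial>lborel)"
          using t by (intro nn_integral_cong) (auto simp: k_def indicator_def norm_mult)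
        then show ?thesis using elim by (simp add: top.not_eq_extremum)
      qed
      have "set_integrable lborel {0<..<1} k"
        unfolding set_integrable_def using nn by (intro integrableI_bounded) auto
      then have "k integrable_on {0<..<1}" by (rule set_borel_integral_eq_integral)
      then have "k integrable_on {0..1}" by (simp add: integrable_on_open_interval_real)
      then have ci: "continuous_on {0..1} (\<lambda>x. integral {0..x} k)" by (rule indefinite_integral_continuous_1)
      then have "((\<lambda>x. integral {0..x} k) \<longlongrightarrow> integral {0..1} k) (at 1 within {0..1})"
        by (auto simp: continuous_on)
      then have lim: "((\<lambda>x. integral {0..x} k) \<longlongrightarrow> integral {0..1} k) (at_left 1)"
        by (simp add: at_within_Icc_at_left)
      have "g (of_real x * cis t) = g 0 + integral {0..x} k" if x: "0 < x" "x < 1" for x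
      proof -
        have "((\<lambda>s. deriv g (of_real s * cis t) * cis t) has_integral (g (of_real x * cis t) - g (of_real 0 * cis t))) {0..x}"
        proof (rule fundamental_theorem_of_calculus)
          fix s assume s: "s \<in> {0..x}"
          have "norm (of_real s * cis t) < 1" using s x by (simp add: norm_mult)
          then have "(g has_field_derivative deriv g (of_real s * cis t)) (at (of_real s * cis t))"
            by (intro holomorphic_derivI[OF g]) auto
          then have "((\<lambda>z. g (z * cis t)) has_field_derivative deriv g (of_real s * cis t) * cis t) (at (of_real s))"
            by (rule DERIV_chain2) (auto intro!: derivative_eq_intros)
          from has_vector_derivative_real_field[OF this]
          show "((\<lambda>s. g (of_real s * cis t)) has_vector_derivative (deriv g (of_real s * cis t) * cis t)) (at s within {0..x})" .
        qed (use x in auto)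
        then have "(k has_integral (g (of_real x * cis t) - g (of_real 0 * cis t))) {0..x}"
          by (rule has_integral_eq[rotated]) (use x in \<open>auto simp: k_def G_def norm_mult\<close>)
        then show ?thesis by (simp add: integral_unique)
      qed
      then have "eventually (\<lambda>x. g 0 + integral {0..x} k = g (of_real x * cis t)) (at_left 1)"
        by (auto simp: eventually_at_left_field intro!: exI[of _ 0])
      moreover have "((\<lambda>x. g 0 + integral {0..x} k) \<longlongrightarrow> g 0 + integral {0..1} k) (at_left 1)"
        by (intro tendsto_intros lim)
      ultimately show "has_radial_limit g (cis t)"
        unfolding has_radial_limit_def by (blast intro: Lim_transform_eventually)
    qed
  qed
  then have "AE t in lebesgue. t \<in> {0..2*pi} \<longrightarrow> has_radial_limit g (cis t)" by (rule AE_completion)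
  then show ?thesis by (subst AE_restrict_space_iff) auto
qed

lemma boundary_difference_le:
  assumes r: "0 \<le> \<rho>" "\<rho> < 1"
  shows "nnint {0..2*pi} (\<lambda>t. norm (boundary_lim g (cis t) - g (of_real \<rho> * cis t)) powr p)
     \<le> ennreal (2 * pi * (C * p * (1 - \<rho>) powr (1 / p)) powr p)"
proof (rule nn_integral_fatou_le[where u = "\<lambda>n t. norm (g (of_real (approach_radius n) * cis t) - g (of_real \<rho> * cis t)) powr p"])
  fix n
  have [measurable]: "(\<lambda>t. g (of_real (approach_radius n) * cis t)) \<in> borel_measurable borel"
    "(\<lambda>t. g (of_real \<rho> * cis t)) \<in> borel_measurable borel"
    by (intro borel_measurable_circle gc, use approach_radius r in \<open>simp add: abs_of_pos\<close>)+
  show "(\<lambda>t. norm (g (of_real (approach_radius n) * cis t) - g (of_real \<rho> * cis t)) powr p) \<in> borel_measurable borel"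
    by measurable
next
  have "AE \<theta> in lborel. has_radial_limit g (cis (\<theta> + 0))"
    by (intro AE_lborel_negligible negligible_circle_shift AE_radial_limit)
  then show "AE \<theta> in lborel. \<theta> \<in> {0..2*pi} \<longrightarrow>
      (\<lambda>n. norm (g (of_real (approach_radius n) * cis \<theta>) - g (of_real \<rho> * cis \<theta>)) powr p)
      \<longlonglongrightarrow> norm (boundary_lim g (cis \<theta>) - g (of_real \<rho> * cis \<theta>)) powr p"
    by eventually_elim (use p in \<open>auto intro!: tendsto_powr' tendsto_intros has_radial_limitD\<close>)
  have "eventually (\<lambda>n. \<rho> < approach_radius n) sequentially"
    using approach_radius_tendsto r by (auto dest: order_tendstoD)
  then show "eventually (\<lambda>n. nnint {0..2*pi} (\<lambda>t. norm (g (of_real (approach_radius n) * cis t) - g (of_real \<rho> * cis t)) powr p)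
     \<le> ennreal (2 * pi * (C * p * (1 - \<rho>) powr (1 / p)) powr p)) sequentially"
    by eventually_elim (use radial_difference_le approach_radius r in auto)
qed auto

text \<open>On the circle of radius 1 - h the derivative has mean at most C * h powr (1/p - 1), and
  the arc of angle h is integrated over: the exponents add up to 1/p.\<close>

lemma tangential_difference_le:
  assumes h: "0 < h" "h < 1"
  shows "nnint {0..2*pi} (\<lambda>t. norm (g (of_real (1 - h) * cis (t + h)) - g (of_real (1 - h) * cis t)) powr p)
     \<le> ennreal (2 * pi * (C * h powr (1 / p)) powr p)"
proof -
  obtain c where c: "0 < c" "c powr p = 2 * pi" using p real_circle_constant[of p] by auto
  define \<rho> where "\<rho> = 1 - h"
  have \<rho>: "0 < \<rho>" "\<rho> < 1" "1 - \<rho> = h" using h by (auto simp: \<rho>_def)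
  have [measurable]: "(\<lambda>t. deriv g (of_real \<rho> * cis t)) \<in> borel_measurable borel"
    using \<rho> by (intro borel_measurable_circle Gc) auto
  have [measurable]: "(\<lambda>(s, t). deriv g (of_real \<rho> * cis (t + s))) \<in> borel_measurable (lborel \<Otimes>\<^sub>M lborel)"
    using measurable_compose[of "\<lambda>(s, t). t + s" "lborel \<Otimes>\<^sub>M lborel" borel "\<lambda>t. deriv g (of_real \<rho> * cis t)" borel]
    by (simp add: case_prod_beta')
  have "nnint {0..2*pi} (\<lambda>t. norm (g (of_real \<rho> * cis (t + h)) - g (of_real \<rho> * cis t)) powr p)
     \<le> ennreal ((c * C * h powr (1 / p)) powr p)"
  proof (rule minkowski_powr[where M = lborel and N = lborel and S = "{0..h}" and
        F = "\<lambda>s t. norm (deriv g (of_real \<rho> * cis (t + s)))" and B = "\<lambda>s. c * C * h powr (1 / p - 1)"])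
    show "(\<lambda>(s, t). norm (deriv g (of_real \<rho> * cis (t + s)))) \<in> borel_measurable (lborel \<Otimes>\<^sub>M lborel)"
      by measurable
    show "nnint {0..h} (\<lambda>s. c * C * h powr (1 / p - 1)) \<le> ennreal (c * C * h powr (1 / p))"
      using h c C by (simp add: powr_diff nn_integral_cmult flip: ennreal_mult)
  next
    fix s assume s: "s \<in> {0..h}"
    have "nnint {0..2*pi} (\<lambda>t. norm (deriv g (of_real \<rho> * cis (t + s))) powr p) = circle_powr p \<rho> (deriv g)"
      using s \<rho> h pi_gt3 by (intro circle_powr_shift Gc) auto
    also have "\<dots> \<le> ennreal (2 * pi * (C * h powr (1 / p - 1)) powr p)"
      using deriv_circle[of \<rho>] \<rho> by simp
    also have "2 * pi * (C * h powr (1 / p - 1)) powr p = (c * C * h powr (1 / p - 1)) powr p"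
      unfolding mult.assoc[of c] using c C by (subst powr_mult[of c]) auto
    finally show "nnint {0..2*pi} (\<lambda>t. norm (deriv g (of_real \<rho> * cis (t + s))) powr p)
      \<le> ennreal ((c * C * h powr (1 / p - 1)) powr p)" .
  next
    fix t :: real
    let ?d = "\<lambda>s. deriv g (of_real \<rho> * cis (t + s)) * (of_real \<rho> * (\<i> * cis (t + s)))"
    have ds: "((\<lambda>s. g (of_real \<rho> * cis (t + s))) has_vector_derivative ?d s) (at s within {0..h})" for s
    proof -
      have "norm (of_real \<rho> * exp (\<i> * (of_real t + of_real s))) < 1" using \<rho> by (simp add: norm_mult)
      then have "(g has_field_derivative deriv g (of_real \<rho> * exp (\<i> * (of_real t + of_real s)))) (at (of_real \<rho> * exp (\<i> * (of_real t + of_real s))))"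
        by (intro holomorphic_derivI[OF g]) auto
      then have "((\<lambda>z. g (of_real \<rho> * exp (\<i> * (of_real t + z)))) has_field_derivative
         deriv g (of_real \<rho> * exp (\<i> * (of_real t + of_real s))) * (of_real \<rho> * (\<i> * exp (\<i> * (of_real t + of_real s))))) (at (of_real s))"
        by (rule DERIV_chain2) (auto intro!: derivative_eq_intros)
      from has_vector_derivative_real_field[OF this] show ?thesis by (simp add: cis_conv_exp)
    qed
    have cont: "continuous_on {0..h} ?d"
      using \<rho> by (intro continuous_intros continuous_on_compose2[OF Gc]) (auto simp: norm_mult)
    have "(?d has_integral (g (of_real \<rho> * cis (t + h)) - g (of_real \<rho> * cis (t + 0)))) {0..h}"
      using h by (intro fundamental_theorem_of_calculus ds) auto
    then have e: "g (of_real \<rho> * cis (t + h)) - g (of_real \<rho> * cis t) = integral {0..h} ?d"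
      by (subst integral_unique[symmetric]) auto
    have "ennreal (norm (g (of_real \<rho> * cis (t + h)) - g (of_real \<rho> * cis t)))
      \<le> nnint {0..h} (\<lambda>s. norm (?d s))"
      unfolding e by (rule norm_integral_le_nn_integral[OF cont])
    also have "\<dots> \<le> nnint {0..h} (\<lambda>s. norm (deriv g (of_real \<rho> * cis (t + s))))"
      using \<rho> by (intro nn_integral_mono mult_right_mono ennreal_leI) (auto simp: norm_mult intro!: mult_left_le)
    finally show "ennreal (norm (g (of_real \<rho> * cis (t + h)) - g (of_real \<rho> * cis t)))
      \<le> nnint {0..h} (\<lambda>s. norm (deriv g (of_real \<rho> * cis (t + s))))" .
  qed (use p c C h in \<open>auto intro!: sigma_finite_lborel mult_pos_pos\<close>)
  also have "(c * C * h powr (1 / p)) powr p = 2 * pi * (C * h powr (1 / p)) powr p"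
    unfolding mult.assoc using c C p by (subst powr_mult[of c]) auto
  finally show ?thesis unfolding \<rho>_def .
qed

text \<open>The path between the two boundary points runs down to the radius 1 - h, along the arc
  and up again. The two radial pieces cost C p each and the arc costs C, all times h powr
  (1/p).\<close>

lemma shift_difference_le:
  assumes h: "0 < h" "h < 1"
  shows "shift_difference p g h \<le> ennreal (2 * pi * ((2 * C * p + C) * h powr (1 / p)) powr p)"
proof -
  obtain c where c: "0 < c" "c powr p = 2 * pi" using p real_circle_constant[of p] by auto
  define \<rho> where "\<rho> = 1 - h"
  have \<rho>: "0 < \<rho>" "\<rho> < 1" "1 - \<rho> = h" using h by (auto simp: \<rho>_def)
  note borel_measurable_boundary_lim[OF gc, measurable]
  have bl[measurable]: "(\<lambda>\<theta>. boundary_lim g (cis (\<theta> + h))) \<in> borel_measurable borel"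
    using measurable_compose[OF _ borel_measurable_boundary_lim[OF gc], of "\<lambda>\<theta>. \<theta> + h" borel] by simp
  have gr[measurable]: "(\<lambda>t. g (of_real \<rho> * cis t)) \<in> borel_measurable borel"
    using \<rho> by (intro borel_measurable_circle gc) auto
  have [measurable]: "(\<lambda>t. g (of_real \<rho> * cis (t + h))) \<in> borel_measurable borel"
    using measurable_compose[OF _ gr, of "\<lambda>\<theta>. \<theta> + h" borel] by simp
  define u where "u z = norm (boundary_lim g z - g (of_real \<rho> * z))" for z
  have um[measurable]: "(\<lambda>t. u (cis t)) \<in> borel_measurable borel" unfolding u_def by measurable
  have [measurable]: "(\<lambda>t. u (cis (t + h))) \<in> borel_measurable borel" unfolding u_def by measurable
  have e1: "2 * pi * (C * p * h powr (1 / p)) powr p = (c * (C * p * h powr (1 / p))) powr p"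
    using c C p by (subst powr_mult[of c]) auto
  have e2: "2 * pi * (C * h powr (1 / p)) powr p = (c * (C * h powr (1 / p))) powr p"
    using c C p by (subst powr_mult[of c]) auto
  have I1: "nnint {0..2*pi} (\<lambda>t. u (cis t) powr p) \<le> ennreal ((c * (C * p * h powr (1 / p))) powr p)"
    unfolding u_def e1[symmetric] using boundary_difference_le[of \<rho>] \<rho> by simp
  have "nnint {0..2*pi} (\<lambda>t. u (cis (t + h)) powr p) = nnint {0..2*pi} (\<lambda>t. u (cis t) powr p)"
    by (rule nn_integral_circle_shift[of "\<lambda>z. ennreal (u z powr p)"]) (use h pi_gt3 in auto)
  with I1 have I2: "nnint {0..2*pi} (\<lambda>t. u (cis (t + h)) powr p) \<le> ennreal ((c * (C * p * h powr (1 / p))) powr p)" by simp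
  have I3: "nnint {0..2*pi} (\<lambda>t. norm (g (of_real \<rho> * cis (t + h)) - g (of_real \<rho> * cis t)) powr p) \<le> ennreal ((c * (C * h powr (1 / p))) powr p)"
    using tangential_difference_le[OF h] unfolding e2 \<rho>_def .
  have I12: "nnint {0..2*pi} (\<lambda>t. (u (cis t) + u (cis (t + h))) powr p)
     \<le> ennreal ((c * (C * p * h powr (1 / p)) + c * (C * p * h powr (1 / p))) powr p)"
    by (rule triangle_powr[OF sigma_finite_lborel p _ _ _ _ _ _ _ I1 I2])
       (use p c C h in \<open>auto simp: u_def\<close>)
  have "shift_difference p g h \<le> ennreal ((c * (C * p * h powr (1 / p)) + c * (C * p * h powr (1 / p)) + c * (C * h powr (1 / p))) powr p)"
  proof (rule triangle_powr[OF sigma_finite_lborel p _ _ _ _ _ _ _ I12 I3])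
    fix t
    have "boundary_lim g (cis (t + h)) - boundary_lim g (cis t)
      = (boundary_lim g (cis (t + h)) - g (of_real \<rho> * cis (t + h))) - (boundary_lim g (cis t) - g (of_real \<rho> * cis t))
        + (g (of_real \<rho> * cis (t + h)) - g (of_real \<rho> * cis t))" by simp
    also have "norm \<dots> \<le> u (cis (t + h)) + u (cis t) + norm (g (of_real \<rho> * cis (t + h)) - g (of_real \<rho> * cis t))"
      unfolding u_def by (intro order_trans[OF norm_triangle_ineq] add_right_mono norm_triangle_ineq4)
    finally show "norm (boundary_lim g (cis (t + h)) - boundary_lim g (cis t)) \<le> u (cis t) + u (cis (t + h)) + norm (g (of_real \<rho> * cis (t + h)) - g (of_real \<rho> * cis t))" 
      by simp
  qed (use p c C h in \<open>auto simp: u_def intro!: add_pos_pos\<close>)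
  also have "c * (C * p * h powr (1 / p)) + c * (C * p * h powr (1 / p)) + c * (C * h powr (1 / p)) = c * ((2 * C * p + C) * h powr (1 / p))"
    by (simp add: algebra_simps)
  also have "(c * ((2 * C * p + C) * h powr (1 / p))) powr p = 2 * pi * ((2 * C * p + C) * h powr (1 / p)) powr p"
    using c C p by (subst powr_mult[of c]) auto
  finally show ?thesis .
qed

lemma mean_lipschitz_of_deriv_bound: "g \<in> mean_lipschitz p (1 / p)"
proof -
  let ?E = "2 * C * p + C"
  have E: "0 < ?E" using C p by (simp add: add_pos_pos)
  let ?m = "\<lambda>h. (1 / (2 * pi) * (LINT \<theta>|lebesgue_on {0..2*pi}.
            norm (boundary_fun g (cis (\<theta> + h)) - boundary_fun g (cis \<theta>)) powr p)) powr (1 / p)"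
  have m: "?m h \<le> ?E * h powr (1 / p)" if h: "0 < h" "h < 1" for h
    using shift_difference_le[OF h] h p E
    by (subst shift_mean_le_iff[OF gc _ _ AE_radial_limit]) (auto intro: order_le_less_trans)
  have "norm (modulus_of_continuity p g t) \<le> ?E * norm (t powr (1 / p))" if t: "0 < t" "t < 1" for t
  proof -
    have mt: "?m h \<le> ?E * t powr (1 / p)" if "h \<in> {0<..t}" for h
    proof -
      have "?m h \<le> ?E * h powr (1 / p)" using that t by (intro m) auto
      also have "\<dots> \<le> ?E * t powr (1 / p)" using that t p E by (intro mult_left_mono powr_mono2) auto
      finally show ?thesis .
    qed
    have 1: "modulus_of_continuity p g t \<le> ?E * t powr (1 / p)"
      unfolding modulus_of_continuity_def using t by (intro cSUP_least mt) auto
    \<comment> \<open>The Landau condition bounds an absolute value, so the supremum must be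
      nonnegative. It dominates its member at h = t because the set has just been shown to be
      bounded.\<close>
    have "0 \<le> ?m t" by simp
    also have "?m t \<le> modulus_of_continuity p g t"
      unfolding modulus_of_continuity_def using t mt
      by (intro cSUP_upper bdd_aboveI2[where M = "?E * t powr (1 / p)"]) auto
    finally show ?thesis using 1 by simp
  qed
  then have "eventually (\<lambda>t. norm (modulus_of_continuity p g t) \<le> ?E * norm (t powr (1 / p))) (at_right 0)"
    by (auto simp: eventually_at_right_field intro!: exI[of _ 1])
  then have "modulus_of_continuity p g \<in> O[at_right 0](\<lambda>t. t powr (1 / p))" by (rule bigoI)
  then show ?thesis unfolding mean_lipschitz_def using hardy_of_deriv_bound AE_radial_limit by auto
qed

end

section \<open>From the Lipschitz condition to the growth of the derivative\<close>

lemma sin_ge_half: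
  fixes x :: real
  assumes "0 \<le> x" "x \<le> pi / 2"
  shows "x / 2 \<le> sin x"
proof (cases "x \<le> pi / 3")
  case True
  have "0 / 2 - sin 0 \<ge> x / 2 - sin x"
  proof (rule DERIV_nonpos_imp_nonincreasing[OF assms(1)])
    fix y assume y: "0 \<le> y" "y \<le> x"
    have "cos (pi / 3) \<le> cos y" using y True by (intro cos_monotone_0_pi_le) auto
    then have "1 / 2 - cos y \<le> 0" by (simp add: cos_60)
    moreover have "((\<lambda>x. x / 2 - sin x) has_real_derivative 1 / 2 - cos y) (at y)"
      by (auto intro!: derivative_eq_intros)
    ultimately show "\<exists>d. ((\<lambda>x. x / 2 - sin x) has_real_derivative d) (at y) \<and> d \<le> 0" by blast
  qed
  then show ?thesis by simp
next
  case False
  \<comment> \<open>Here the sine is at least sqrt 3 / 2 \<ge> 17/20, while x / 2 \<le> pi / 4 \<le>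
    17/20.\<close>
  have "sin (pi / 3) \<le> sin x" using False assms by (intro sin_monotone_2pi_le) auto
  moreover have "sqrt 3 / 2 \<ge> 17 / 20" using real_le_rsqrt[of "17 / 10" 3] by (simp add: power2_eq_square)
  moreover have "x \<le> 17 / 10" using assms pi_less_4 pi_approx by simp
  ultimately show ?thesis by (simp add: sin_60)
qed

text \<open>The distance is at least 1 - r and at least \<theta> / 4, the latter through the chord
  from 1 to cis \<theta>. Averaging the squares gives the crude constant 32 = 2 * 16. The purpose is
  to replace the circle kernels by homogeneous kernels on a half-line.\<close>

lemma norm_cis_minus_ge:
  assumes r: "0 \<le> r" "r < 1" and \<theta>: "0 \<le> \<theta>" "\<theta> \<le> pi"
  shows "((1 - r)\<^sup>2 + \<theta>\<^sup>2) / 32 \<le> (norm (cis \<theta> - complex_of_real r))\<^sup>2"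
proof -
  let ?n = "norm (cis \<theta> - complex_of_real r)"
  have 1: "1 - r \<le> ?n" using norm_triangle_ineq2[of "cis \<theta>" "complex_of_real r"] r by simp
  have "norm (cis \<theta> - 1) = 2 * sin (\<theta> / 2)"
  proof -
    have "(norm (cis \<theta> - 1))\<^sup>2 = (cos \<theta> - 1)\<^sup>2 + (sin \<theta>)\<^sup>2" by (simp add: cmod_power2)
    also have "\<dots> = (sin \<theta>)\<^sup>2 + (cos \<theta>)\<^sup>2 + 1 - 2 * cos \<theta>" by (simp add: power2_eq_square algebra_simps)
    also have "\<dots> = 2 - 2 * cos (2 * (\<theta> / 2))" by simp
    also have "\<dots> = (2 * sin (\<theta> / 2))\<^sup>2" unfolding cos_double_sin by (simp add: power2_eq_square)
    finally show ?thesis using \<theta> by (subst (asm) power2_eq_iff_nonneg) (auto intro!: sin_ge_zero)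
  qed
  also have "2 * sin (\<theta> / 2) \<ge> \<theta> / 2" using sin_ge_half[of "\<theta> / 2"] \<theta> by simp
  finally have "\<theta> / 2 \<le> norm (cis \<theta> - 1)" .
  also have "\<dots> = norm ((cis \<theta> - complex_of_real r) - complex_of_real (1 - r))" by simp
  also have "\<dots> \<le> ?n + (1 - r)" using norm_triangle_ineq4[of "cis \<theta> - complex_of_real r" "complex_of_real (1 - r)"] r
    by (simp del: of_real_diff)
  also have "\<dots> \<le> 2 * ?n" using 1 by simp
  finally have 2: "\<theta> / 4 \<le> ?n" by simp
  have f1: "(1 - r)\<^sup>2 \<le> ?n\<^sup>2" using 1 r by (intro power_mono) auto
  have f2: "\<theta>\<^sup>2 / 16 \<le> ?n\<^sup>2" using power_mono[OF 2, of 2] \<theta> by (simp add: power_divide)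
  have gen: "(A + B) / 32 \<le> X" if "A \<le> X" "B / 16 \<le> X" "0 \<le> A" "0 \<le> B" for A B X :: real
    using that by simp
  show ?thesis by (rule gen[OF f1 f2]) auto
qed

lemma norm_cis_minus_reflect: "norm (cis (2 * pi - \<theta>) - complex_of_real r) = norm (cis \<theta> - complex_of_real r)"
proof -
  have "cis (2 * pi - \<theta>) - complex_of_real r = cnj (cis \<theta> - complex_of_real r)"
    by (simp add: complex_eq_iff)
  then show ?thesis by (simp only: complex_mod_cnj)
qed

lemma norm_cis_minus_ge':
  assumes r: "0 \<le> r" "r < 1" and \<theta>: "0 \<le> \<theta>" "\<theta> \<le> 2 * pi"
  shows "((1 - r)\<^sup>2 + (min \<theta> (2 * pi - \<theta>))\<^sup>2) / 32 \<le> (norm (cis \<theta> - complex_of_real r))\<^sup>2"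
proof (cases "\<theta> \<le> pi")
  case True
  then show ?thesis using norm_cis_minus_ge[OF r, of \<theta>] \<theta> by (simp add: min_absorb1)
next
  case False
  then show ?thesis using norm_cis_minus_ge[OF r, of "2 * pi - \<theta>"] \<theta>
    by (simp add: min_absorb2 norm_cis_minus_reflect)
qed

text \<open>The substitution x = \<delta> u. For a = 1/q and \<delta> = 1 - r the power \<delta>
  powr (a - 1) is exactly the growth condition.\<close>

lemma nn_integral_scaled_kernel:
  assumes a: "-1 < a" "a < 1" and \<delta>: "0 < \<delta>"
    and b: "nnint {0<..} (\<lambda>u. u powr a / (1 + u\<^sup>2)) \<le> ennreal b" and b0: "0 \<le> b"
  shows "nnint {0<..} (\<lambda>x. x powr a / (\<delta>\<^sup>2 + x\<^sup>2)) \<le> ennreal (b * \<delta> powr (a - 1))"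
proof -
  have "nnint {0<..} (\<lambda>x. x powr a / (\<delta>\<^sup>2 + x\<^sup>2))
    = ennreal \<delta> * (\<integral>\<^sup>+u. ennreal ((0 + \<delta> * u) powr a / (\<delta>\<^sup>2 + (0 + \<delta> * u)\<^sup>2)) * indicator {0<..} (0 + \<delta> * u) \<partial>lborel)"
    using \<delta> by (subst nn_integral_real_affine[where c = \<delta> and t = 0]) auto
  also have "(\<integral>\<^sup>+u. ennreal ((0 + \<delta> * u) powr a / (\<delta>\<^sup>2 + (0 + \<delta> * u)\<^sup>2)) * indicator {0<..} (0 + \<delta> * u) \<partial>lborel)
    = (\<integral>\<^sup>+u. ennreal (\<delta> powr (a - 2)) * (ennreal (u powr a / (1 + u\<^sup>2)) * indicator {0<..} u) \<partial>lborel)"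
  proof (intro nn_integral_cong)
    fix u
    show "ennreal ((0 + \<delta> * u) powr a / (\<delta>\<^sup>2 + (0 + \<delta> * u)\<^sup>2)) * indicator {0<..} (0 + \<delta> * u)
      = ennreal (\<delta> powr (a - 2)) * (ennreal (u powr a / (1 + u\<^sup>2)) * indicator {0<..} u)"
    proof (cases "0 < u")
      case True
      have "\<delta>\<^sup>2 + (\<delta> * u)\<^sup>2 = \<delta>\<^sup>2 * (1 + u\<^sup>2)" by (simp add: algebra_simps power2_eq_square)
      moreover have "\<delta> powr (a - 2) = \<delta> powr a / \<delta>\<^sup>2" using \<delta> by (simp add: powr_diff)
      ultimately show ?thesis using True \<delta> by (simp add: powr_mult flip: ennreal_mult)
    next
      case False
      then show ?thesis using \<delta> by (simp add: zero_less_mult_iff)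
    qed
  qed
  also have "\<dots> = ennreal (\<delta> powr (a - 2)) * nnint {0<..} (\<lambda>u. u powr a / (1 + u\<^sup>2))"
    by (rule nn_integral_cmult) measurable
  also have "ennreal \<delta> * (ennreal (\<delta> powr (a - 2)) * nnint {0<..} (\<lambda>u. u powr a / (1 + u\<^sup>2)))
     \<le> ennreal \<delta> * (ennreal (\<delta> powr (a - 2)) * ennreal b)"
    by (intro mult_left_mono b) auto
  also have "\<dots> = ennreal (b * \<delta> powr (a - 1))"
  proof -
    have "\<delta> * \<delta> powr (a - 2) = \<delta> powr 1 * \<delta> powr (a - 2)" using \<delta> by simp
    also have "\<dots> = \<delta> powr (a - 1)" by (subst powr_add[symmetric]) simp
    finally show ?thesis using \<delta> b0 by (simp add: mult_ac flip: ennreal_mult)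
  qed
  finally show ?thesis .
qed

section \<open>The derivative as an integral of boundary differences\<close>

context
  fixes q K :: real and g :: "complex \<Rightarrow> complex"
  assumes q: "1 < q" and g: "g holomorphic_on ball 0 1" and K: "0 < K"
    and gK: "\<And>r. 0 < r \<Longrightarrow> r < 1 \<Longrightarrow> circle_powr q r g \<le> ennreal (2 * pi * K powr q)"
    and AE: "AE \<theta> in lebesgue_on {0..2*pi}. has_radial_limit g (cis \<theta>)"
begin

private lemma g_cont: "continuous_on (ball 0 1) g"
  by (rule holomorphic_on_imp_continuous_on[OF g])

private lemma beta_meas [measurable]: "(\<lambda>t. boundary_lim g (cis t)) \<in> borel_measurable borel"
  by (rule borel_measurable_boundary_lim[OF g_cont])

private lemma beta_shift_meas [measurable]: "(\<lambda>t. boundary_lim g (cis (t + h))) \<in> borel_measurable borel"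
  using measurable_compose[OF _ beta_meas, of "\<lambda>\<theta>. \<theta> + h" borel] by simp

private lemma beta_bound:
  "nnint {0..2*pi} (\<lambda>t. norm (boundary_lim g (cis t)) powr q) \<le> ennreal (2 * pi * K powr q)"
  using q by (intro circle_powr_boundary_le g_cont AE gK) auto

text \<open>Supplies the finiteness required by \<open>shift_mean_le_iff\<close> and the bound for
  shifts that are not small, about which a condition at 0 says nothing.\<close>

lemma shift_difference_bounded:
  assumes h: "0 \<le> h" "h \<le> 2 * pi"
  shows "shift_difference q g h \<le> ennreal (2 * pi * (2 * K) powr q)"
proof -
  obtain c where c: "0 < c" "c powr q = 2 * pi" using q real_circle_constant[of q] by auto
  have e: "2 * pi * K powr q = (c * K) powr q" using c K by (simp add: powr_mult)
  have 1: "nnint {0..2*pi} (\<lambda>t. norm (boundary_lim g (cis t)) powr q) \<le> ennreal ((c * K) powr q)"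
    using beta_bound unfolding e .
  have "nnint {0..2*pi} (\<lambda>t. norm (boundary_lim g (cis (t + h))) powr q)
    = nnint {0..2*pi} (\<lambda>t. norm (boundary_lim g (cis t)) powr q)"
    by (rule nn_integral_circle_shift[of "\<lambda>z. ennreal (norm (boundary_lim g z) powr q)"]) (use h in auto)
  with 1 have 2: "nnint {0..2*pi} (\<lambda>t. norm (boundary_lim g (cis (t + h))) powr q) \<le> ennreal ((c * K) powr q)"
    by simp
  have "shift_difference q g h \<le> ennreal ((c * K + c * K) powr q)"
    by (rule triangle_powr[OF sigma_finite_lborel q _ _ _ _ _ _ _ 2 1])
       (use c K in \<open>auto intro: norm_triangle_ineq4\<close>)
  also have "(c * K + c * K) powr q = 2 * pi * (2 * K) powr q"
    using c K by (simp add: powr_mult flip: mult_2)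
  finally show ?thesis .
qed

text \<open>Pointwise convergence almost everywhere together with bounded L^q norms, q > 1, gives
  L^1 convergence. The difference d is cut at a height L: min d L converges by domination, and the
  excess is controlled uniformly in n by the q-th power.\<close>

lemma boundary_convergence_L1:
  assumes \<epsilon>: "0 < \<epsilon>"
  shows "eventually (\<lambda>n. nnint {0..2*pi} (\<lambda>t. norm (g (of_real (approach_radius n) * cis t) - boundary_lim g (cis t)))
     \<le> ennreal \<epsilon>) sequentially"
proof -
  obtain c where c: "0 < c" "c powr q = 2 * pi" using q real_circle_constant[of q] by auto
  have e: "2 * pi * K powr q = (c * K) powr q" using c K by (simp add: powr_mult)
  define d where "d n t = norm (g (of_real (approach_radius n) * cis t) - boundary_lim g (cis t))" for n t
  have gm[measurable]: "(\<lambda>t. g (of_real (approach_radius n) * cis t)) \<in> borel_measurable borel" for n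
    by (intro borel_measurable_circle g_cont) (use approach_radius[of n] in \<open>simp add: abs_of_pos\<close>)
  have [measurable]: "d n \<in> borel_measurable borel" for n unfolding d_def[abs_def] by measurable
  define M where "M = (c * K + c * K) powr q"
  have M0: "0 < M" using c K by (simp add: M_def)
  have dM: "nnint {0..2*pi} (\<lambda>t. d n t powr q) \<le> ennreal M" for n
    unfolding M_def
  proof (rule triangle_powr[OF sigma_finite_lborel q, where u = "\<lambda>t. norm (g (of_real (approach_radius n) * cis t))" and v = "\<lambda>t. norm (boundary_lim g (cis t))"])
    show "nnint {0..2*pi} (\<lambda>t. norm (g (of_real (approach_radius n) * cis t)) powr q) \<le> ennreal ((c * K) powr q)"
      using gK[OF approach_radius] unfolding e .
    show "nnint {0..2*pi} (\<lambda>t. norm (boundary_lim g (cis t)) powr q) \<le> ennreal ((c * K) powr q)"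
      using beta_bound unfolding e .
  qed (use c K in \<open>auto simp: d_def intro: norm_triangle_ineq4\<close>)
  \<comment> \<open>Where d > L, one has d \<le> L powr (1 - q) * d powr q. The height is chosen so
    that the integral of this majorant is at most \<epsilon> / 2.\<close>
  define L where "L = (\<epsilon> / (2 * M)) powr (1 / (1 - q))"
  have L: "0 < L" "L powr (1 - q) = \<epsilon> / (2 * M)" using \<epsilon> M0 q by (auto simp: L_def powr_powr)
  have split: "d n t \<le> min (d n t) L + L powr (1 - q) * d n t powr q" for n t
  proof (cases "d n t \<le> L")
    case False
    then have "d n t = d n t powr (1 - q) * d n t powr q" using L by (simp flip: powr_add)
    also have "\<dots> \<le> L powr (1 - q) * d n t powr q"
      using False L q by (intro mult_right_mono powr_mono2') auto
    finally have "d n t \<le> L powr (1 - q) * d n t powr q" .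
    moreover have "0 \<le> min (d n t) L" using L False by simp
    ultimately have "0 + d n t \<le> min (d n t) L + L powr (1 - q) * d n t powr q" by (intro add_mono)
    then show ?thesis by simp
  qed simp
  have "(\<lambda>n. \<integral>\<^sup>+t. ennreal (min (d n t) L) * indicator {0..2*pi} t \<partial>lborel) \<longlonglongrightarrow> (\<integral>\<^sup>+t. 0 \<partial>(lborel :: real measure))"
  proof (rule nn_integral_dominated_convergence[where w = "\<lambda>t. ennreal L * indicator {0..2*pi} t"])
    show "(\<integral>\<^sup>+t. ennreal L * indicator {0..2*pi} t \<partial>(lborel :: real measure)) < \<infinity>"
      by (simp add: nn_integral_cmult ennreal_mult_less_top)
    show "AE t in lborel. ennreal (min (d n t) L) * indicator {0..2*pi} t \<le> ennreal L * indicator {0..2*pi} t" for n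
      by (intro AE_I2 mult_right_mono ennreal_leI) auto
    have "AE \<theta> in lborel. has_radial_limit g (cis (\<theta> + 0))"
      by (intro AE_lborel_negligible negligible_circle_shift AE)
    then show "AE t in lborel. (\<lambda>n. ennreal (min (d n t) L) * indicator {0..2*pi} t) \<longlonglongrightarrow> 0"
    proof eventually_elim
      case (elim t)
      then have "(\<lambda>n. g (of_real (approach_radius n) * cis t) - boundary_lim g (cis t)) \<longlonglongrightarrow> boundary_lim g (cis t) - boundary_lim g (cis t)"
        by (intro tendsto_intros has_radial_limitD) auto
      then have "(\<lambda>n. d n t) \<longlonglongrightarrow> 0" unfolding d_def by (simp add: tendsto_norm_zero_iff)
      then have "(\<lambda>n. min (d n t) L) \<longlonglongrightarrow> min 0 L" by (intro tendsto_min tendsto_const)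
      then have "(\<lambda>n. ennreal (min (d n t) L)) \<longlonglongrightarrow> ennreal 0" using L by (intro tendsto_ennrealI) (simp add: min_def)
      then show ?case by (cases "t \<in> {0..2*pi}") auto
    qed
  qed auto
  then have "eventually (\<lambda>n. (\<integral>\<^sup>+t. ennreal (min (d n t) L) * indicator {0..2*pi} t \<partial>lborel) < ennreal (\<epsilon> / 2)) sequentially"
    using \<epsilon> by (intro order_tendstoD(2)) auto
  then show ?thesis
  proof eventually_elim
    case (elim n)
    have "nnint {0..2*pi} (\<lambda>t. d n t) \<le> (\<integral>\<^sup>+t. ennreal (min (d n t) L) * indicator {0..2*pi} t
       + ennreal (\<epsilon> / (2 * M)) * (ennreal (d n t powr q) * indicator {0..2*pi} t) \<partial>lborel)"
    proof (rule nn_integral_mono)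
      fix t
      have nn: "0 \<le> min (d n t) L" "0 \<le> \<epsilon> / (2 * M) * d n t powr q" "0 \<le> \<epsilon> / (2 * M)"
        using \<epsilon> M0 L by (simp_all add: d_def)
      have eq: "ennreal (min (d n t) L + \<epsilon> / (2 * M) * d n t powr q) = ennreal (min (d n t) L) + ennreal (\<epsilon> / (2 * M)) * ennreal (d n t powr q)"
        unfolding ennreal_plus[OF nn(1,2)] by (subst ennreal_mult[OF nn(3)]) simp_all
      have "ennreal (d n t) \<le> ennreal (min (d n t) L) + ennreal (\<epsilon> / (2 * M)) * ennreal (d n t powr q)"
        using ennreal_leI[OF split[of n t]] unfolding L(2) eq .
      then show "ennreal (d n t) * indicator {0..2*pi} t \<le> ennreal (min (d n t) L) * indicator {0..2*pi} t
         + ennreal (\<epsilon> / (2 * M)) * (ennreal (d n t powr q) * indicator {0..2*pi} t)"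
        by (cases "t \<in> {0..2*pi}") auto
    qed
    also have "\<dots> = (\<integral>\<^sup>+t. ennreal (min (d n t) L) * indicator {0..2*pi} t \<partial>lborel)
       + ennreal (\<epsilon> / (2 * M)) * nnint {0..2*pi} (\<lambda>t. d n t powr q)"
      by (subst nn_integral_add) (auto simp: nn_integral_cmult)
    also have "\<dots> \<le> ennreal (\<epsilon> / 2) + ennreal (\<epsilon> / (2 * M)) * ennreal M"
      using elim by (intro add_mono mult_left_mono dM) auto
    also have "\<dots> = ennreal \<epsilon>" using \<epsilon> M0 by (simp flip: ennreal_mult ennreal_plus)
    finally show ?case unfolding d_def .
  qed
qed

text \<open>Cauchy's formula holds on radii R < 1 only, and R tends to 1 afterwards. For fixed r the
  kernel stays bounded, so L^1 convergence to the boundary function is enough and leaves an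
  arbitrarily small error. The factor 4 pays for replacing the kernel at radius R by the one at
  radius 1.\<close>

lemma deriv_le_boundary_integral:
  assumes r: "0 \<le> r" "r < 1"
  shows "ennreal (2 * pi * norm (deriv g (of_real r * cis t)))
    \<le> nnint {0..2*pi} (\<lambda>\<theta>. norm (boundary_lim g (cis (\<theta> + t)) - boundary_lim g (cis t)) * (4 / (norm (cis \<theta> - complex_of_real r))\<^sup>2))"
    (is "_ \<le> ?I")
proof (rule ennreal_le_epsilon)
  fix \<epsilon> :: real assume \<epsilon>: "0 < \<epsilon>"
  obtain k where k: "0 \<le> t + 2 * pi * of_int k" "t + 2 * pi * of_int k \<le> 2 * pi" by (rule ex_cis_period)
  \<comment> \<open>The same boundary point with its angle reduced to one period, as the rotation
    lemma requires of shifts.\<close>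
  define t' where "t' = t + 2 * pi * of_int k"
  have t': "cis t' = cis t" "0 \<le> t'" "t' \<le> 2 * pi" using k by (auto simp: t'_def cis_add_period)
  have ct: "cis (\<theta> + t') = cis (\<theta> + t)" for \<theta> using t' by (simp flip: cis_mult)
  define \<eta> where "\<eta> = \<epsilon> * (1 - r)\<^sup>2 / 4"
  have \<eta>: "0 < \<eta>" using \<epsilon> r by (simp add: \<eta>_def)
  have "eventually (\<lambda>n. (1 + r) / 2 < approach_radius n) sequentially"
    using r by (intro order_tendstoD[OF approach_radius_tendsto]) auto
  then obtain n where n: "(1 + r) / 2 < approach_radius n"
    "nnint {0..2*pi} (\<lambda>t. norm (g (of_real (approach_radius n) * cis t) - boundary_lim g (cis t))) \<le> ennreal \<eta>"
    using eventually_happens[OF eventually_conj[OF _ boundary_convergence_L1[OF \<eta>]]] by auto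
  define R where "R = approach_radius n"
  have R: "r < R" "R < 1" "1 - R \<le> R - r" "(1 - r) / 2 \<le> R - r" "0 < R" 
    using n r approach_radius[of n] by (auto simp: R_def)
  \<comment> \<open>Subtracting a constant does not change the derivative; this particular constant
    produces the boundary differences. The inequality therefore holds at every t, whether or not a
    radial limit exists there.\<close>
  define b where "b = boundary_lim g (cis t)"
  let ?ker = "\<lambda>\<theta>. of_real R * cis \<theta> / (of_real R * cis \<theta> - complex_of_real r)\<^sup>2"
  let ?ft = "\<lambda>z. g (cis t * z) - b"
  have nz: "of_real R * cis \<theta> - complex_of_real r \<noteq> 0" for \<theta>
    by (intro circle_minus_nonzero) (use R r in auto)
  have hol: "?ft holomorphic_on ball 0 1"
    by (intro holomorphic_intros holomorphic_on_rotate g)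
  have dft: "deriv ?ft r = cis t * deriv g (cis t * r)"
  proof -
    have "(g has_field_derivative deriv g (cis t * r)) (at (cis t * r))"
      using r by (intro holomorphic_derivI[OF g]) (auto simp: norm_mult)
    then have "((\<lambda>z. g (cis t * z)) has_field_derivative deriv g (cis t * r) * cis t) (at (of_real r))"
      by (rule DERIV_chain2) (auto intro!: derivative_eq_intros)
    then have "(?ft has_field_derivative deriv g (cis t * r) * cis t - 0) (at (of_real r))"
      by (intro DERIV_diff DERIV_const)
    then show ?thesis by (simp add: DERIV_imp_deriv mult.commute)
  qed
  have hi: "((\<lambda>\<theta>. ?ft (of_real R * cis \<theta>) * ?ker \<theta>) has_integral (2 * pi * deriv ?ft r)) {0..2*pi}"
    by (rule has_integral_Cauchy_deriv_circle[OF hol]) (use R r in auto)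
  have e0: "norm (integral {0..2*pi} (\<lambda>\<theta>. ?ft (of_real R * cis \<theta>) * ?ker \<theta>)) = 2 * pi * norm (deriv g (of_real r * cis t))"
    unfolding integral_unique[OF hi] dft by (simp add: norm_mult mult.commute)
  have "ennreal (2 * pi * norm (deriv g (of_real r * cis t))) \<le> nnint {0..2*pi} (\<lambda>\<theta>. norm (?ft (of_real R * cis \<theta>) * ?ker \<theta>))"
    unfolding e0[symmetric] using nz R
    by (intro norm_integral_le_nn_integral continuous_intros continuous_on_circle holomorphic_on_imp_continuous_on[OF hol]
        holomorphic_on_imp_continuous_on[OF holomorphic_on_rotate[OF g]]) auto
  also have "\<dots> \<le> (\<integral>\<^sup>+\<theta>. ennreal (norm (boundary_lim g (cis (\<theta> + t)) - b) * (4 / (norm (cis \<theta> - complex_of_real r))\<^sup>2)) * indicator {0..2*pi} \<theta>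
      + ennreal (4 / (1 - r)\<^sup>2) * (ennreal (norm (g (of_real R * cis (\<theta> + t')) - boundary_lim g (cis (\<theta> + t')))) * indicator {0..2*pi} \<theta>) \<partial>lborel)"
  proof (rule nn_integral_mono)
    fix \<theta>
    let ?D = "norm (of_real R * cis \<theta> - complex_of_real r)"
    have D1: "R - r \<le> ?D" using norm_triangle_ineq2[of "of_real R * cis \<theta>" "complex_of_real r"] R r by (simp add: norm_mult)
    \<comment> \<open>R lies beyond the midpoint of r and 1, so moving from R cis \<theta> to cis
      \<theta> adds 1 - R \<le> R - r, which is at most the distance at radius R. Squaring gives the
      4.\<close>
    have D2: "norm (cis \<theta> - complex_of_real r) \<le> 2 * ?D"
    proof -
      have "cis \<theta> - complex_of_real r = (of_real R * cis \<theta> - complex_of_real r) + of_real (1 - R) * cis \<theta>" by (simp add: algebra_simps)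
      then have "norm (cis \<theta> - complex_of_real r) \<le> ?D + norm (of_real (1 - R) * cis \<theta>)" by (metis norm_triangle_ineq)
      also have "norm (of_real (1 - R) * cis \<theta>) = 1 - R" using R by (simp add: norm_mult del: of_real_diff)
      finally show ?thesis using D1 R by simp
    qed
    have D0: "0 < ?D" using nz by simp
    have n0: "0 < norm (cis \<theta> - complex_of_real r)" using circle_minus_nonzero[of r 1 \<theta>] r by simp
    have nk: "norm (?ker \<theta>) = R / ?D\<^sup>2" using R by (simp add: norm_divide norm_mult norm_power)
    have k1: "norm (?ker \<theta>) \<le> 4 / (norm (cis \<theta> - complex_of_real r))\<^sup>2"
    proof -
      have "(norm (cis \<theta> - complex_of_real r))\<^sup>2 \<le> 4 * ?D\<^sup>2" using power_mono[OF D2, of 2] by (simp add: power_mult_distrib)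
      then have "4 / (4 * ?D\<^sup>2) \<le> 4 / (norm (cis \<theta> - complex_of_real r))\<^sup>2" using n0 D0 by (intro divide_left_mono) auto
      moreover have "R / ?D\<^sup>2 \<le> 1 / ?D\<^sup>2" using R by (intro divide_right_mono) auto
      ultimately show ?thesis unfolding nk by simp
    qed
    have k2: "norm (?ker \<theta>) \<le> 4 / (1 - r)\<^sup>2"
    proof -
      have "((1 - r) / 2)\<^sup>2 \<le> ?D\<^sup>2" using D1 R r by (intro power_mono) auto
      then have "1 / ?D\<^sup>2 \<le> 1 / ((1 - r) / 2)\<^sup>2" using r D0 by (intro divide_left_mono) auto
      moreover have "R / ?D\<^sup>2 \<le> 1 / ?D\<^sup>2" using R by (intro divide_right_mono) auto
      ultimately show ?thesis unfolding nk by (simp add: power_divide)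
    qed
    have cc: "cis t * (of_real R * cis \<theta>) = of_real R * cis (\<theta> + t')" unfolding ct by (simp add: cis_mult[symmetric] mult_ac)
    have "norm (?ft (of_real R * cis \<theta>)) \<le> norm (boundary_lim g (cis (\<theta> + t')) - b) + norm (g (of_real R * cis (\<theta> + t')) - boundary_lim g (cis (\<theta> + t')))"
      unfolding cc using norm_triangle_ineq[of "boundary_lim g (cis (\<theta> + t')) - b" "g (of_real R * cis (\<theta> + t')) - boundary_lim g (cis (\<theta> + t'))"] by simp
    then have "norm (?ft (of_real R * cis \<theta>)) * norm (?ker \<theta>) \<le> (norm (boundary_lim g (cis (\<theta> + t')) - b) + norm (g (of_real R * cis (\<theta> + t')) - boundary_lim g (cis (\<theta> + t')))) * norm (?ker \<theta>)"
      by (intro mult_right_mono) auto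
    also have "\<dots> \<le> norm (boundary_lim g (cis (\<theta> + t')) - b) * (4 / (norm (cis \<theta> - complex_of_real r))\<^sup>2) + norm (g (of_real R * cis (\<theta> + t')) - boundary_lim g (cis (\<theta> + t'))) * (4 / (1 - r)\<^sup>2)"
      unfolding distrib_right by (intro add_mono mult_left_mono k1 k2) auto
    finally have fin: "norm (?ft (of_real R * cis \<theta>) * ?ker \<theta>) \<le> norm (boundary_lim g (cis (\<theta> + t)) - b) * (4 / (norm (cis \<theta> - complex_of_real r))\<^sup>2)
       + 4 / (1 - r)\<^sup>2 * norm (g (of_real R * cis (\<theta> + t')) - boundary_lim g (cis (\<theta> + t')))"
      unfolding ct by (subst norm_mult) (simp only: mult.commute)
    show "ennreal (norm (?ft (of_real R * cis \<theta>) * ?ker \<theta>)) * indicator {0..2*pi} \<theta>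
      \<le> ennreal (norm (boundary_lim g (cis (\<theta> + t)) - b) * (4 / (norm (cis \<theta> - complex_of_real r))\<^sup>2)) * indicator {0..2*pi} \<theta>
      + ennreal (4 / (1 - r)\<^sup>2) * (ennreal (norm (g (of_real R * cis (\<theta> + t')) - boundary_lim g (cis (\<theta> + t')))) * indicator {0..2*pi} \<theta>)"
    proof (cases "\<theta> \<in> {0..2*pi}")
      case True
      have ind: "indicator {0..2*pi} \<theta> = (1 :: ennreal)" using True by simp
      have eq: "ennreal (norm (boundary_lim g (cis (\<theta> + t)) - b) * (4 / (norm (cis \<theta> - complex_of_real r))\<^sup>2)
          + 4 / (1 - r)\<^sup>2 * norm (g (of_real R * cis (\<theta> + t')) - boundary_lim g (cis (\<theta> + t'))))
        = ennreal (norm (boundary_lim g (cis (\<theta> + t)) - b) * (4 / (norm (cis \<theta> - complex_of_real r))\<^sup>2))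
          + ennreal (4 / (1 - r)\<^sup>2) * ennreal (norm (g (of_real R * cis (\<theta> + t')) - boundary_lim g (cis (\<theta> + t'))))"
        by (subst ennreal_plus, simp, simp, subst ennreal_mult, simp, simp, rule refl)
      show ?thesis unfolding ind mult_1_right using ennreal_leI[OF fin] unfolding eq .
    qed simp
  qed
  also have "\<dots> = ?I + ennreal (4 / (1 - r)\<^sup>2) * nnint {0..2*pi} (\<lambda>\<theta>. norm (g (of_real R * cis (\<theta> + t')) - boundary_lim g (cis (\<theta> + t'))))"
  proof -
    have gR[measurable]: "(\<lambda>t. g (of_real R * cis t)) \<in> borel_measurable borel"
      using R by (intro borel_measurable_circle g_cont) auto
    have [measurable]: "(\<lambda>\<theta>. g (of_real R * cis (\<theta> + t'))) \<in> borel_measurable borel"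
      using measurable_compose[OF _ gR, of "\<lambda>\<theta>. \<theta> + t'" borel] by simp
    show ?thesis unfolding b_def by (subst nn_integral_add) (auto simp: nn_integral_cmult)
  qed
  also have "nnint {0..2*pi} (\<lambda>\<theta>. norm (g (of_real R * cis (\<theta> + t')) - boundary_lim g (cis (\<theta> + t'))))
     = nnint {0..2*pi} (\<lambda>\<theta>. norm (g (of_real R * cis \<theta>) - boundary_lim g (cis \<theta>)))"
  proof -
    have gR[measurable]: "(\<lambda>t. g (of_real R * cis t)) \<in> borel_measurable borel"
      using R by (intro borel_measurable_circle g_cont) auto
    show ?thesis
      by (rule nn_integral_circle_shift[of "\<lambda>z. ennreal (norm (g (of_real R * z) - boundary_lim g z))"]) (use t' in auto)
  qed
  also have "?I + ennreal (4 / (1 - r)\<^sup>2) * \<dots> \<le> ?I + ennreal (4 / (1 - r)\<^sup>2) * ennreal \<eta>"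
    using n(2) unfolding R_def by (intro add_left_mono mult_left_mono) auto
  also have "ennreal (4 / (1 - r)\<^sup>2) * ennreal \<eta> = ennreal \<epsilon>"
    using r \<eta> by (simp add: \<eta>_def flip: ennreal_mult)
  finally show "ennreal (2 * pi * norm (deriv g (of_real r * cis t))) \<le> ?I + ennreal \<epsilon>" .
qed

text \<open>A rotation by 2 * pi - \<theta> is the inverse of one by \<theta>. Hence the Lipschitz
  bound, available for angles up to pi, covers the whole circle.\<close>

lemma shift_difference_reflect:
  assumes "0 \<le> \<theta>" "\<theta> \<le> 2 * pi"
  shows "shift_difference q g (2 * pi - \<theta>) = shift_difference q g \<theta>"
proof -
  define u where "u z = ennreal (norm (boundary_lim g (z * cis (2 * pi - \<theta>)) - boundary_lim g z) powr q)" for z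
  have u1: "u (cis t) = ennreal (norm (boundary_lim g (cis (t + (2 * pi - \<theta>))) - boundary_lim g (cis t)) powr q)" for t
    by (simp add: u_def cis_mult)
  have u2: "u (cis (t + \<theta>)) = ennreal (norm (boundary_lim g (cis (t + \<theta>)) - boundary_lim g (cis t)) powr q)" for t
    by (simp add: u_def cis_mult cis_periodic norm_minus_commute)
  have "(\<integral>\<^sup>+t\<in>{0..2*pi}. u (cis (t + \<theta>)) \<partial>lborel) = (\<integral>\<^sup>+t\<in>{0..2*pi}. u (cis t) \<partial>lborel)"
    using assms by (intro nn_integral_circle_shift) (auto simp: u1)
  moreover have "(\<integral>\<^sup>+t\<in>{0..2*pi}. u (cis (t + \<theta>)) \<partial>lborel) = shift_difference q g \<theta>" by (simp only: u2)
  moreover have "(\<integral>\<^sup>+t\<in>{0..2*pi}. u (cis t) \<partial>lborel) = shift_difference q g (2 * pi - \<theta>)" by (simp only: u1)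
  ultimately show ?thesis by simp
qed

context
  assumes lip: "modulus_of_continuity q g \<in> O[at_right 0](\<lambda>t. t powr (1 / q))"
begin

lemma shift_difference_lipschitz:
  obtains C where "0 < C" "\<And>\<theta>. 0 < \<theta> \<Longrightarrow> \<theta> \<le> pi \<Longrightarrow> shift_difference q g \<theta> \<le> ennreal (2 * pi * (C * \<theta> powr (1 / q)) powr q)"
proof -
  let ?m = "\<lambda>h. (1 / (2 * pi) * (LINT \<theta>|lebesgue_on {0..2*pi}.
            norm (boundary_fun g (cis (\<theta> + h)) - boundary_fun g (cis \<theta>)) powr q)) powr (1 / q)"
  obtain c where c: "0 < c" "eventually (\<lambda>t. norm (modulus_of_continuity q g t) \<le> c * norm (t powr (1 / q))) (at_right 0)"
    using lip by (rule landau_o.bigE)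
  then obtain t0 where t0: "0 < t0" "\<And>t. 0 < t \<Longrightarrow> t < t0 \<Longrightarrow> norm (modulus_of_continuity q g t) \<le> c * norm (t powr (1 / q))"
    by (auto simp: eventually_at_right_field)
  define t1 where "t1 = min (t0 / 2) 1"
  have t1: "0 < t1" "t1 < t0" "t1 \<le> 1" using t0 by (auto simp: t1_def)
  have pi1: "1 \<le> pi" using pi_gt3 by simp
  have m_iff: "?m h \<le> X \<longleftrightarrow> shift_difference q g h \<le> ennreal (2 * pi * X powr q)" if "0 \<le> h" "h \<le> 2 * pi" "0 \<le> X" for h X
    using shift_difference_bounded[OF that(1,2)] that q
    by (intro shift_mean_le_iff g_cont AE) (auto intro: order_le_less_trans)
  \<comment> \<open>The Landau bound holds up to t1 only. Beyond t1 the trivial bound 2 * K is below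
    2 * K * (\<theta> / t1) powr (1/q), which the second entry of the maximum absorbs.\<close>
  define C where "C = max c (2 * K * t1 powr (- 1 / q))"
  have C: "0 < C" using c by (simp add: C_def)
  have "shift_difference q g \<theta> \<le> ennreal (2 * pi * (C * \<theta> powr (1 / q)) powr q)" if \<theta>: "0 < \<theta>" "\<theta> \<le> pi" for \<theta>
  proof (cases "\<theta> \<le> t1")
    case True
    \<comment> \<open>A supremum of reals bounds its members only if the set is bounded above, which
      the trivial bound 2 * K ensures.\<close>
    have "?m \<theta> \<le> modulus_of_continuity q g \<theta>"
      unfolding modulus_of_continuity_def
    proof (rule cSUP_upper)
      show "bdd_above (?m ` {0<..\<theta>})"
      proof (rule bdd_aboveI2)
        fix h assume "h \<in> {0<..\<theta>}"
        then show "?m h \<le> 2 * K" using \<theta> K by (subst m_iff) (auto intro: shift_difference_bounded)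
      qed
    qed (use \<theta> in auto)
    also have "\<dots> \<le> c * \<theta> powr (1 / q)" using t0(2)[of \<theta>] True t1 \<theta> by simp
    also have "\<dots> \<le> C * \<theta> powr (1 / q)" by (intro mult_right_mono) (auto simp: C_def)
    finally show ?thesis using \<theta> C by (subst (asm) m_iff) auto
  next
    case False
    have "shift_difference q g \<theta> \<le> ennreal (2 * pi * (2 * K) powr q)"
      using \<theta> by (intro shift_difference_bounded) auto
    also have "\<dots> \<le> ennreal (2 * pi * (C * \<theta> powr (1 / q)) powr q)"
    proof (intro ennreal_leI mult_left_mono powr_mono2)
      have "2 * K = 2 * K * t1 powr (- 1 / q) * t1 powr (1 / q)" using t1 by (simp flip: powr_add)
      also have "\<dots> \<le> C * \<theta> powr (1 / q)"
        using False t1 q K C by (intro mult_mono powr_mono2) (auto simp: C_def)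
      finally show "2 * K \<le> C * \<theta> powr (1 / q)" .
    qed (use q K in auto)
    finally show ?thesis .
  qed
  then show thesis using that C by blast
qed

lemma deriv_bound_of_lipschitz:
  obtains C where "0 < C" "\<And>r. 0 < r \<Longrightarrow> r < 1 \<Longrightarrow> circle_powr q r (deriv g) \<le> ennreal (2 * pi * (C * (1 - r) powr (1 / q - 1)) powr q)"
proof -
  obtain C where C: "0 < C" "\<And>\<theta>. 0 < \<theta> \<Longrightarrow> \<theta> \<le> pi \<Longrightarrow> shift_difference q g \<theta> \<le> ennreal (2 * pi * (C * \<theta> powr (1 / q)) powr q)"
    using shift_difference_lipschitz by blast
  obtain c where c: "0 < c" "c powr q = 2 * pi" using q real_circle_constant[of q] by auto
  \<comment> \<open>The distance from \<theta> to the nearer of 0 and 2 * pi, that is, the angle to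
    the point 1 of the circle.\<close>
  define \<mu> where "\<mu> \<theta> = min \<theta> (2 * pi - \<theta>)" for \<theta>
  have \<mu>: "0 < \<mu> \<theta>" "\<mu> \<theta> \<le> pi" if "\<theta> \<in> {0<..<2*pi}" for \<theta> using that by (auto simp: \<mu>_def min_def)
  have Cs: "shift_difference q g \<theta> \<le> ennreal ((c * C * \<mu> \<theta> powr (1 / q)) powr q)" if "\<theta> \<in> {0<..<2*pi}" for \<theta>
  proof -
    have "shift_difference q g \<theta> = shift_difference q g (\<mu> \<theta>)"
      using that shift_difference_reflect[of \<theta>] by (auto simp: \<mu>_def min_def)
    also have "\<dots> \<le> ennreal (2 * pi * (C * \<mu> \<theta> powr (1 / q)) powr q)" using \<mu>[OF that] by (intro C)
    also have "2 * pi * (C * \<mu> \<theta> powr (1 / q)) powr q = (c * C * \<mu> \<theta> powr (1 / q)) powr q"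
      unfolding mult.assoc[of c] using c C by (subst powr_mult[of c]) auto
    finally show ?thesis .
  qed
  have q1: "-1 < 1 / q" "1 / q < 1" using q by (auto intro: less_trans[of _ 0])
  obtain b where b: "0 < b" "nnint {0<..} (\<lambda>u. u powr (1 / q) / (1 + u\<^sup>2)) \<le> ennreal b"
    using q1 by (rule nn_integral_powr_cauchy_kernel)
  \<comment> \<open>128 = 4 * 32, with 4 from \<open>deriv_le_boundary_integral\<close> and 32 from
    \<open>norm_cis_minus_ge'\<close>; the denominator comes from Cauchy's formula.\<close>
  define E where "E = 128 / (2 * pi)"
  have E: "0 < E" by (simp add: E_def)
  have "circle_powr q r (deriv g) \<le> ennreal (2 * pi * (C * E * 2 * b * (1 - r) powr (1 / q - 1)) powr q)" if r: "0 < r" "r < 1" for r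
  proof -
    define \<delta> where "\<delta> = 1 - r"
    have \<delta>: "0 < \<delta>" using r by (simp add: \<delta>_def)
    define \<kappa> where "\<kappa> x = x powr (1 / q) / (\<delta>\<^sup>2 + x\<^sup>2)" for x
    have \<kappa>0: "0 < \<kappa> x" if "0 < x" for x using that \<delta> by (auto simp: \<kappa>_def intro!: divide_pos_pos add_pos_pos)
    have [measurable]: "\<kappa> \<in> borel_measurable borel" "\<mu> \<in> borel_measurable borel" unfolding \<kappa>_def \<mu>_def by measurable
    have \<kappa>i: "nnint {0<..} (\<lambda>x. \<kappa> x) \<le> ennreal (b * \<delta> powr (1 / q - 1))"
      unfolding \<kappa>_def using q1 b \<delta> by (intro nn_integral_scaled_kernel) auto
    have "circle_powr q r (deriv g) \<le> ennreal ((c * C * E * (2 * (b * \<delta> powr (1 / q - 1)))) powr q)"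
    proof (rule minkowski_powr[where M = lborel and N = lborel and S = "{0<..<2*pi}" and B = "\<lambda>\<theta>. c * C * E * \<kappa> (\<mu> \<theta>)" and
          F = "\<lambda>\<theta> t. norm (boundary_lim g (cis (\<theta> + t)) - boundary_lim g (cis t)) * (E / (\<delta>\<^sup>2 + (\<mu> \<theta>)\<^sup>2))"])
      have [measurable]: "(\<lambda>(\<theta>, t). boundary_lim g (cis (\<theta> + t))) \<in> borel_measurable (lborel \<Otimes>\<^sub>M lborel)"
        using measurable_compose[of "\<lambda>(s, t). s + t" "lborel \<Otimes>\<^sub>M lborel" borel, OF _ beta_meas]
        by (simp add: case_prod_beta')
      show "(\<lambda>(\<theta>, t). norm (boundary_lim g (cis (\<theta> + t)) - boundary_lim g (cis t)) * (E / (\<delta>\<^sup>2 + (\<mu> \<theta>)\<^sup>2))) \<in> borel_measurable (lborel \<Otimes>\<^sub>M lborel)"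
        by measurable
      \<comment> \<open>Since \<mu> \<theta> is one of \<theta> and 2 * pi - \<theta>, the kernel is
        at most the sum of two copies on half-lines; this is the factor 2 in the constant.\<close>
      have "nnint {0<..<2*pi} (\<lambda>\<theta>. c * C * E * \<kappa> (\<mu> \<theta>))
        \<le> (\<integral>\<^sup>+\<theta>. ennreal (c * C * E) * (ennreal (\<kappa> \<theta>) * indicator {0<..} \<theta> + ennreal (\<kappa> (2*pi + (-1) * \<theta>)) * indicator {0<..} (2*pi + (-1) * \<theta>)) \<partial>lborel)"
      proof (rule nn_integral_mono)
        fix \<theta> :: real
        show "ennreal (c * C * E * \<kappa> (\<mu> \<theta>)) * indicator {0<..<2*pi} \<theta>
          \<le> ennreal (c * C * E) * (ennreal (\<kappa> \<theta>) * indicator {0<..} \<theta> + ennreal (\<kappa> (2*pi + (-1) * \<theta>)) * indicator {0<..} (2*pi + (-1) * \<theta>))"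
        proof (cases "\<theta> \<in> {0<..<2*pi}")
          case True
          then have "\<kappa> (\<mu> \<theta>) \<le> \<kappa> \<theta> + \<kappa> (2*pi + (-1) * \<theta>)" "0 \<le> \<kappa> \<theta>" "0 \<le> \<kappa> (2*pi + (-1) * \<theta>)"
            using \<kappa>0[of \<theta>] \<kappa>0[of "2*pi - \<theta>"] by (auto simp: \<mu>_def min_def)
          then show ?thesis using True c C E
            by (simp flip: ennreal_plus ennreal_mult)
        qed simp
      qed
      also have "\<dots> = ennreal (c * C * E) * (\<integral>\<^sup>+\<theta>. (ennreal (\<kappa> \<theta>) * indicator {0<..} \<theta> + ennreal (\<kappa> (2*pi + (-1) * \<theta>)) * indicator {0<..} (2*pi + (-1) * \<theta>)) \<partial>lborel)"
        by (rule nn_integral_cmult) measurable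
      also have "(\<integral>\<^sup>+\<theta>. (ennreal (\<kappa> \<theta>) * indicator {0<..} \<theta> + ennreal (\<kappa> (2*pi + (-1) * \<theta>)) * indicator {0<..} (2*pi + (-1) * \<theta>)) \<partial>lborel)
        = nnint {0<..} (\<lambda>\<theta>. \<kappa> \<theta>) + (\<integral>\<^sup>+\<theta>. ennreal (\<kappa> (2*pi + (-1) * \<theta>)) * indicator {0<..} (2*pi + (-1) * \<theta>) \<partial>lborel)"
        by (rule nn_integral_add) measurable
      also have "(\<integral>\<^sup>+\<theta>. ennreal (\<kappa> (2*pi + (-1) * \<theta>)) * indicator {0<..} (2*pi + (-1) * \<theta>) \<partial>lborel) = nnint {0<..} (\<lambda>\<theta>. \<kappa> \<theta>)"
        by (subst (2) nn_integral_real_affine[where c = "-1" and t = "2*pi"]) auto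
      also have "ennreal (c * C * E) * (nnint {0<..} (\<lambda>\<theta>. \<kappa> \<theta>) + nnint {0<..} (\<lambda>\<theta>. \<kappa> \<theta>))
        \<le> ennreal (c * C * E) * (ennreal (b * \<delta> powr (1 / q - 1)) + ennreal (b * \<delta> powr (1 / q - 1)))"
        by (intro mult_left_mono add_mono \<kappa>i) auto
      also have "\<dots> = ennreal (c * C * E * (2 * (b * \<delta> powr (1 / q - 1))))"
        using c C E b by (simp flip: ennreal_plus ennreal_mult)
      finally show "nnint {0<..<2*pi} (\<lambda>\<theta>. c * C * E * \<kappa> (\<mu> \<theta>)) \<le> ennreal (c * C * E * (2 * (b * \<delta> powr (1 / q - 1))))" .
    next
      fix \<theta> :: real assume \<theta>: "\<theta> \<in> {0<..<2*pi}"
      define e where "e = E / (\<delta>\<^sup>2 + (\<mu> \<theta>)\<^sup>2)"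
      have e: "0 < e" using E \<delta> by (auto simp: e_def intro!: divide_pos_pos add_pos_nonneg)
      have "nnint {0..2*pi} (\<lambda>t. (norm (boundary_lim g (cis (\<theta> + t)) - boundary_lim g (cis t)) * e) powr q)
        = (\<integral>\<^sup>+t. ennreal (e powr q) * (ennreal (norm (boundary_lim g (cis (t + \<theta>)) - boundary_lim g (cis t)) powr q) * indicator {0..2*pi} t) \<partial>lborel)"
        using e by (intro nn_integral_cong) (auto simp: indicator_def powr_mult add.commute mult.commute simp flip: ennreal_mult)
      also have "\<dots> = ennreal (e powr q) * shift_difference q g \<theta>" by (rule nn_integral_cmult) measurable
      also have "\<dots> \<le> ennreal (e powr q) * ennreal ((c * C * \<mu> \<theta> powr (1 / q)) powr q)" by (intro mult_left_mono Cs \<theta>) auto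
      also have "\<dots> = ennreal ((e * (c * C * \<mu> \<theta> powr (1 / q))) powr q)"
        using e c C by (subst powr_mult[of e]) (auto simp flip: ennreal_mult)
      also have "e * (c * C * \<mu> \<theta> powr (1 / q)) = c * C * E * \<kappa> (\<mu> \<theta>)" by (simp add: e_def \<kappa>_def)
      finally show "nnint {0..2*pi} (\<lambda>t. (norm (boundary_lim g (cis (\<theta> + t)) - boundary_lim g (cis t)) * (E / (\<delta>\<^sup>2 + (\<mu> \<theta>)\<^sup>2))) powr q)
        \<le> ennreal ((c * C * E * \<kappa> (\<mu> \<theta>)) powr q)" unfolding e_def .
    next
      fix t :: real
      have "ennreal (norm (deriv g (of_real r * cis t))) = ennreal (1 / (2 * pi)) * ennreal (2 * pi * norm (deriv g (of_real r * cis t)))"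
        by (simp flip: ennreal_mult)
      also have "\<dots> \<le> ennreal (1 / (2 * pi)) * nnint {0..2*pi} (\<lambda>\<theta>. norm (boundary_lim g (cis (\<theta> + t)) - boundary_lim g (cis t)) * (4 / (norm (cis \<theta> - complex_of_real r))\<^sup>2))"
        using r by (intro mult_left_mono deriv_le_boundary_integral) auto
      also have "\<dots> = (\<integral>\<^sup>+\<theta>. ennreal (1 / (2 * pi)) * (ennreal (norm (boundary_lim g (cis (\<theta> + t)) - boundary_lim g (cis t)) * (4 / (norm (cis \<theta> - complex_of_real r))\<^sup>2)) * indicator {0..2*pi} \<theta>) \<partial>lborel)"
        by (rule nn_integral_cmult[symmetric]) measurable
      also have "\<dots> \<le> nnint {0<..<2*pi} (\<lambda>\<theta>. norm (boundary_lim g (cis (\<theta> + t)) - boundary_lim g (cis t)) * (E / (\<delta>\<^sup>2 + (\<mu> \<theta>)\<^sup>2)))"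
      proof (rule nn_integral_mono_AE, use AE_lborel_singleton[of 0] AE_lborel_singleton[of "2*pi"] in eventually_elim)
        case (elim \<theta>)
        show ?case
        proof (cases "\<theta> \<in> {0..2*pi}")
          case True
          with elim have \<theta>: "\<theta> \<in> {0<..<2*pi}" by auto
          have pos: "0 < \<delta>\<^sup>2 + (\<mu> \<theta>)\<^sup>2" using \<delta> by (auto intro!: add_pos_nonneg)
          have k32: "(\<delta>\<^sup>2 + (\<mu> \<theta>)\<^sup>2) / 32 \<le> (norm (cis \<theta> - complex_of_real r))\<^sup>2"
            unfolding \<delta>_def \<mu>_def using r \<theta> by (intro norm_cis_minus_ge') auto
          have pos32: "0 < (\<delta>\<^sup>2 + (\<mu> \<theta>)\<^sup>2) / 32" using pos by simp
          have "4 / (norm (cis \<theta> - complex_of_real r))\<^sup>2 \<le> 4 / ((\<delta>\<^sup>2 + (\<mu> \<theta>)\<^sup>2) / 32)"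
            using mult_pos_pos[OF less_le_trans[OF pos32 k32] pos32] by (intro divide_left_mono k32) auto
          also have "\<dots> = 2 * pi * (E / (\<delta>\<^sup>2 + (\<mu> \<theta>)\<^sup>2))" by (simp add: E_def)
          finally have k: "4 / (norm (cis \<theta> - complex_of_real r))\<^sup>2 \<le> 2 * pi * (E / (\<delta>\<^sup>2 + (\<mu> \<theta>)\<^sup>2))" .
          define X where "X = norm (boundary_lim g (cis (\<theta> + t)) - boundary_lim g (cis t))"
          have "1 / (2 * pi) * (X * (4 / (norm (cis \<theta> - complex_of_real r))\<^sup>2)) \<le> 1 / (2 * pi) * (X * (2 * pi * (E / (\<delta>\<^sup>2 + (\<mu> \<theta>)\<^sup>2))))"
            by (intro mult_left_mono k) (auto simp: X_def)
          also have "\<dots> = X * (E / (\<delta>\<^sup>2 + (\<mu> \<theta>)\<^sup>2))" by simp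
          finally have "ennreal (1 / (2 * pi) * (X * (4 / (norm (cis \<theta> - complex_of_real r))\<^sup>2))) \<le> ennreal (X * (E / (\<delta>\<^sup>2 + (\<mu> \<theta>)\<^sup>2)))"
            by (rule ennreal_leI)
          then show ?thesis using \<theta> unfolding X_def by (subst (asm) ennreal_mult) auto
        qed simp
      qed
      finally show "ennreal (norm (deriv g (of_real r * cis t))) \<le> nnint {0<..<2*pi} (\<lambda>\<theta>. norm (boundary_lim g (cis (\<theta> + t)) - boundary_lim g (cis t)) * (E / (\<delta>\<^sup>2 + (\<mu> \<theta>)\<^sup>2)))" .
    next
      fix \<theta> t :: real
      show "0 \<le> norm (boundary_lim g (cis (\<theta> + t)) - boundary_lim g (cis t)) * (E / (\<delta>\<^sup>2 + (\<mu> \<theta>)\<^sup>2))"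
        using E by (intro mult_nonneg_nonneg divide_nonneg_nonneg) auto
    qed (use q c C E b \<delta> \<kappa>0 \<mu> in \<open>auto intro!: sigma_finite_lborel mult_pos_pos\<close>)
    also have "(c * C * E * (2 * (b * \<delta> powr (1 / q - 1)))) powr q = (c * (C * E * 2 * b * \<delta> powr (1 / q - 1))) powr q"
      by (simp add: mult_ac)
    also have "\<dots> = 2 * pi * (C * E * 2 * b * \<delta> powr (1 / q - 1)) powr q"
      using c C E b by (subst powr_mult[of c]) auto
    finally show ?thesis unfolding \<delta>_def .
  qed
  then show thesis using C E b by (intro that[of "C * E * 2 * b"]) auto
qed

end

end

section \<open>Raising the exponent in the growth condition\<close>

text \<open>Jensen for the Poisson kernel, whose supremum is of order 1 / (1 - r), costs (1 - r)
  powr (-1/q) in passing from the mean to a pointwise bound. Together with the exponent 1/q - 1 this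
  makes 1 / (1 - r), independently of q.\<close>

lemma sup_bound_of_deriv_bound:
  assumes q: "1 < q" and G: "G holomorphic_on ball 0 1" and C: "0 < C"
    and GC: "\<And>r. 0 < r \<Longrightarrow> r < 1 \<Longrightarrow> circle_powr q r G \<le> ennreal (2 * pi * (C * (1 - r) powr (1 / q - 1)) powr q)"
    and r: "0 \<le> r" "r < 1"
  shows "norm (G (of_real r * cis t)) \<le> (4 * 2 powr (q - 1)) powr (1 / q) * C / (1 - r)"
proof -
  define R where "R = (1 + r) / 2"
  have R: "r < R" "R < 1" "0 < R" "1 - R = (1 - r) / 2" "R - r = (1 - r) / 2" using r by (auto simp: R_def field_simps)
  define P where "P \<theta> = (R\<^sup>2 - r\<^sup>2) / (norm (of_real R * cis \<theta> - complex_of_real r))\<^sup>2 / (2 * pi)" for \<theta>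
  have Gc: "continuous_on (ball 0 1) G" by (rule holomorphic_on_imp_continuous_on[OF G])
  have nz: "of_real R * cis \<theta> - complex_of_real r \<noteq> 0" for \<theta>
    by (intro circle_minus_nonzero) (use R r in auto)
  have sq: "R\<^sup>2 - r\<^sup>2 = (R - r) * (R + r)" by (simp add: power2_eq_square algebra_simps)
  have sq0: "0 < R\<^sup>2 - r\<^sup>2" using R r unfolding sq by (intro mult_pos_pos) auto
  have P0: "0 < P \<theta>" for \<theta> using nz[of \<theta>] sq0 by (auto simp: P_def intro!: divide_pos_pos)
  have P1: "P \<theta> \<le> 4 / (1 - r) / (2 * pi)" for \<theta>
  proof -
    have "R - r \<le> norm (of_real R * cis \<theta> - complex_of_real r)"
      using norm_triangle_ineq2[of "of_real R * cis \<theta>" "complex_of_real r"] R r by (simp add: norm_mult)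
    then have "(R - r)\<^sup>2 \<le> (norm (of_real R * cis \<theta> - complex_of_real r))\<^sup>2" using R by (intro power_mono) auto
    then have "(R\<^sup>2 - r\<^sup>2) / (norm (of_real R * cis \<theta> - complex_of_real r))\<^sup>2 \<le> (R\<^sup>2 - r\<^sup>2) / (R - r)\<^sup>2"
      using sq0 R nz[of \<theta>] by (intro divide_left_mono) auto
    also have "\<dots> = (R + r) / (R - r)" unfolding sq using R by (simp add: power2_eq_square)
    also have "\<dots> \<le> 2 / (R - r)" using R r by (intro divide_right_mono) auto
    also have "\<dots> = 4 / (1 - r)" unfolding R(5) by simp
    finally show ?thesis unfolding P_def by (intro divide_right_mono) auto
  qed
  have Pc: "continuous_on A P" for A unfolding P_def using nz by (intro continuous_intros) auto
  have [measurable]: "P \<in> borel_measurable borel" by (intro borel_measurable_continuous_onI Pc)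
  have Pi: "nnint {0..2*pi} (\<lambda>\<theta>. P \<theta>) = 1"
  proof -
    have "nnint {0..2*pi} (\<lambda>\<theta>. P \<theta>) = (\<integral>\<^sup>+\<theta>. ennreal ((R\<^sup>2 - r\<^sup>2) / (2 * pi)) *
       (ennreal (1 / (norm (of_real R * cis \<theta> - complex_of_real r))\<^sup>2) * indicator {0..2*pi} \<theta>) \<partial>lborel)"
      using sq0 by (intro nn_integral_cong) (auto simp: P_def indicator_def simp flip: ennreal_mult)
    also have "\<dots> = ennreal ((R\<^sup>2 - r\<^sup>2) / (2 * pi)) * nnint {0..2*pi} (\<lambda>\<theta>. 1 / (norm (of_real R * cis \<theta> - complex_of_real r))\<^sup>2)"
      by (rule nn_integral_cmult) measurable
    also have "\<dots> = ennreal ((R\<^sup>2 - r\<^sup>2) / (2 * pi)) * ennreal (2 * pi / (R\<^sup>2 - r\<^sup>2))"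
      using R r by (subst nn_integral_circle_kernel) auto
    also have "\<dots> = 1" using sq0 by (subst ennreal_mult[symmetric]) auto
    finally show ?thesis .
  qed
  obtain k where k: "0 \<le> t + 2 * pi * of_int k" "t + 2 * pi * of_int k \<le> 2 * pi" by (rule ex_cis_period)
  define t' where "t' = t + 2 * pi * of_int k"
  have t': "cis t' = cis t" "0 \<le> t'" "t' \<le> 2 * pi" using k by (auto simp: t'_def cis_add_period)
  have gR[measurable]: "(\<lambda>t. G (of_real R * cis t)) \<in> borel_measurable borel"
    using R by (intro borel_measurable_circle Gc) auto
  have [measurable]: "(\<lambda>\<theta>. G (of_real R * cis (\<theta> + t'))) \<in> borel_measurable borel"
    using measurable_compose[OF _ gR, of "\<lambda>\<theta>. \<theta> + t'" borel] by simp
  let ?F = "\<lambda>\<theta>. norm (G (of_real R * cis (\<theta> + t'))) * P \<theta>"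
  have "ennreal (norm (G (of_real r * cis t)) powr q) \<le> ennreal (1 powr (q - 1)) * nnint {0..2*pi} (\<lambda>\<theta>. ?F \<theta> powr q * P \<theta> powr (1 - q))"
  \<comment> \<open>The kernel P is a weight of mass 1 and F is |G| P, so F powr q * P powr (1 - q)
    is |G| powr q times P; P is then replaced by its supremum.\<close>
  proof (rule jensen_powr[OF q])
    let ?ft = "\<lambda>z. G (cis t * z)"
    let ?k = "\<lambda>\<theta>. complex_of_real ((R\<^sup>2 - r\<^sup>2) / (norm (of_real R * cis \<theta> - complex_of_real r))\<^sup>2)"
    have hol: "?ft holomorphic_on ball 0 1" by (rule holomorphic_on_rotate[OF G])
    have "((\<lambda>\<theta>. ?ft (of_real R * cis \<theta>) * ?k \<theta>) has_integral (2 * pi * ?ft r)) {0..2*pi}"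
      by (rule has_integral_Poisson[OF hol]) (use R r in auto)
    then have e: "2 * pi * ?ft r = integral {0..2*pi} (\<lambda>\<theta>. ?ft (of_real R * cis \<theta>) * ?k \<theta>)"
      by (rule integral_unique[symmetric])
    have "ennreal (2 * pi) * ennreal (norm (G (of_real r * cis t))) = ennreal (norm (2 * pi * ?ft r))"
      by (simp add: norm_mult mult.commute flip: ennreal_mult)
    also have "\<dots> \<le> nnint {0..2*pi} (\<lambda>\<theta>. norm (?ft (of_real R * cis \<theta>) * ?k \<theta>))"
      unfolding e using nz R by (intro norm_integral_le_nn_integral continuous_intros continuous_on_circle holomorphic_on_imp_continuous_on[OF hol]) auto
    also have "\<dots> = (\<integral>\<^sup>+\<theta>. ennreal (2 * pi) * (ennreal (?F \<theta>) * indicator {0..2*pi} \<theta>) \<partial>lborel)"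
    proof (intro nn_integral_cong)
      fix \<theta>
      have 1: "cis t * (of_real R * cis \<theta>) = of_real R * cis (\<theta> + t')" using t' by (simp add: cis_mult[symmetric] mult_ac)
      have 2: "norm (?k \<theta>) = 2 * pi * P \<theta>" using sq0 unfolding norm_of_real by (simp add: P_def)
      have 3: "norm (?ft (of_real R * cis \<theta>) * ?k \<theta>) = 2 * pi * ?F \<theta>"
        by (subst norm_mult, simp only: 1 2) simp
      show "ennreal (norm (?ft (of_real R * cis \<theta>) * ?k \<theta>)) * indicator {0..2*pi} \<theta> = ennreal (2 * pi) * (ennreal (?F \<theta>) * indicator {0..2*pi} \<theta>)"
        unfolding 3 by (subst ennreal_mult) (use P0[of \<theta>] in \<open>auto simp: mult_ac\<close>)
    qed
    also have "\<dots> = ennreal (2 * pi) * nnint {0..2*pi} (\<lambda>\<theta>. ?F \<theta>)" by (rule nn_integral_cmult) measurable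
    finally show "ennreal (norm (G (of_real r * cis t))) \<le> nnint {0..2*pi} (\<lambda>\<theta>. ?F \<theta>)"
      by (subst (asm) ennreal_mult_le_mult_iff) auto
  qed (use P0 Pi in \<open>auto simp: less_imp_le\<close>)
  also have "\<dots> \<le> (\<integral>\<^sup>+\<theta>. ennreal (4 / (1 - r) / (2 * pi)) * (ennreal (norm (G (of_real R * cis (\<theta> + t'))) powr q) * indicator {0..2*pi} \<theta>) \<partial>lborel)"
    unfolding powr_one_eq_one ennreal_1 mult_1_left
  proof (rule nn_integral_mono)
    fix \<theta>
    have "?F \<theta> powr q * P \<theta> powr (1 - q) = norm (G (of_real R * cis (\<theta> + t'))) powr q * (P \<theta> powr q * P \<theta> powr (1 - q))"
      using P0[of \<theta>] by (simp add: powr_mult)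
    also have "P \<theta> powr q * P \<theta> powr (1 - q) = P \<theta>" using P0[of \<theta>] by (simp flip: powr_add)
    also have "norm (G (of_real R * cis (\<theta> + t'))) powr q * P \<theta> \<le> norm (G (of_real R * cis (\<theta> + t'))) powr q * (4 / (1 - r) / (2 * pi))"
      by (intro mult_left_mono P1) auto
    finally have "ennreal (?F \<theta> powr q * P \<theta> powr (1 - q)) \<le> ennreal (4 / (1 - r) / (2 * pi)) * ennreal (norm (G (of_real R * cis (\<theta> + t'))) powr q)"
      using r by (subst ennreal_mult[symmetric]) (auto simp: mult.commute intro!: ennreal_leI)
    then show "ennreal (?F \<theta> powr q * P \<theta> powr (1 - q)) * indicator {0..2*pi} \<theta>
      \<le> ennreal (4 / (1 - r) / (2 * pi)) * (ennreal (norm (G (of_real R * cis (\<theta> + t'))) powr q) * indicator {0..2*pi} \<theta>)"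
      by (cases "\<theta> \<in> {0..2*pi}") auto
  qed
  also have "\<dots> = ennreal (4 / (1 - r) / (2 * pi)) * nnint {0..2*pi} (\<lambda>\<theta>. norm (G (of_real R * cis (\<theta> + t'))) powr q)"
    by (rule nn_integral_cmult) measurable
  also have "nnint {0..2*pi} (\<lambda>\<theta>. norm (G (of_real R * cis (\<theta> + t'))) powr q) = circle_powr q R G"
    using R t' by (intro circle_powr_shift Gc) auto
  also have "ennreal (4 / (1 - r) / (2 * pi)) * circle_powr q R G \<le> ennreal (4 / (1 - r) / (2 * pi)) * ennreal (2 * pi * (C * (1 - R) powr (1 / q - 1)) powr q)"
    using R by (intro mult_left_mono GC) auto
  also have "\<dots> = ennreal (4 / (1 - r) / (2 * pi) * (2 * pi * (C * (1 - R) powr (1 / q - 1)) powr q))"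
    using r by (intro ennreal_mult[symmetric]) auto
  finally have "norm (G (of_real r * cis t)) powr q \<le> 4 / (1 - r) / (2 * pi) * (2 * pi * (C * (1 - R) powr (1 / q - 1)) powr q)"
    using r by (subst (asm) ennreal_le_iff) auto
  also have "\<dots> = 4 / (1 - r) * (C powr q * ((1 - r) / 2) powr (1 - q))"
  proof -
    have "(1 / q - 1) * q = 1 - q" using q by (simp add: field_simps)
    then show ?thesis unfolding R(4) using C r q by (simp add: powr_mult powr_powr)
  qed
  also have "((1 - r) / 2) powr (1 - q) = 2 powr (q - 1) * (1 - r) powr (1 - q)"
  proof -
    have "2 powr (q - 1) = 1 / (2::real) powr (1 - q)" by (simp add: powr_minus_divide[symmetric])
    then show ?thesis using r by (simp add: powr_divide)
  qed
  also have "4 / (1 - r) * (C powr q * (2 powr (q - 1) * (1 - r) powr (1 - q))) = 4 * 2 powr (q - 1) * (C powr q * (1 - r) powr (- q))"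
  proof -
    have "(1 - r) powr (1 - q) = (1 - r) * (1 - r) powr (- q)" using r by (simp add: powr_diff powr_minus_divide)
    then show ?thesis using r by simp
  qed
  finally have fin: "norm (G (of_real r * cis t)) powr q \<le> 4 * 2 powr (q - 1) * (C powr q * (1 - r) powr (- q))" .
  have "norm (G (of_real r * cis t)) = (norm (G (of_real r * cis t)) powr q) powr (1 / q)" using q by (simp add: powr_powr)
  also have "\<dots> \<le> (4 * 2 powr (q - 1) * (C powr q * (1 - r) powr (- q))) powr (1 / q)"
    using q by (intro powr_mono2 fin) auto
  also have "\<dots> = (4 * 2 powr (q - 1)) powr (1 / q) * ((C powr q) powr (1 / q) * ((1 - r) powr (- q)) powr (1 / q))"
    using C r by (subst powr_mult, simp, simp, subst powr_mult, auto)
  also have "\<dots> = (4 * 2 powr (q - 1)) powr (1 / q) * C / (1 - r)"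
  proof -
    have "((1 - r) powr (- q)) powr (1 / q) = (1 - r) powr (- 1)" using q by (subst powr_powr) simp
    also have "\<dots> = 1 / (1 - r)" using r by (simp add: powr_minus_divide)
    finally show ?thesis using C q by (simp add: powr_powr)
  qed
  finally show ?thesis .
qed

text \<open>Write |G|^s = |G|^(s-q) |G|^q and bound the first factor pointwise. The powers (1 -
  r)^(q-s) and (1 - r)^(1-q) combine to (1 - r)^(1-s), the growth condition for s with no loss; D is
  read off from D^s = A^(s-q) C^q.\<close>

lemma deriv_bound_larger_exponent:
  assumes q: "1 < q" "q \<le> s" and G: "G holomorphic_on ball 0 1" and C: "0 < C"
    and GC: "\<And>r. 0 < r \<Longrightarrow> r < 1 \<Longrightarrow> circle_powr q r G \<le> ennreal (2 * pi * (C * (1 - r) powr (1 / q - 1)) powr q)"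
  obtains D where "0 < D" "\<And>r. 0 < r \<Longrightarrow> r < 1 \<Longrightarrow> circle_powr s r G \<le> ennreal (2 * pi * (D * (1 - r) powr (1 / s - 1)) powr s)"
proof -
  define A where "A = (4 * 2 powr (q - 1)) powr (1 / q) * C"
  have A: "0 < A" using C by (simp add: A_def)
  define D where "D = (A powr (s - q) * C powr q) powr (1 / s)"
  have D: "0 < D" using A C by (simp add: D_def)
  have Gc: "continuous_on (ball 0 1) G" by (rule holomorphic_on_imp_continuous_on[OF G])
  have "circle_powr s r G \<le> ennreal (2 * pi * (D * (1 - r) powr (1 / s - 1)) powr s)" if r: "0 < r" "r < 1" for r
  proof -
    have [measurable]: "(\<lambda>t. G (of_real r * cis t)) \<in> borel_measurable borel"
      using r by (intro borel_measurable_circle Gc) auto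
    have sup: "norm (G (of_real r * cis t)) \<le> A / (1 - r)" for t
      unfolding A_def using r by (intro sup_bound_of_deriv_bound q G C GC) auto
    have pt: "norm (G (of_real r * cis t)) powr s \<le> (A / (1 - r)) powr (s - q) * norm (G (of_real r * cis t)) powr q" for t
    proof -
      have "norm (G (of_real r * cis t)) powr s = norm (G (of_real r * cis t)) powr (s - q) * norm (G (of_real r * cis t)) powr q"
        by (subst powr_add[symmetric]) simp
      also have "\<dots> \<le> (A / (1 - r)) powr (s - q) * norm (G (of_real r * cis t)) powr q"
        using sup q by (intro mult_right_mono powr_mono2) auto
      finally show ?thesis .
    qed
    have "circle_powr s r G \<le> (\<integral>\<^sup>+t. ennreal ((A / (1 - r)) powr (s - q)) * (ennreal (norm (G (of_real r * cis t)) powr q) * indicator {0..2*pi} t) \<partial>lborel)"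
      using pt by (intro nn_integral_mono) (auto simp: indicator_def simp flip: ennreal_mult intro!: ennreal_leI)
    also have "\<dots> = ennreal ((A / (1 - r)) powr (s - q)) * circle_powr q r G" by (rule nn_integral_cmult) measurable
    also have "\<dots> \<le> ennreal ((A / (1 - r)) powr (s - q)) * ennreal (2 * pi * (C * (1 - r) powr (1 / q - 1)) powr q)"
      using r by (intro mult_left_mono GC) auto
    also have "\<dots> = ennreal ((A / (1 - r)) powr (s - q) * (2 * pi * (C * (1 - r) powr (1 / q - 1)) powr q))"
      by (rule ennreal_mult[symmetric]) auto
    also have "(A / (1 - r)) powr (s - q) * (2 * pi * (C * (1 - r) powr (1 / q - 1)) powr q) = 2 * pi * (D * (1 - r) powr (1 / s - 1)) powr s"
    proof -
      have eq: "(1 / q - 1) * q = 1 - q" "(1 / s - 1) * s = 1 - s" using q by (auto simp: field_simps)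
      have "(A / (1 - r)) powr (s - q) = A powr (s - q) * (1 - r) powr (q - s)"
        using A r powr_minus_divide[of "1 - r" "s - q"] by (simp add: powr_divide)
      moreover have "(1 - r) powr (q - s) * (1 - r) powr (1 - q) = (1 - r) powr (1 - s)" by (simp flip: powr_add)
      moreover have "(C * (1 - r) powr (1 / q - 1)) powr q = C powr q * (1 - r) powr (1 - q)" using C r by (simp add: powr_mult powr_powr eq)
      moreover have "(D * (1 - r) powr (1 / s - 1)) powr s = D powr s * (1 - r) powr (1 - s)" using D r by (simp add: powr_mult powr_powr eq)
      moreover have "D powr s = A powr (s - q) * C powr q" using q A C by (simp add: D_def powr_powr)
      ultimately show ?thesis by (simp add: mult_ac)
    qed
    finally show ?thesis .
  qed
  then show thesis using that D by blast
qed

section \<open>The inequalities of Fejer--Riesz and Hardy\<close>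

text \<open>Folds the circle along the real axis: the lower half is reflected onto (0, pi] and added
  to the upper half. The exceptional null set allows for the endpoints 0 and 2 * pi.\<close>

lemma nn_integral_mono_reflect:
  fixes h h1 h2 :: "real \<Rightarrow> real"
  assumes [measurable]: "h1 \<in> borel_measurable borel" "h2 \<in> borel_measurable borel"
    and "\<And>\<theta>. 0 \<le> h1 \<theta>" "\<And>\<theta>. 0 \<le> h2 \<theta>"
    and le: "AE \<theta> in lborel. h \<theta> \<le> h1 \<theta> + h2 (2 * pi - \<theta>)"
  shows "(\<integral>\<^sup>+\<theta>. ennreal (h \<theta>) \<partial>lborel) \<le> (\<integral>\<^sup>+\<theta>. ennreal (h1 \<theta> + h2 \<theta>) \<partial>lborel)"
proof -
  have "(\<integral>\<^sup>+\<theta>. ennreal (h \<theta>) \<partial>lborel) \<le> (\<integral>\<^sup>+\<theta>. ennreal (h1 \<theta>) + ennreal (h2 (2 * pi + (- 1) * \<theta>)) \<partial>lborel)"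
  proof (rule nn_integral_mono_AE, use le in eventually_elim)
    case (elim \<theta>)
    then have "ennreal (h \<theta>) \<le> ennreal (h1 \<theta> + h2 (2 * pi - \<theta>))" by (rule ennreal_leI)
    then show ?case using assms by simp
  qed
  also have "\<dots> = (\<integral>\<^sup>+\<theta>. ennreal (h1 \<theta>) \<partial>lborel) + (\<integral>\<^sup>+\<theta>. ennreal (h2 (2 * pi + (- 1) * \<theta>)) \<partial>lborel)"
    by (rule nn_integral_add) measurable
  also have "(\<integral>\<^sup>+\<theta>. ennreal (h2 (2 * pi + (- 1) * \<theta>)) \<partial>lborel) = (\<integral>\<^sup>+\<theta>. ennreal (h2 \<theta>) \<partial>lborel)"
    by (subst (2) nn_integral_real_affine[where c = "-1" and t = "2*pi"]) auto
  also have "(\<integral>\<^sup>+\<theta>. ennreal (h1 \<theta>) \<partial>lborel) + (\<integral>\<^sup>+\<theta>. ennreal (h2 \<theta>) \<partial>lborel) = (\<integral>\<^sup>+\<theta>. ennreal (h1 \<theta>) + ennreal (h2 \<theta>) \<partial>lborel)"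
    by (rule nn_integral_add[symmetric]) measurable
  finally show ?thesis using assms by simp
qed

lemma cis_reflect: "cis (- (2 * pi - \<theta>)) = cis \<theta>"
  using cis_periodic[of "\<theta> - 2 * pi"] by simp

lemma Poisson_radial_le:
  assumes f: "f holomorphic_on ball 0 1" and R: "0 < R" "R < 1" and x: "0 < x" "x < 1"
  defines "\<phi> \<equiv> \<lambda>\<theta>. if \<theta> \<in> {0<..pi} then norm (f (of_real R * cis \<theta>)) + norm (f (of_real R * cis (- \<theta>))) else 0"
  shows "ennreal (norm (f (of_real (R * (1 - x))))) \<le> nnint {0<..} (\<lambda>u. \<phi> (x * u) * (32 / pi / (1 + u\<^sup>2)))"
proof -
  have fc: "continuous_on (ball 0 1) f" by (rule holomorphic_on_imp_continuous_on[OF f])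
  define t where "t = 1 - x"
  have t: "0 < t" "t < 1" using x by (auto simp: t_def)
  let ?k = "\<lambda>\<theta>. complex_of_real ((R\<^sup>2 - (R * t)\<^sup>2) / (norm (of_real R * cis \<theta> - complex_of_real (R * t)))\<^sup>2)"
  have nz: "of_real R * cis \<theta> - complex_of_real (R * t) \<noteq> 0" for \<theta>
    by (intro circle_minus_nonzero) (use R t in \<open>auto simp: abs_mult\<close>)
  have hi: "((\<lambda>\<theta>. f (of_real R * cis \<theta>) * ?k \<theta>) has_integral (2 * pi * f (of_real (R * t)))) {0..2*pi}"
    by (rule has_integral_Poisson[OF f]) (use R t in auto)
  have e0: "norm (integral {0..2*pi} (\<lambda>\<theta>. f (of_real R * cis \<theta>) * ?k \<theta>)) = 2 * pi * norm (f (of_real (R * t)))"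
    unfolding integral_unique[OF hi] by (simp add: norm_mult)
  have fm[measurable]: "(\<lambda>t. f (of_real R * cis t)) \<in> borel_measurable borel"
    using R by (intro borel_measurable_circle fc) auto
  have [measurable]: "(\<lambda>t. f (of_real R * cis (- t))) \<in> borel_measurable borel"
    using measurable_compose[OF _ fm, of "\<lambda>\<theta>. - \<theta>" borel] by simp
  have \<phi>m[measurable]: "\<phi> \<in> borel_measurable borel" unfolding \<phi>_def by measurable
  define K where "K \<theta> = 64 * x / (x\<^sup>2 + \<theta>\<^sup>2)" for \<theta>
  have K0: "0 \<le> K \<theta>" for \<theta> using x by (simp add: K_def)
  have [measurable]: "K \<in> borel_measurable borel" unfolding K_def by measurable
  define h where "h \<theta> = norm (f (of_real R * cis \<theta>) * ?k \<theta>) * indicator {0..2*pi} \<theta>" for \<theta>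
  define h1 where "h1 \<theta> = (if \<theta> \<in> {0<..pi} then norm (f (of_real R * cis \<theta>)) * K \<theta> else 0)" for \<theta>
  define h2 where "h2 \<theta> = (if \<theta> \<in> {0<..pi} then norm (f (of_real R * cis (- \<theta>))) * K \<theta> else 0)" for \<theta>
  have hK: "norm (?k \<theta>) \<le> K (min \<theta> (2 * pi - \<theta>))" if "\<theta> \<in> {0..2*pi}" for \<theta>
  proof -
    have n: "norm (of_real R * cis \<theta> - complex_of_real (R * t)) = R * norm (cis \<theta> - complex_of_real t)"
    proof -
      have "of_real R * cis \<theta> - complex_of_real (R * t) = of_real R * (cis \<theta> - complex_of_real t)" by (simp add: algebra_simps)
      then show ?thesis using R by (simp add: norm_mult)
    qed
    have n0: "0 < norm (cis \<theta> - complex_of_real t)" using circle_minus_nonzero[of t 1 \<theta>] t by simp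
    have t2: "t\<^sup>2 \<le> 1" using t by (simp add: power_le_one)
    have "norm (?k \<theta>) = (R\<^sup>2 - (R * t)\<^sup>2) / (R * norm (cis \<theta> - complex_of_real t))\<^sup>2"
      unfolding norm_of_real n using t2 R by (simp add: power_mult_distrib abs_of_nonneg mult_left_le)
    also have "\<dots> = (1 - t\<^sup>2) / (norm (cis \<theta> - complex_of_real t))\<^sup>2"
    proof -
      have "R\<^sup>2 - (R * t)\<^sup>2 = R\<^sup>2 * (1 - t\<^sup>2)" by (simp add: power_mult_distrib algebra_simps)
      then show ?thesis using R by (simp add: power_mult_distrib)
    qed
    also have "\<dots> \<le> (1 - t\<^sup>2) / (((1 - t)\<^sup>2 + (min \<theta> (2 * pi - \<theta>))\<^sup>2) / 32)"
    proof (rule divide_left_mono)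
      have "0 < (1 - t)\<^sup>2 + (min \<theta> (2 * pi - \<theta>))\<^sup>2" using t by (intro add_pos_nonneg) auto
      then show "0 < (norm (cis \<theta> - complex_of_real t))\<^sup>2 * (((1 - t)\<^sup>2 + (min \<theta> (2 * pi - \<theta>))\<^sup>2) / 32)"
        using n0 by (intro mult_pos_pos) auto
    qed (use t t2 that norm_cis_minus_ge'[of t \<theta>] in auto)
    also have "\<dots> \<le> (2 * x) / (((1 - t)\<^sup>2 + (min \<theta> (2 * pi - \<theta>))\<^sup>2) / 32)"
    proof (rule divide_right_mono)
      have "1 - t\<^sup>2 = (1 + t) * x" by (simp add: t_def power2_eq_square algebra_simps)
      also have "\<dots> \<le> 2 * x" using t x by (intro mult_right_mono) auto
      finally show "1 - t\<^sup>2 \<le> 2 * x" .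
    qed simp
    also have "\<dots> = K (min \<theta> (2 * pi - \<theta>))" by (simp add: K_def t_def)
    finally show ?thesis .
  qed
  have hle: "h \<theta> \<le> h1 \<theta> + h2 (2 * pi - \<theta>)" if nz: "\<theta> \<noteq> 0" "\<theta> \<noteq> 2 * pi" for \<theta>
  proof (cases "\<theta> \<in> {0..2*pi}")
    case True
    have le: "h \<theta> \<le> norm (f (of_real R * cis \<theta>)) * K (min \<theta> (2 * pi - \<theta>))"
      unfolding h_def norm_mult using True by (simp only: indicator_simps mult_1_right) (intro mult_left_mono hK, auto)
    consider "\<theta> \<in> {0<..pi}" | "2 * pi - \<theta> \<in> {0<..pi}" "\<not> \<theta> \<in> {0<..pi}" using True nz by (cases "\<theta> \<le> pi") auto
    then show ?thesis
    proof cases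
      case 1
      then have "h1 \<theta> = norm (f (of_real R * cis \<theta>)) * K (min \<theta> (2 * pi - \<theta>))" by (simp add: h1_def min_absorb1)
      moreover have "0 \<le> h2 (2 * pi - \<theta>)" using K0 by (simp add: h2_def)
      ultimately show ?thesis using le by simp
    next
      case 2
      then have "h2 (2 * pi - \<theta>) = norm (f (of_real R * cis \<theta>)) * K (min \<theta> (2 * pi - \<theta>))"
        unfolding h2_def cis_reflect by (simp add: min_absorb2)
      moreover have "h1 \<theta> = 0" using 2 unfolding h1_def by simp
      ultimately show ?thesis using le by simp
    qed
  next
    case False
    then have "h \<theta> = 0" by (simp add: h_def)
    then show ?thesis using K0 by (simp add: h1_def h2_def)
  qed
  have "ennreal (2 * pi) * ennreal (norm (f (of_real (R * t)))) = ennreal (2 * pi * norm (f (of_real (R * t))))"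
    by (simp add: ennreal_mult)
  also have "\<dots> \<le> nnint {0..2*pi} (\<lambda>\<theta>. norm (f (of_real R * cis \<theta>) * ?k \<theta>))"
    unfolding e0[symmetric] using nz R
    by (intro norm_integral_le_nn_integral continuous_intros continuous_on_circle fc) auto
  also have "\<dots> = (\<integral>\<^sup>+\<theta>. ennreal (h \<theta>) \<partial>lborel)"
    by (intro nn_integral_cong) (simp add: h_def indicator_def)
  also have "\<dots> \<le> (\<integral>\<^sup>+\<theta>. ennreal (h1 \<theta> + h2 \<theta>) \<partial>lborel)"
  proof (rule nn_integral_mono_reflect)
    show "AE \<theta> in lborel. h \<theta> \<le> h1 \<theta> + h2 (2 * pi - \<theta>)"
      using AE_lborel_singleton[of 0] AE_lborel_singleton[of "2*pi"] by eventually_elim (rule hle)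
    show "h1 \<in> borel_measurable borel" "h2 \<in> borel_measurable borel" unfolding h1_def h2_def by measurable
  qed (use K0 in \<open>auto simp: h1_def h2_def\<close>)
  also have "\<dots> = (\<integral>\<^sup>+\<theta>. ennreal (\<phi> \<theta> * K \<theta>) \<partial>lborel)"
    by (intro nn_integral_cong) (simp add: h1_def h2_def \<phi>_def distrib_right)
  also have "\<dots> = ennreal x * (\<integral>\<^sup>+u. ennreal (\<phi> (0 + x * u) * K (0 + x * u)) \<partial>lborel)"
    using x by (subst nn_integral_real_affine[where c = x and t = 0]) auto
  also have "\<dots> = (\<integral>\<^sup>+u. ennreal x * ennreal (\<phi> (0 + x * u) * K (0 + x * u)) \<partial>lborel)"
    by (rule nn_integral_cmult[symmetric]) measurable
  also have "\<dots> = (\<integral>\<^sup>+u. ennreal (2 * pi) * (ennreal (\<phi> (x * u) * (32 / pi / (1 + u\<^sup>2))) * indicator {0<..} u) \<partial>lborel)"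
  proof (intro nn_integral_cong)
    fix u
    show "ennreal x * ennreal (\<phi> (0 + x * u) * K (0 + x * u)) = ennreal (2 * pi) * (ennreal (\<phi> (x * u) * (32 / pi / (1 + u\<^sup>2))) * indicator {0<..} u)"
    proof (cases "0 < u")
      case True
      have "x * K (x * u) = 2 * pi * (32 / pi / (1 + u\<^sup>2))"
      proof -
        have "x\<^sup>2 + (x * u)\<^sup>2 = x * x * (1 + u\<^sup>2)" by (simp add: algebra_simps power2_eq_square)
        then show ?thesis using x by (simp add: K_def)
      qed
      then have "x * (\<phi> (x * u) * K (x * u)) = 2 * pi * (\<phi> (x * u) * (32 / pi / (1 + u\<^sup>2)))" by algebra
      moreover have "0 \<le> \<phi> (x * u)" by (simp add: \<phi>_def)
      ultimately show ?thesis using True x K0[of "x * u"] by (simp flip: ennreal_mult)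
    next
      case False
      then have "\<phi> (x * u) = 0" using x by (auto simp: \<phi>_def zero_less_mult_iff)
      then show ?thesis by simp
    qed
  qed
  also have "\<dots> = ennreal (2 * pi) * nnint {0<..} (\<lambda>u. \<phi> (x * u) * (32 / pi / (1 + u\<^sup>2)))"
    by (rule nn_integral_cmult) measurable
  finally show ?thesis unfolding t_def by (subst (asm) ennreal_mult_le_mult_iff) auto
qed

lemma fejer_riesz:
  assumes p: "1 < p"
  obtains C where "0 < C"
    "\<And>f A. f holomorphic_on ball 0 1 \<Longrightarrow> 0 < A \<Longrightarrow>
       (\<And>r. 0 < r \<Longrightarrow> r < 1 \<Longrightarrow> circle_powr p r f \<le> ennreal (2 * pi * A powr p)) \<Longrightarrow>
       nnint {0<..<1} (\<lambda>t. norm (f (of_real t)) powr p) \<le> ennreal ((C * A) powr p)"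
proof -
  obtain c where c: "0 < c" "c powr p = 2 * pi" using p real_circle_constant[of p] by auto
  have p1: "-1 < - 1 / p" "- 1 / p < 1" using p by (auto simp: field_simps intro: less_trans[of _ 0])
  obtain b0 where b0: "0 < b0" "nnint {0<..} (\<lambda>u. u powr (- 1 / p) / (1 + u\<^sup>2)) \<le> ennreal b0"
    using p1 by (rule nn_integral_powr_cauchy_kernel)
  define b where "b = 32 / pi * b0"
  have b: "0 < b" using b0 by (simp add: b_def)
  have \<kappa>b: "nnint {0<..} (\<lambda>u. 32 / pi / (1 + u\<^sup>2) * u powr (- 1 / p)) \<le> ennreal b"
  proof -
    have "nnint {0<..} (\<lambda>u. 32 / pi / (1 + u\<^sup>2) * u powr (- 1 / p))
      = (\<integral>\<^sup>+u. ennreal (32 / pi) * (ennreal (u powr (- 1 / p) / (1 + u\<^sup>2)) * indicator {0<..} u) \<partial>lborel)"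
      by (intro nn_integral_cong) (auto simp: indicator_def simp flip: ennreal_mult)
    also have "\<dots> = ennreal (32 / pi) * nnint {0<..} (\<lambda>u. u powr (- 1 / p) / (1 + u\<^sup>2))"
      by (rule nn_integral_cmult) measurable
    also have "\<dots> \<le> ennreal (32 / pi) * ennreal b0" by (intro mult_left_mono b0) auto
    also have "\<dots> = ennreal b" using b0 by (simp add: b_def flip: ennreal_mult)
    finally show ?thesis .
  qed
  show thesis
  \<comment> \<open>The folded function is the sum of the two halves of the circle, each of norm at
    most c * A; b is the norm of the homogeneous kernel.\<close>
  proof (rule that[of "b * (c + c)"])
    show "0 < b * (c + c)" using b c by simp
  next
    fix f A assume f: "f holomorphic_on ball 0 1" and A: "0 < A"
      and fA: "\<And>r. 0 < r \<Longrightarrow> r < 1 \<Longrightarrow> circle_powr p r f \<le> ennreal (2 * pi * A powr p)"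
    have fc: "continuous_on (ball 0 1) f" by (rule holomorphic_on_imp_continuous_on[OF f])
    have [measurable]: "disc_cut f \<in> borel_measurable borel" by (rule borel_measurable_disc_cut[OF fc])
    have bound: "nnint {0<..<1} (\<lambda>x. norm (disc_cut f (of_real (R * (1 - x)))) powr p) \<le> ennreal ((b * (c * A + c * A)) powr p)"
      if R: "0 < R" "R < 1" for R
    proof -
      have fm[measurable]: "(\<lambda>t. f (of_real R * cis t)) \<in> borel_measurable borel"
        using R by (intro borel_measurable_circle fc) auto
      have [measurable]: "(\<lambda>t. f (of_real R * cis (- t))) \<in> borel_measurable borel"
        using measurable_compose[OF _ fm, of "\<lambda>\<theta>. - \<theta>" borel] by simp
      define u where "u \<theta> = (if \<theta> \<in> {0<..pi} then norm (f (of_real R * cis \<theta>)) else 0)" for \<theta>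
      define v where "v \<theta> = (if \<theta> \<in> {0<..pi} then norm (f (of_real R * cis (- \<theta>))) else 0)" for \<theta>
      define \<phi> where "\<phi> = (\<lambda>\<theta>. if \<theta> \<in> {0<..pi} then norm (f (of_real R * cis \<theta>)) + norm (f (of_real R * cis (- \<theta>))) else 0)"
      have [measurable]: "u \<in> borel_measurable borel" "v \<in> borel_measurable borel" "\<phi> \<in> borel_measurable borel"
        unfolding u_def v_def \<phi>_def by measurable
      have eA: "2 * pi * A powr p = (c * A) powr p" using c A by (simp add: powr_mult)
      have "circle_powr p R f \<le> ennreal ((c * A) powr p)" using fA[OF R] unfolding eA .
      then have cR: "(\<integral>\<^sup>+t. ennreal (norm (f (of_real R * cis t)) powr p * indicator {0..2*pi} t) \<partial>lborel) \<le> ennreal ((c * A) powr p)"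
        by (simp add: nn_integral_set_ennreal)
      have I1: "nnint {0<..} (\<lambda>\<theta>. u \<theta> powr p) \<le> ennreal ((c * A) powr p)"
        by (rule order_trans[OF nn_integral_mono cR]) (auto simp: u_def indicator_def intro!: ennreal_leI)
      have I2: "nnint {0<..} (\<lambda>\<theta>. v \<theta> powr p) \<le> ennreal ((c * A) powr p)"
      proof -
        have "nnint {0<..} (\<lambda>\<theta>. v \<theta> powr p) = (\<integral>\<^sup>+\<theta>. ennreal (v (2 * pi + (- 1) * \<theta>) powr p) * indicator {0<..} (2 * pi + (- 1) * \<theta>) \<partial>lborel)"
          by (subst nn_integral_real_affine[where c = "-1" and t = "2*pi"]) auto
        also have "\<dots> \<le> (\<integral>\<^sup>+t. ennreal (norm (f (of_real R * cis t)) powr p * indicator {0..2*pi} t) \<partial>lborel)"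
        proof (rule nn_integral_mono)
          fix \<theta> :: real
          show "ennreal (v (2 * pi + (- 1) * \<theta>) powr p) * indicator {0<..} (2 * pi + (- 1) * \<theta>) \<le> ennreal (norm (f (of_real R * cis \<theta>)) powr p * indicator {0..2*pi} \<theta>)"
            using cis_reflect[of \<theta>] by (cases "2 * pi - \<theta> \<in> {0<..pi}") (auto simp: v_def indicator_def)
        qed
        finally show ?thesis using cR by (rule order_trans)
      qed
      have I\<phi>: "nnint {0<..} (\<lambda>\<theta>. \<phi> \<theta> powr p) \<le> ennreal ((c * A + c * A) powr p)"
        by (rule triangle_powr[OF sigma_finite_lborel p _ _ _ _ _ _ _ I1 I2])
           (use c A in \<open>auto simp: u_def v_def \<phi>_def\<close>)
      show ?thesis
      proof (rule homogeneous_kernel_bound[OF p _ b, where \<phi> = \<phi> and \<kappa> = "\<lambda>u. 32 / pi / (1 + u\<^sup>2)" and U = "{0<..}"])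
        show "0 < 32 / pi / (1 + u\<^sup>2)" for u :: real by (intro divide_pos_pos add_pos_nonneg) auto
      next
        fix x :: real assume x: "x \<in> {0<..<1}"
        have "\<bar>R * (1 - x)\<bar> < 1" using x R mult_strict_mono'[of R 1 "1 - x" 1] by (auto simp: abs_mult)
        then have "norm (disc_cut f (of_real (R * (1 - x)))) = norm (f (of_real (R * (1 - x))))"
          by (subst disc_cut_eq) (simp_all only: norm_of_real)
        then show "ennreal (norm (disc_cut f (of_real (R * (1 - x))))) \<le> nnint {0<..} (\<lambda>u. \<phi> (x * u) * (32 / pi / (1 + u\<^sup>2)))"
          unfolding \<phi>_def using Poisson_radial_le[OF f R, of x] x by simp
      qed (use I\<phi> \<kappa>b c A in \<open>auto simp: \<phi>_def\<close>)
    qed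
    have F1: "nnint {0<..<1} (\<lambda>x. norm (f (of_real (1 - x))) powr p) \<le> ennreal ((b * (c * A + c * A)) powr p)"
    proof (rule nn_integral_fatou_le[where u = "\<lambda>n x. norm (disc_cut f (of_real (approach_radius n * (1 - x)))) powr p"])
      show "AE x in lborel. x \<in> {0<..<1} \<longrightarrow> (\<lambda>n. norm (disc_cut f (of_real (approach_radius n * (1 - x)))) powr p) \<longlonglongrightarrow> norm (f (of_real (1 - x))) powr p"
      proof (intro AE_I2 impI)
        fix x :: real assume x: "x \<in> {0<..<1}"
        have "(\<lambda>n. complex_of_real (approach_radius n * (1 - x))) \<longlonglongrightarrow> of_real (1 * (1 - x))"
          by (intro tendsto_intros approach_radius_tendsto)
        moreover have "isCont f (of_real (1 - x))"
          using fc x by (subst (asm) continuous_on_eq_continuous_at) (auto simp del: of_real_diff)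
        ultimately have "(\<lambda>n. f (of_real (approach_radius n * (1 - x)))) \<longlonglongrightarrow> f (of_real (1 - x))"
          by (intro isCont_tendsto_compose[of _ f]) simp_all
        moreover have "disc_cut f (of_real (approach_radius n * (1 - x))) = f (of_real (approach_radius n * (1 - x)))" for n
        proof (rule disc_cut_eq)
          have "\<bar>approach_radius n * (1 - x)\<bar> < 1"
            using x approach_radius[of n] mult_strict_mono'[of "approach_radius n" 1 "1 - x" 1] by (auto simp: abs_mult)
          then show "norm (complex_of_real (approach_radius n * (1 - x))) < 1" by (simp only: norm_of_real)
        qed
        ultimately have "(\<lambda>n. disc_cut f (of_real (approach_radius n * (1 - x)))) \<longlonglongrightarrow> f (of_real (1 - x))" by simp
        then show "(\<lambda>n. norm (disc_cut f (of_real (approach_radius n * (1 - x)))) powr p) \<longlonglongrightarrow> norm (f (of_real (1 - x))) powr p"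
          using p by (intro tendsto_powr' tendsto_intros) auto
      qed
    qed (use bound approach_radius in auto)
    have F2: "nnint {0<..<1} (\<lambda>t. norm (f (of_real t)) powr p) = nnint {0<..<1} (\<lambda>x. norm (f (of_real (1 - x))) powr p)"
    proof -
      have "nnint {0<..<1} (\<lambda>t. norm (f (of_real t)) powr p) = nnint {0<..<1} (\<lambda>t. norm (disc_cut f (of_real t)) powr p)"
        by (intro nn_integral_cong) (auto simp: indicator_def)
      also have "\<dots> = (\<integral>\<^sup>+x. ennreal (norm (disc_cut f (of_real (1 + (- 1) * x))) powr p) * indicator {0<..<1} (1 + (- 1) * x) \<partial>lborel)"
        by (subst nn_integral_real_affine[where c = "-1" and t = 1]) auto
      also have "\<dots> = nnint {0<..<1} (\<lambda>x. norm (f (of_real (1 - x))) powr p)"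
      proof (intro nn_integral_cong)
        fix x :: real
        have "x \<in> {0<..<1} \<Longrightarrow> norm (complex_of_real (1 - x)) < 1" unfolding norm_of_real by auto
        then show "ennreal (norm (disc_cut f (of_real (1 + (- 1) * x))) powr p) * indicator {0<..<1} (1 + (- 1) * x) = ennreal (norm (f (of_real (1 - x))) powr p) * indicator {0<..<1} x"
          by (cases "x \<in> {0<..<1}") (auto simp: indicator_def)
      qed
      finally show ?thesis .
    qed
    have F3: "b * (c * A + c * A) = b * (c + c) * A" by (simp add: algebra_simps)
    show "nnint {0<..<1} (\<lambda>t. norm (f (of_real t)) powr p) \<le> ennreal ((b * (c + c) * A) powr p)"
      unfolding F2 F3[symmetric] by (rule F1)
  qed
qed

text \<open>With y = 1 - t the operator integrates \<psi>(y) y powr (s - 1) over y > x, and y = x u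
  turns it into x powr s times an average of dilations with kernel u powr (s - 1) on u \<ge> 1.
  Against u powr (-1/p) this kernel has integral 1 / (1/p - s), finite because s < 1/p.\<close>

lemma hardy_operator_bound:
  fixes \<phi> W :: "real \<Rightarrow> real"
  assumes p: "1 < p" and s: "0 < s" "s < 1 / p" and A: "0 < A"
    and [measurable]: "\<phi> \<in> borel_measurable borel" "W \<in> borel_measurable borel"
    and \<phi>: "\<And>t. t \<in> {0<..<1} \<Longrightarrow> 0 \<le> \<phi> t"
    and \<phi>A: "nnint {0<..<1} (\<lambda>t. \<phi> t powr p) \<le> ennreal (A powr p)"
    and W: "\<And>t. t \<in> {0<..<1} \<Longrightarrow> 0 \<le> W t"
    and W\<phi>: "\<And>t. t \<in> {0<..<1} \<Longrightarrow> ennreal (W t) \<le> nnint {0<..<t} (\<lambda>x. \<phi> x * (1 - x) powr (s - 1))"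
  shows "nnint {0<..<1} (\<lambda>t. ((1 - t) powr (- s) * W t) powr p) \<le> ennreal ((1 / (1 / p - s) * A) powr p)"
proof -
  \<comment> \<open>The function seen from the endpoint 1 and extended by zero, so that u may run
    over all of {1..}.\<close>
  define \<psi> where "\<psi> y = (if y \<in> {0<..<1} then \<phi> (1 - y) else 0)" for y
  have [measurable]: "\<psi> \<in> borel_measurable borel" unfolding \<psi>_def by measurable
  have "nnint {0<..<1} (\<lambda>x. (x powr (- s) * W (1 - x)) powr p) \<le> ennreal ((1 / (1 / p - s) * A) powr p)"
  proof (rule homogeneous_kernel_bound[OF p A, where \<phi> = \<psi> and \<kappa> = "\<lambda>u. u powr (s - 1)" and U = "{1..}"])
    show "0 \<le> \<psi> y" for y using \<phi>[of "1 - y"] by (auto simp: \<psi>_def)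
    have "nnint {0<..} (\<lambda>y. \<psi> y powr p) = (\<integral>\<^sup>+y. ennreal (\<psi> (1 + (- 1) * y) powr p) * indicator {0<..} (1 + (- 1) * y) \<partial>lborel)"
      by (subst nn_integral_real_affine[where c = "-1" and t = 1]) auto
    also have "\<dots> \<le> nnint {0<..<1} (\<lambda>t. \<phi> t powr p)"
      by (intro nn_integral_mono) (auto simp: \<psi>_def indicator_def)
    finally show "nnint {0<..} (\<lambda>y. \<psi> y powr p) \<le> ennreal (A powr p)" using \<phi>A by simp
    have "nnint {1..} (\<lambda>u. u powr (s - 1) * u powr (- 1 / p)) = nnint {1..} (\<lambda>u. u powr (s - 1 - 1 / p))"
      by (intro nn_integral_cong) (simp flip: powr_add)
    also have "\<dots> = ennreal (1 / (1 / p - s))"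
    proof -
      have "s - 1 - 1 / p < - 1" using s by simp
      moreover have "- (1 powr (s - 1 - 1 / p + 1)) / (s - 1 - 1 / p + 1) = 1 / (1 / p - s)"
      proof -
        have "s - 1 - 1 / p + 1 = - (1 / p - s)" by simp
        then show ?thesis by (simp only: powr_one_eq_one minus_divide_divide)
      qed
      ultimately show ?thesis by (subst nn_integral_powr_atLeast) simp_all
    qed
    finally show "nnint {1..} (\<lambda>u. u powr (s - 1) * u powr (- 1 / p)) \<le> ennreal (1 / (1 / p - s))" by simp
  next
    fix x :: real assume x: "x \<in> {0<..<1}"
    have "ennreal (x powr (- s) * W (1 - x)) = ennreal (x powr (- s)) * ennreal (W (1 - x))"
      using W[of "1 - x"] x by (intro ennreal_mult) auto
    also have "\<dots> \<le> ennreal (x powr (- s)) * nnint {0<..<1-x} (\<lambda>y. \<phi> y * (1 - y) powr (s - 1))"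
      using x by (intro mult_left_mono W\<phi>) auto
    also have "nnint {0<..<1-x} (\<lambda>y. \<phi> y * (1 - y) powr (s - 1))
      = ennreal x * (\<integral>\<^sup>+u. ennreal (\<phi> (1 + (- x) * u) * (1 - (1 + (- x) * u)) powr (s - 1)) * indicator {0<..<1-x} (1 + (- x) * u) \<partial>lborel)"
      using x by (subst nn_integral_real_affine[where c = "- x" and t = 1]) auto
    also have "ennreal (x powr (- s)) * (ennreal x * (\<integral>\<^sup>+u. ennreal (\<phi> (1 + (- x) * u) * (1 - (1 + (- x) * u)) powr (s - 1)) * indicator {0<..<1-x} (1 + (- x) * u) \<partial>lborel))
      = (\<integral>\<^sup>+u. ennreal (x powr (- s) * x) * (ennreal (\<phi> (1 + (- x) * u) * (1 - (1 + (- x) * u)) powr (s - 1)) * indicator {0<..<1-x} (1 + (- x) * u)) \<partial>lborel)"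
      using x by (subst nn_integral_cmult) (auto simp: ennreal_mult mult.assoc)
    also have "\<dots> \<le> nnint {1..} (\<lambda>u. \<psi> (x * u) * u powr (s - 1))"
    proof (rule nn_integral_mono)
      fix u :: real
      show "ennreal (x powr (- s) * x) * (ennreal (\<phi> (1 + (- x) * u) * (1 - (1 + (- x) * u)) powr (s - 1)) * indicator {0<..<1-x} (1 + (- x) * u))
        \<le> ennreal (\<psi> (x * u) * u powr (s - 1)) * indicator {1..} u"
      proof (cases "1 + (- x) * u \<in> {0<..<1-x}")
        case True
        then have xu: "x * u \<in> {0<..<1}" "1 \<le> u"
        proof -
          have "x < x * u" "x * u < 1" using True by auto
          then show "x * u \<in> {0<..<1}" "1 \<le> u" using x by (auto simp: mult_less_cancel_left1 intro: less_trans)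
        qed
        \<comment> \<open>The weight, the Jacobian and the kernel contribute the exponents -s, 1 and
          s - 1 of x, which cancel: the inequality is scale invariant.\<close>
        have "x powr (- s) * x * (x * u) powr (s - 1) = (x powr (- s) * x powr 1 * x powr (s - 1)) * u powr (s - 1)"
          using x xu by (simp add: powr_mult)
        also have "x powr (- s) * x powr 1 * x powr (s - 1) = 1"
          using x by (simp only: powr_add[symmetric]) simp
        finally have e: "x powr (- s) * x * (x * u) powr (s - 1) = u powr (s - 1)" by simp
        have "ennreal (x powr (- s) * x) * ennreal (\<phi> (1 - x * u) * (x * u) powr (s - 1)) = ennreal (\<phi> (1 - x * u) * (x powr (- s) * x * (x * u) powr (s - 1)))"
          using x xu \<phi>[of "1 - x * u"] by (subst ennreal_mult[symmetric]) (auto simp: mult_ac)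
        then show ?thesis using True xu unfolding e by (simp add: \<psi>_def)
      qed simp
    qed
    finally show "ennreal (x powr (- s) * W (1 - x)) \<le> nnint {1..} (\<lambda>u. \<psi> (x * u) * u powr (s - 1))" .
    show "0 \<le> x powr (- s) * W (1 - x)" using W[of "1 - x"] x by simp
  qed (use s in auto)
  moreover have "nnint {0<..<1} (\<lambda>t. ((1 - t) powr (- s) * W t) powr p)
    = nnint {0<..<1} (\<lambda>x. (x powr (- s) * W (1 - x)) powr p)"
    by (subst nn_integral_real_affine[where c = "-1" and t = 1]) (auto simp: indicator_def intro!: nn_integral_cong)
  ultimately show ?thesis by simp
qed

section \<open>Primitives and their powers\<close>

text \<open>The upper limit sits inside the integrand of a Lebesgue integral over the whole line.
  Joint measurability in the limit and a further parameter then follows from measurability of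
  parametrised integrals.\<close>

definition primitive :: "(real \<Rightarrow> real) \<Rightarrow> real \<Rightarrow> real" where
  "primitive \<psi> t = (LINT x|lborel. (if 0 < x \<and> x < t then \<psi> x else 0))"

lemma primitive_eq_integral:
  assumes "continuous_on {0..t} \<psi>"
  shows "primitive \<psi> t = integral {0..t} \<psi>"
proof -
  have "set_integrable lborel {0<..<t} \<psi>"
    by (rule set_integrable_subset[OF borel_integrable_atLeastAtMost'[OF assms]]) auto
  then have "(LINT x:{0<..<t}|lborel. \<psi> x) = integral {0<..<t} \<psi>" by (rule set_borel_integral_eq_integral)
  moreover have "primitive \<psi> t = (LINT x:{0<..<t}|lborel. \<psi> x)"
    unfolding primitive_def set_lebesgue_integral_def by (intro Bochner_Integration.integral_cong) (auto simp: indicator_def)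
  ultimately show ?thesis by (simp add: integral_open_interval_real)
qed

lemma nn_integral_Ioo_eq_Icc:
  "(\<integral>\<^sup>+x\<in>{a<..<b}. f x \<partial>lborel) = (\<integral>\<^sup>+x\<in>{a..b::real}. f x \<partial>lborel)"
  by (rule nn_integral_cong_AE)
     (use AE_lborel_singleton[of a] AE_lborel_singleton[of b] in eventually_elim, auto simp: indicator_def)

lemma ennreal_primitive:
  assumes "continuous_on {0..t} \<psi>" "\<And>x. x \<in> {0..t} \<Longrightarrow> 0 \<le> \<psi> x"
  shows "ennreal (primitive \<psi> t) = nnint {0<..<t} (\<lambda>x. \<psi> x)"
  unfolding primitive_eq_integral[OF assms(1)] nn_integral_Ioo_eq_Icc
  by (rule nn_integral_Icc_continuous[OF assms, symmetric])

lemma primitive_pos: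
  assumes c: "continuous_on {0..t} \<psi>" and pos: "\<And>x. x \<in> {0..t} \<Longrightarrow> 0 < \<psi> x" and t: "0 < t"
  shows "0 < primitive \<psi> t"
proof -
  obtain x0 where x0: "x0 \<in> {0..t}" "\<And>x. x \<in> {0..t} \<Longrightarrow> \<psi> x0 \<le> \<psi> x"
    using continuous_attains_inf[OF _ _ c] t by auto
  have "0 < \<psi> x0 * t" using pos[OF x0(1)] t by simp
  also have "\<dots> = integral {0..t} (\<lambda>x. \<psi> x0)" using t by simp
  also have "\<dots> \<le> integral {0..t} \<psi>" using x0 by (intro integral_le integrable_continuous_interval c) auto
  finally show ?thesis by (simp add: primitive_eq_integral[OF c])
qed

text \<open>The fundamental theorem of calculus for V powr p. Strict positivity of the integrand
  keeps V away from 0 on the interior, where powr is differentiated; at the left end, where V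
  vanishes, only continuity is used.\<close>

lemma primitive_powr:
  assumes p: "1 < p" and c: "continuous_on {0..T} \<psi>" and pos: "\<And>x. x \<in> {0..T} \<Longrightarrow> 0 < \<psi> x" and T: "0 < T"
  shows "ennreal (primitive \<psi> T powr p) = nnint {0<..<T} (\<lambda>t. p * (\<psi> t * primitive \<psi> t powr (p - 1)))"
proof -
  let ?V = "\<lambda>t. integral {0..t} \<psi>"
  have sub: "primitive \<psi> t = ?V t" if "t \<in> {0..T}" for t
    by (rule primitive_eq_integral) (use that in \<open>auto intro: continuous_on_subset[OF c]\<close>)
  have Vpos: "0 < ?V t" if "t \<in> {0<..T}" for t
    using primitive_pos[of t \<psi>] sub[of t] that pos continuous_on_subset[OF c, of "{0..t}"] by auto
  have Vc: "continuous_on {0..T} ?V" by (intro indefinite_integral_continuous_1 integrable_continuous_interval c)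
  have "((\<lambda>t. p * ?V t powr (p - 1) * \<psi> t) has_integral ?V T powr p - ?V 0 powr p) {0..T}"
  proof (rule fundamental_theorem_of_calculus_interior)
    show "continuous_on {0..T} (\<lambda>t. ?V t powr p)"
    proof (intro continuous_on_powr' Vc continuous_intros ballI)
      fix t assume t: "t \<in> {0..T}"
      show "0 \<le> ?V t \<and> (?V t = 0 \<longrightarrow> 0 < p)"
        using Vpos[of t] t p by (cases "t = 0") auto
    qed
    fix t assume t: "t \<in> {0<..<T}"
    have "(?V has_real_derivative \<psi> t) (at t within {0..T})"
      using t by (intro integral_has_real_derivative c) auto
    then have "(?V has_real_derivative \<psi> t) (at t)"
      using t by (simp add: at_within_Icc_at)
    then have "((\<lambda>t. ?V t powr p) has_real_derivative p * ?V t powr (p - 1) * \<psi> t) (at t)"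
      using Vpos[of t] t by (intro DERIV_fun_powr[THEN DERIV_cong]) (auto simp: mult_ac)
    then show "((\<lambda>t. ?V t powr p) has_vector_derivative p * ?V t powr (p - 1) * \<psi> t) (at t)"
      by (simp add: has_real_derivative_iff_has_vector_derivative)
  qed (use T in auto)
  then have "((\<lambda>t. p * ?V t powr (p - 1) * \<psi> t) has_integral primitive \<psi> T powr p) {0..T}"
    using sub[of T] T by simp
  then have hi: "((\<lambda>t. p * (\<psi> t * primitive \<psi> t powr (p - 1))) has_integral primitive \<psi> T powr p) {0..T}"
    by (rule has_integral_eq[rotated]) (simp add: sub mult_ac)
  show ?thesis unfolding nn_integral_Ioo_eq_Icc
    using p pos by (intro nn_integral_has_integral_lebesgue'[symmetric] hi) (auto simp: less_imp_le)
qed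

section \<open>Boundedness of the operator\<close>

text \<open>The factor (1 - t) powr (1/e - 1) is at least 1 and so absorbs the added constant, at
  the price of C + 1. Radii t * r \<le> t only improve the bound, which makes it uniform in
  r.\<close>

lemma nn_integral_deriv_plus_one_le:
  assumes e: "1 < e" and G: "G holomorphic_on ball 0 1" and C: "0 < C" and c: "0 < c" "c powr e = 2 * pi"
    and GC: "\<And>r. 0 < r \<Longrightarrow> r < 1 \<Longrightarrow> circle_powr e r G \<le> ennreal (2 * pi * (C * (1 - r) powr (1 / e - 1)) powr e)"
    and r: "0 < r" "r < 1" and t: "0 < t" "t < 1"
  shows "nnint {0..2*pi} (\<lambda>\<theta>. (norm (disc_cut G (of_real t * (of_real r * cis \<theta>))) + 1) powr e)
     \<le> ennreal ((c * (C + 1) * (1 - t) powr (1 / e - 1)) powr e)"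
proof -
  have Gc: "continuous_on (ball 0 1) G" by (rule holomorphic_on_imp_continuous_on[OF G])
  have [measurable]: "disc_cut G \<in> borel_measurable borel" by (rule borel_measurable_disc_cut[OF Gc])
  define d where "d = (1 - t) powr (1 / e - 1)"
  have d0: "0 < d" using t by (simp add: d_def)
  have e0: "1 / e - 1 \<le> 0" using e by simp
  have tr: "0 < t * r" "t * r < 1" "t * r \<le> t" using t r mult_strict_mono'[of t 1 r 1] by auto
  have "nnint {0..2*pi} (\<lambda>\<theta>. norm (disc_cut G (of_real t * (of_real r * cis \<theta>))) powr e) = circle_powr e (t * r) G"
  proof -
    have "disc_cut G (of_real t * (of_real r * cis \<theta>)) = G (of_real (t * r) * cis \<theta>)" for \<theta>
      by (subst disc_cut_eq) (simp_all add: norm_mult abs_of_pos tr t r mult.assoc)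
    then show ?thesis by simp
  qed
  also have "\<dots> \<le> ennreal (2 * pi * (C * (1 - t * r) powr (1 / e - 1)) powr e)" by (rule GC[OF tr(1,2)])
  also have "\<dots> \<le> ennreal (2 * pi * (C * d) powr e)"
    unfolding d_def using tr t C e e0 by (intro ennreal_leI mult_left_mono powr_mono2 powr_mono2') auto
  also have "2 * pi * (C * d) powr e = (c * (C * d)) powr e" using c C d0 by (subst powr_mult[of c]) auto
  finally have 1: "nnint {0..2*pi} (\<lambda>\<theta>. norm (disc_cut G (of_real t * (of_real r * cis \<theta>))) powr e) \<le> ennreal ((c * (C * d)) powr e)" .
  have "1 \<le> d"
  proof -
    have "(1 - t) powr 0 \<le> (1 - t) powr (1 / e - 1)" using t e0 by (intro powr_mono') auto
    then show ?thesis using t by (simp add: d_def)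
  qed
  then have "2 * pi \<le> (c * d) powr e" using c d0 ge_one_powr_ge_zero[of d e] e by (subst powr_mult) auto
  then have 2: "nnint {0..2*pi} (\<lambda>\<theta>. 1 powr e) \<le> ennreal ((c * d) powr e)"
    by (simp add: ennreal_leI)
  have "nnint {0..2*pi} (\<lambda>\<theta>. (norm (disc_cut G (of_real t * (of_real r * cis \<theta>))) + 1) powr e)
      \<le> ennreal ((c * (C * d) + c * d) powr e)"
    by (rule triangle_powr[OF sigma_finite_lborel e _ _ _ _ _ _ _ 1 2]) (use c C d0 in auto)
  also have "c * (C * d) + c * d = c * (C + 1) * d" by (simp add: algebra_simps)
  finally show ?thesis unfolding d_def .
qed

lemma borel_measurable_primitive:
  assumes [measurable]: "(\<lambda>(x, y). \<psi> y x) \<in> borel_measurable (lborel \<Otimes>\<^sub>M lborel)"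
  shows "(\<lambda>(t, y). primitive (\<psi> y) t) \<in> borel_measurable (lborel \<Otimes>\<^sub>M lborel)"
proof -
  have [measurable]: "(\<lambda>w. \<psi> (snd (fst w)) (snd w)) \<in> borel_measurable ((lborel \<Otimes>\<^sub>M lborel) \<Otimes>\<^sub>M lborel)"
    using measurable_compose[of "\<lambda>w. (snd w, snd (fst w))" "(lborel \<Otimes>\<^sub>M lborel) \<Otimes>\<^sub>M lborel" "lborel \<Otimes>\<^sub>M lborel", OF _ assms]
    by simp
  have "(\<lambda>w. if 0 < snd w \<and> snd w < fst (fst w) then \<psi> (snd (fst w)) (snd w) else 0) \<in> borel_measurable ((lborel \<Otimes>\<^sub>M lborel) \<Otimes>\<^sub>M lborel)"
    by measurable
  then have "(\<lambda>ty. LINT x|lborel. (if 0 < x \<and> x < fst ty then \<psi> (snd ty) x else 0)) \<in> borel_measurable (lborel \<Otimes>\<^sub>M lborel)"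
    by (intro lborel.borel_measurable_lebesgue_integral) (simp add: case_prod_beta')
  then show ?thesis by (simp add: primitive_def case_prod_beta')
qed

lemma borel_measurable_primitive_single:
  assumes [measurable]: "\<psi> \<in> borel_measurable borel"
  shows "primitive \<psi> \<in> borel_measurable borel"
proof -
  have "(\<lambda>w. if 0 < snd w \<and> snd w < fst w then \<psi> (snd w) else 0) \<in> borel_measurable (lborel \<Otimes>\<^sub>M lborel)"
    by measurable
  then have "(\<lambda>t. LINT x|lborel. (if 0 < x \<and> x < t then \<psi> x else 0)) \<in> borel_measurable lborel"
    by (intro lborel.borel_measurable_lebesgue_integral) (simp add: case_prod_beta')
  then show ?thesis by (simp add: primitive_def[abs_def])
qed

lemma continuous_on_disc_cut_ray:
  fixes z :: complex
  assumes "continuous_on (ball 0 1) G" "t < 1" "norm z \<le> 1"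
  shows "continuous_on {0..t} (\<lambda>x. disc_cut G (of_real x * z))"
proof -
  have n: "norm (of_real x * z) < 1" if "x \<in> {0..t}" for x
  proof -
    have "norm (of_real x * z) \<le> t * 1" using that assms unfolding norm_mult by (intro mult_mono) auto
    then show ?thesis using assms by simp
  qed
  have "continuous_on {0..t} (\<lambda>x. G (of_real x * z))"
    by (intro continuous_on_compose2[OF assms(1)] continuous_intros) (use n in auto)
  then show ?thesis by (rule continuous_on_eq) (use n in auto)
qed

text \<open>Marcinkiewicz interpolation between the exponents \<open>q < p\<close> and \<open>q\<^sub>1 > p\<close>, in the form
  \<open>U(T)\<^sup>p = p \<integral> U\<^sup>p\<^sup>-\<^sup>1 dU\<close>: Hoelder with exponent \<open>q\<close> is applied to the increment \<open>dU\<close>,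
  Minkowski with exponent \<open>q\<^sub>1\<close> to \<open>U\<close>. Adding \<open>A\<close> and \<open>1\<close> to the factors keeps \<open>U\<close> positive.\<close>

lemma hilbert_main_estimate:
  fixes p q C D :: real and G :: "complex \<Rightarrow> complex"
  assumes q: "1 < q" "q < p" and G: "G holomorphic_on ball 0 1" and C: "0 < C" and D: "0 < D"
  defines "q1 \<equiv> (p - 1) * q / (q - 1)"
  assumes GC: "\<And>r. 0 < r \<Longrightarrow> r < 1 \<Longrightarrow> circle_powr q r G \<le> ennreal (2 * pi * (C * (1 - r) powr (1 / q - 1)) powr q)"
    and GD: "\<And>r. 0 < r \<Longrightarrow> r < 1 \<Longrightarrow> circle_powr q1 r G \<le> ennreal (2 * pi * (D * (1 - r) powr (1 / q1 - 1)) powr q1)"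
  obtains M where "0 < M"
    "\<And>f A r T. f holomorphic_on ball 0 1 \<Longrightarrow> 0 < A \<Longrightarrow> 0 < r \<Longrightarrow> r < 1 \<Longrightarrow> 0 < T \<Longrightarrow> T < 1 \<Longrightarrow>
       (\<And>r. 0 < r \<Longrightarrow> r < 1 \<Longrightarrow> circle_powr p r f \<le> ennreal (2 * pi * A powr p)) \<Longrightarrow>
       nnint {0..2*pi} (\<lambda>\<theta>. primitive (\<lambda>t. (norm (disc_cut f (of_real t)) + A) *
           (norm (disc_cut G (of_real t * (of_real r * cis \<theta>))) + 1)) T powr p) \<le> ennreal ((M * A) powr p)"
proof -
  have p: "1 < p" using q by simp
  \<comment> \<open>The exponent dual to q. The choice of q1 makes the b-th power of U powr (p - 1)
    equal to U powr q1.\<close>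
  define b where "b = q / (q - 1)"
  have b: "1 < b" "1 / q + 1 / b = 1" "(p - 1) * b = q1" using q by (auto simp: b_def q1_def field_simps)
  have q1p: "p < q1"
  proof -
    have "p * (q - 1) < (p - 1) * q" using q by (simp add: algebra_simps)
    then show ?thesis unfolding q1_def using q by (simp add: pos_less_divide_eq)
  qed
  have q11: "1 < q1" using q1p p by simp
  \<comment> \<open>The condition s < 1/p of Hardy's inequality is exactly q1 > p, and this in turn
    amounts to q < p.\<close>
  define s where "s = 1 / q1"
  have s: "0 < s" "s < 1 / p" using q1p p q11 by (auto simp: s_def frac_less2)
  \<comment> \<open>The growth exponent of the increment is thus a (p - 1)-st power and merges with
    W powr (p - 1) into the quantity that Hardy's inequality bounds.\<close>
  have sp: "1 / q - 1 = - s * (p - 1)"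
  proof -
    have "s * (p - 1) = (p - 1) / ((p - 1) * b)" unfolding s_def b(3) by simp
    also have "\<dots> = 1 / b" using p by simp
    finally have "s * (p - 1) = 1 / b" .
    then show ?thesis using b(2) by simp
  qed
  obtain c where c: "0 < c" "c powr q = 2 * pi" using q real_circle_constant[of q] by auto
  obtain c1 where c1: "0 < c1" "c1 powr q1 = 2 * pi" using q11 real_circle_constant[of q1] by auto
  obtain E0 where E0: "0 < E0" "\<And>f A. f holomorphic_on ball 0 1 \<Longrightarrow> 0 < A \<Longrightarrow>
       (\<And>r. 0 < r \<Longrightarrow> r < 1 \<Longrightarrow> circle_powr p r f \<le> ennreal (2 * pi * A powr p)) \<Longrightarrow>
       nnint {0<..<1} (\<lambda>t. norm (f (of_real t)) powr p) \<le> ennreal ((E0 * A) powr p)"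
    using fejer_riesz[OF p] by blast
  \<comment> \<open>The summand 1 pays for the constant A added to |f|, whose norm on the unit
    interval is A.\<close>
  define E where "E = E0 + 1"
  have E: "0 < E" using E0 by (simp add: E_def)
  define h where "h = 1 / (1 / p - s)"
  have h: "0 < h" using s by (simp add: h_def)
  define L where "L = p * (c * (C + 1)) * (c1 * (D + 1)) powr (p - 1)"
  have L: "0 < L" using p c c1 C D by (auto simp: L_def intro!: mult_pos_pos)
  define M where "M = (L * (E * (h * E) powr (p - 1))) powr (1 / p)"
  have M: "0 < M" "M powr p = L * (E * (h * E) powr (p - 1))" using L E h p by (auto simp: M_def powr_powr)
  show thesis
  proof (rule that[OF M(1)])
    fix f :: "complex \<Rightarrow> complex" and A r T :: real
    assume f: "f holomorphic_on ball 0 1" and A: "0 < A" and r: "0 < r" "r < 1" and T: "0 < T" "T < 1"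
      and fA: "\<And>r. 0 < r \<Longrightarrow> r < 1 \<Longrightarrow> circle_powr p r f \<le> ennreal (2 * pi * A powr p)"
    have fc: "continuous_on (ball 0 1) f" and Gc: "continuous_on (ball 0 1) G"
      using holomorphic_on_imp_continuous_on f G by auto
    have [measurable]: "disc_cut f \<in> borel_measurable borel" "disc_cut G \<in> borel_measurable borel"
      using borel_measurable_disc_cut fc Gc by auto
    define \<phi> where "\<phi> t = norm (disc_cut f (of_real t)) + A" for t :: real
    define k where "k \<theta> t = norm (disc_cut G (of_real t * (of_real r * cis \<theta>))) + 1" for \<theta> t :: real
    define \<psi> where "\<psi> \<theta> t = \<phi> t * k \<theta> t" for \<theta> t
    define U where "U t \<theta> = primitive (\<psi> \<theta>) t" for t \<theta>
    \<comment> \<open>Up to a constant, the Minkowski bound for the L^q1 norm of U t over the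
      circle: the slice at x contributes \<phi> x times (1 - x) powr (1/q1 - 1).\<close>
    define W where "W = primitive (\<lambda>x. \<phi> x * (1 - x) powr (s - 1))"
    have \<phi>0: "0 < \<phi> t" for t using A by (simp add: \<phi>_def add_nonneg_pos)
    have k0: "0 < k \<theta> t" for \<theta> t by (simp add: k_def add_nonneg_pos)
    have \<psi>0: "0 < \<psi> \<theta> t" for \<theta> t by (simp add: \<psi>_def \<phi>0 k0)
    have [measurable]: "\<phi> \<in> borel_measurable borel" unfolding \<phi>_def by measurable
    have km[measurable]: "(\<lambda>(x, y). k y x) \<in> borel_measurable (lborel \<Otimes>\<^sub>M lborel)" unfolding k_def by measurable
    have km'[measurable]: "(\<lambda>\<theta>. k \<theta> t) \<in> borel_measurable borel" for t unfolding k_def by measurable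
    have \<psi>m[measurable]: "(\<lambda>(x, y). \<psi> y x) \<in> borel_measurable (lborel \<Otimes>\<^sub>M lborel)" unfolding \<psi>_def k_def by measurable
    have Um[measurable]: "(\<lambda>(t, \<theta>). U t \<theta>) \<in> borel_measurable (lborel \<Otimes>\<^sub>M lborel)"
      unfolding U_def by (rule borel_measurable_primitive[OF \<psi>m])
    have Um'[measurable]: "(\<lambda>\<theta>. U t \<theta>) \<in> borel_measurable borel" for t
      using measurable_compose[of "\<lambda>\<theta>. (t, \<theta>)" borel "lborel \<Otimes>\<^sub>M lborel", OF _ Um] by simp
    have [measurable]: "W \<in> borel_measurable borel" unfolding W_def by (rule borel_measurable_primitive_single) measurable
    have \<phi>c: "continuous_on {0..t} \<phi>" if "t < 1" for t
      unfolding \<phi>_def using continuous_on_disc_cut_ray[OF fc that, of 1] by (intro continuous_intros) auto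
    have \<psi>c: "continuous_on {0..t} (\<psi> \<theta>)" if "t < 1" for t \<theta>
      unfolding \<psi>_def k_def using r that
      by (intro continuous_intros \<phi>c continuous_on_disc_cut_ray[OF Gc]) (auto simp: norm_mult)
    have \<omega>c: "continuous_on {0..t} (\<lambda>x. \<phi> x * (1 - x) powr (s - 1))" if "t < 1" for t
      using that by (intro continuous_intros \<phi>c) auto
    have Upos: "0 < U t \<theta>" if "0 < t" "t < 1" for t \<theta>
      unfolding U_def using that by (intro primitive_pos \<psi>c \<psi>0) auto
    have Wpos: "0 < W t" if "0 < t" "t < 1" for t
      unfolding W_def using that \<phi>0 by (intro primitive_pos \<omega>c) auto
    have We: "ennreal (W t) = nnint {0<..<t} (\<lambda>x. \<phi> x * (1 - x) powr (s - 1))" if "t < 1" for t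
      unfolding W_def using that \<phi>0 by (intro ennreal_primitive \<omega>c) (auto simp: less_imp_le)
    have \<phi>E: "nnint {0<..<1} (\<lambda>t. \<phi> t powr p) \<le> ennreal ((E * A) powr p)"
    proof -
      have 1: "nnint {0<..<1} (\<lambda>t. norm (disc_cut f (of_real t)) powr p) \<le> ennreal ((E0 * A) powr p)"
      proof -
        have "nnint {0<..<1} (\<lambda>t. norm (disc_cut f (of_real t)) powr p) = nnint {0<..<1} (\<lambda>t. norm (f (of_real t)) powr p)"
          by (intro nn_integral_cong) (auto simp: indicator_def)
        then show ?thesis using E0(2)[OF f A fA] by simp
      qed
      have 2: "nnint {0<..<1} (\<lambda>t. A powr p) \<le> ennreal (A powr p)" by (simp add: nn_integral_cmult)
      have "nnint {0<..<1} (\<lambda>t. \<phi> t powr p) \<le> ennreal ((E0 * A + A) powr p)"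
        by (rule triangle_powr[OF sigma_finite_lborel p _ _ _ _ _ _ _ 1 2]) (use E0 A in \<open>auto simp: \<phi>_def\<close>)
      then show ?thesis by (simp add: E_def distrib_right)
    qed
    have U1: "nnint {0..2*pi} (\<lambda>\<theta>. U t \<theta> powr q1) \<le> ennreal ((c1 * (D + 1) * W t) powr q1)" if t: "0 < t" "t < 1" for t
    proof (rule minkowski_powr[where M = lborel and N = lborel and S = "{0<..<t}" and F = "\<lambda>x \<theta>. \<psi> \<theta> x" and
          B = "\<lambda>x. c1 * (D + 1) * (\<phi> x * (1 - x) powr (s - 1))"])
      have "nnint {0<..<t} (\<lambda>x. c1 * (D + 1) * (\<phi> x * (1 - x) powr (s - 1)))
        = (\<integral>\<^sup>+x. ennreal (c1 * (D + 1)) * (ennreal (\<phi> x * (1 - x) powr (s - 1)) * indicator {0<..<t} x) \<partial>lborel)"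
        using c1 D \<phi>0 by (intro nn_integral_cong) (auto simp: indicator_def less_imp_le simp flip: ennreal_mult)
      also have "\<dots> = ennreal (c1 * (D + 1)) * nnint {0<..<t} (\<lambda>x. \<phi> x * (1 - x) powr (s - 1))"
        by (rule nn_integral_cmult) measurable
      also have "\<dots> = ennreal (c1 * (D + 1) * W t)"
        using We[of t] Wpos[OF t] t c1 D by (simp add: ennreal_mult)
      finally show "nnint {0<..<t} (\<lambda>x. c1 * (D + 1) * (\<phi> x * (1 - x) powr (s - 1))) \<le> ennreal (c1 * (D + 1) * W t)" by simp
    next
      fix x assume x: "x \<in> {0<..<t}"
      have kx: "nnint {0..2*pi} (\<lambda>\<theta>. k \<theta> x powr q1) \<le> ennreal ((c1 * (D + 1) * (1 - x) powr (s - 1)) powr q1)"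
        unfolding k_def s_def using x t by (intro nn_integral_deriv_plus_one_le q11 G D c1 GD r) auto
      have "nnint {0..2*pi} (\<lambda>\<theta>. \<psi> \<theta> x powr q1) = (\<integral>\<^sup>+\<theta>. ennreal (\<phi> x powr q1) * (ennreal (k \<theta> x powr q1) * indicator {0..2*pi} \<theta>) \<partial>lborel)"
        using \<phi>0 k0 by (intro nn_integral_cong) (auto simp: \<psi>_def indicator_def powr_mult less_imp_le simp flip: ennreal_mult)
      also have "\<dots> = ennreal (\<phi> x powr q1) * nnint {0..2*pi} (\<lambda>\<theta>. k \<theta> x powr q1)"
        by (rule nn_integral_cmult) measurable
      also have "\<dots> \<le> ennreal (\<phi> x powr q1) * ennreal ((c1 * (D + 1) * (1 - x) powr (s - 1)) powr q1)"
        by (intro mult_left_mono kx) auto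
      also have "\<dots> = ennreal ((\<phi> x * (c1 * (D + 1) * (1 - x) powr (s - 1))) powr q1)"
        using \<phi>0[of x] c1 D by (subst powr_mult[of "\<phi> x"]) (auto simp: less_imp_le simp flip: ennreal_mult)
      also have "\<phi> x * (c1 * (D + 1) * (1 - x) powr (s - 1)) = c1 * (D + 1) * (\<phi> x * (1 - x) powr (s - 1))" by simp
      finally show "nnint {0..2*pi} (\<lambda>\<theta>. \<psi> \<theta> x powr q1) \<le> ennreal ((c1 * (D + 1) * (\<phi> x * (1 - x) powr (s - 1))) powr q1)" .
    next
      fix \<theta>
      show "ennreal (U t \<theta>) \<le> nnint {0<..<t} (\<lambda>x. \<psi> \<theta> x)"
        unfolding U_def using t \<psi>0 by (subst ennreal_primitive[OF \<psi>c]) (auto simp: less_imp_le)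
    qed (use q11 c1 D t Wpos[OF t] \<phi>0 \<psi>0 Upos[OF t] in \<open>auto intro!: sigma_finite_lborel mult_pos_pos simp: less_imp_le\<close>)
    have inner: "nnint {0..2*pi} (\<lambda>\<theta>. p * (\<psi> \<theta> t * U t \<theta> powr (p - 1)))
       \<le> ennreal (L * (\<phi> t * ((1 - t) powr (- s) * W t) powr (p - 1)))" if t: "0 < t" "t < 1" for t
    proof -
      define X where "X = c * (C + 1) * (1 - t) powr (1 / q - 1)"
      define Y where "Y = (c1 * (D + 1) * W t) powr (p - 1)"
      have X0: "0 < X" using c C t by (simp add: X_def)
      have Y0: "0 < Y" using c1 D Wpos[OF t] by (simp add: Y_def)
      have k1: "nnint {0..2*pi} (\<lambda>\<theta>. k \<theta> t powr q) \<le> ennreal (X powr q)"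
        unfolding k_def X_def by (intro nn_integral_deriv_plus_one_le q G C c GC r t)
      have U2: "nnint {0..2*pi} (\<lambda>\<theta>. (U t \<theta> powr (p - 1)) powr b) \<le> ennreal (Y powr b)"
        using U1[OF t] unfolding Y_def powr_powr b(3) .
      have kU: "nnint {0..2*pi} (\<lambda>\<theta>. k \<theta> t * U t \<theta> powr (p - 1)) \<le> ennreal (X * Y)"
        by (rule hoelder_powr[OF q(1) b(1,2) X0 Y0 _ _ _ _ _ k1 U2]) (use k0 in \<open>auto simp: less_imp_le\<close>)
      have "nnint {0..2*pi} (\<lambda>\<theta>. p * (\<psi> \<theta> t * U t \<theta> powr (p - 1)))
        = (\<integral>\<^sup>+\<theta>. ennreal (p * \<phi> t) * (ennreal (k \<theta> t * U t \<theta> powr (p - 1)) * indicator {0..2*pi} \<theta>) \<partial>lborel)"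
        using p \<phi>0[of t] k0 by (intro nn_integral_cong) (auto simp: \<psi>_def indicator_def less_imp_le mult.assoc simp flip: ennreal_mult)
      also have "\<dots> = ennreal (p * \<phi> t) * nnint {0..2*pi} (\<lambda>\<theta>. k \<theta> t * U t \<theta> powr (p - 1))"
        by (rule nn_integral_cmult) measurable
      also have "\<dots> \<le> ennreal (p * \<phi> t) * ennreal (X * Y)" by (intro mult_left_mono kU) auto
      also have "\<dots> = ennreal (p * \<phi> t * (X * Y))" using p \<phi>0[of t] X0 Y0 by (intro ennreal_mult[symmetric]) auto
      also have "p * \<phi> t * (X * Y) = L * (\<phi> t * ((1 - t) powr (- s) * W t) powr (p - 1))"
      proof -
        have "Y = (c1 * (D + 1)) powr (p - 1) * W t powr (p - 1)"
          unfolding Y_def using c1 D Wpos[OF t] by (subst powr_mult) auto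
        moreover have "((1 - t) powr (- s) * W t) powr (p - 1) = (1 - t) powr (1 / q - 1) * W t powr (p - 1)"
          unfolding sp using t Wpos[OF t] by (subst powr_mult) (auto simp: powr_powr)
        ultimately show ?thesis unfolding X_def L_def by simp
      qed
      finally show ?thesis .
    qed
    \<comment> \<open>Only functions of t are left. Hoelder with exponents p and p / (p - 1)
      separates \<open>\<phi>\<close>, handled by Fejer-Riesz, from the (p - 1)-st power, which
      becomes the p-th power in Hardy's inequality.\<close>
    have Z: "nnint {0<..<1} (\<lambda>t. \<phi> t * ((1 - t) powr (- s) * W t) powr (p - 1)) \<le> ennreal ((E * A) * (h * (E * A)) powr (p - 1))"
    proof (rule hoelder_powr[OF p, where b = "p / (p - 1)"])
      show "nnint {0<..<1} (\<lambda>t. (((1 - t) powr (- s) * W t) powr (p - 1)) powr (p / (p - 1))) \<le> ennreal (((h * (E * A)) powr (p - 1)) powr (p / (p - 1)))"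
      proof -
        have pp: "(p - 1) * (p / (p - 1)) = p" using p by simp
        show ?thesis unfolding powr_powr pp h_def
          using E A \<phi>0 We Wpos by (intro hardy_operator_bound[where \<phi> = \<phi>] p s \<phi>E) (auto simp: less_imp_le)
      qed
    qed (use p E A h \<phi>0 \<phi>E in \<open>auto simp: less_imp_le field_simps\<close>)
    \<comment> \<open>Differentiating the power along each ray and exchanging integrals reduces the
      claim to \<open>inner\<close>, the estimate on a single circle at fixed t.\<close>
    have "nnint {0..2*pi} (\<lambda>\<theta>. U T \<theta> powr p)
      = (\<integral>\<^sup>+\<theta>. (\<integral>\<^sup>+t. ennreal (p * (\<psi> \<theta> t * U t \<theta> powr (p - 1))) * indicator {0<..<T} t * indicator {0..2*pi} \<theta> \<partial>lborel) \<partial>lborel)"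
    proof (intro nn_integral_cong)
      fix \<theta>
      have "ennreal (U T \<theta> powr p) = nnint {0<..<T} (\<lambda>t. p * (\<psi> \<theta> t * U t \<theta> powr (p - 1)))"
        unfolding U_def using T by (intro primitive_powr p \<psi>c \<psi>0)
      then show "ennreal (U T \<theta> powr p) * indicator {0..2*pi} \<theta> = (\<integral>\<^sup>+t. ennreal (p * (\<psi> \<theta> t * U t \<theta> powr (p - 1))) * indicator {0<..<T} t * indicator {0..2*pi} \<theta> \<partial>lborel)"
        by (cases "\<theta> \<in> {0..2*pi}") auto
    qed
    also have "\<dots> = (\<integral>\<^sup>+t. (\<integral>\<^sup>+\<theta>. ennreal (p * (\<psi> \<theta> t * U t \<theta> powr (p - 1))) * indicator {0<..<T} t * indicator {0..2*pi} \<theta> \<partial>lborel) \<partial>lborel)"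
      by (rule lborel_pair.Fubini') measurable
    also have "\<dots> \<le> (\<integral>\<^sup>+t. ennreal L * (ennreal (\<phi> t * ((1 - t) powr (- s) * W t) powr (p - 1)) * indicator {0<..<1} t) \<partial>lborel)"
    proof (rule nn_integral_mono)
      fix t :: real
      show "(\<integral>\<^sup>+\<theta>. ennreal (p * (\<psi> \<theta> t * U t \<theta> powr (p - 1))) * indicator {0<..<T} t * indicator {0..2*pi} \<theta> \<partial>lborel)
        \<le> ennreal L * (ennreal (\<phi> t * ((1 - t) powr (- s) * W t) powr (p - 1)) * indicator {0<..<1} t)"
        using inner[of t] L \<phi>0[of t] T by (cases "t \<in> {0<..<T}") (auto simp: less_imp_le simp flip: ennreal_mult)
    qed
    also have "\<dots> = ennreal L * nnint {0<..<1} (\<lambda>t. \<phi> t * ((1 - t) powr (- s) * W t) powr (p - 1))"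
      by (rule nn_integral_cmult) measurable
    also have "\<dots> \<le> ennreal L * ennreal ((E * A) * (h * (E * A)) powr (p - 1))" by (intro mult_left_mono Z) auto
    also have "\<dots> = ennreal (L * ((E * A) * (h * (E * A)) powr (p - 1)))" using L E A h by (intro ennreal_mult[symmetric]) auto
    also have "L * ((E * A) * (h * (E * A)) powr (p - 1)) = (M * A) powr p"
    proof -
      have "(h * (E * A)) powr (p - 1) = (h * E) powr (p - 1) * A powr (p - 1)"
        unfolding mult.assoc[symmetric] using h E A by (subst powr_mult[of "h * E"]) auto
      moreover have "A * A powr (p - 1) = A powr p" using A by (simp add: powr_diff)
      moreover have "(M * A) powr p = M powr p * A powr p" using M(1) A by (subst powr_mult) auto
      ultimately show ?thesis unfolding M(2) by (simp add: mult_ac)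
    qed
    finally show "nnint {0..2*pi} (\<lambda>\<theta>. primitive (\<lambda>t. (norm (disc_cut f (of_real t)) + A) *
           (norm (disc_cut G (of_real t * (of_real r * cis \<theta>))) + 1)) T powr p) \<le> ennreal ((M * A) powr p)"
      unfolding U_def \<psi>_def \<phi>_def k_def .
  qed
qed

section \<open>The operator as a limit of its truncations\<close>

text \<open>On a segment of length 1 the bound |f| \<le> 1 + |f|^p makes f integrable, and the other
  factor is bounded on the compact disc of radius \<rho>.\<close>

lemma hilbert_integrand_integrable:
  fixes f G :: "complex \<Rightarrow> complex" and z :: complex and p \<rho> :: real
  assumes f: "continuous_on (ball 0 1) f" and G: "continuous_on (ball 0 1) G" and p: "1 < p"
    and fin: "nnint {0<..<1} (\<lambda>t. norm (f (of_real t)) powr p) < \<infinity>"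
    and \<rho>: "\<rho> < 1" and z: "norm z \<le> \<rho>"
  shows "(\<lambda>t. f (of_real t) * G (of_real t * z)) absolutely_integrable_on {0<..<1}"
proof -
  have [measurable]: "disc_cut f \<in> borel_measurable borel" "disc_cut G \<in> borel_measurable borel"
    using borel_measurable_disc_cut f G by auto
  have "compact (G ` cball 0 \<rho>)" using \<rho> by (intro compact_continuous_image continuous_on_subset[OF G]) auto
  then obtain M where M: "0 < M" "\<And>w. w \<in> cball 0 \<rho> \<Longrightarrow> norm (G w) \<le> M"
    by (metis bounded_pos compact_imp_bounded imageI)
  have n: "norm (of_real t * z) \<le> \<rho>" "norm (of_real t * z) < 1" if "t \<in> {0<..<1}" for t
  proof -
    have "norm (of_real t * z) \<le> 1 * norm z" using that unfolding norm_mult by (intro mult_right_mono) auto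
    then show "norm (of_real t * z) \<le> \<rho>" "norm (of_real t * z) < 1" using z \<rho> by auto
  qed
  let ?F = "\<lambda>t. indicator {0<..<1} t *\<^sub>R (disc_cut f (of_real t) * disc_cut G (of_real t * z))"
  have "(\<integral>\<^sup>+t. ennreal (norm (?F t)) \<partial>lborel) \<le> (\<integral>\<^sup>+t. ennreal M * (indicator {0<..<1} t + ennreal (norm (f (of_real t)) powr p) * indicator {0<..<1} t) \<partial>lborel)"
  proof (rule nn_integral_mono)
    fix t :: real
    show "ennreal (norm (?F t)) \<le> ennreal M * (indicator {0<..<1} t + ennreal (norm (f (of_real t)) powr p) * indicator {0<..<1} t)"
    proof (cases "t \<in> {0<..<1}")
      case True
      have "norm (f (of_real t)) \<le> 1 + norm (f (of_real t)) powr p"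
      proof (cases "norm (f (of_real t)) \<le> 1")
        case False
        then have "norm (f (of_real t)) powr 1 \<le> norm (f (of_real t)) powr p" using p by (intro powr_mono) auto
        then show ?thesis using False by simp
      qed (simp add: add_increasing2)
      then have "norm (f (of_real t)) * norm (G (of_real t * z)) \<le> (1 + norm (f (of_real t)) powr p) * M"
        using M(2)[of "of_real t * z"] n[OF True] by (intro mult_mono) auto
      then have "ennreal (norm (?F t)) \<le> ennreal (M * (1 + norm (f (of_real t)) powr p))"
        using True n[OF True] by (intro ennreal_leI) (simp add: norm_mult mult.commute)
      also have "\<dots> = ennreal M * (1 + ennreal (norm (f (of_real t)) powr p))"
        using M(1) by (subst ennreal_mult) simp_all
      finally show ?thesis using True by simp
    qed simp
  qed
  also have "\<dots> = (\<integral>\<^sup>+t. ennreal M * (indicator {0<..<1} t + ennreal (norm (disc_cut f (of_real t)) powr p) * indicator {0<..<1} t) \<partial>lborel)"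
    by (intro nn_integral_cong) (auto simp: indicator_def)
  also have "\<dots> = ennreal M * (1 + nnint {0<..<1} (\<lambda>t. norm (disc_cut f (of_real t)) powr p))"
    by (subst nn_integral_cmult, measurable, subst nn_integral_add, auto)
  also have "nnint {0<..<1} (\<lambda>t. norm (disc_cut f (of_real t)) powr p) = nnint {0<..<1} (\<lambda>t. norm (f (of_real t)) powr p)"
    by (intro nn_integral_cong) (auto simp: indicator_def)
  finally have "(\<integral>\<^sup>+t. ennreal (norm (?F t)) \<partial>lborel) < \<infinity>"
    using fin by (auto simp: ennreal_mult_less_top intro: order_le_less_trans)
  then have "integrable lborel ?F" by (intro integrableI_bounded) auto
  then have "integrable lebesgue ?F" by (subst integrable_completion) auto
  then have "(\<lambda>t. disc_cut f (of_real t) * disc_cut G (of_real t * z)) absolutely_integrable_on {0<..<1}"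
    by (simp add: set_integrable_def)
  then show ?thesis
    by (rule absolutely_integrable_spike[where S = "{}"]) (use n in auto)
qed

lemma hilbert_op_eq_integral:
  assumes f: "continuous_on (ball 0 1) f" and g: "g holomorphic_on ball 0 1" and p: "1 < p"
    and fin: "nnint {0<..<1} (\<lambda>t. norm (f (of_real t)) powr p) < \<infinity>"
    and z: "norm z < 1"
  shows "(\<lambda>t. f (of_real t) * deriv g (of_real t * z)) integrable_on {0..1}"
    and "hilbert_op g f z = integral {0..1} (\<lambda>t. f (of_real t) * deriv g (of_real t * z))"
proof -
  let ?F = "\<lambda>t. f (of_real t) * deriv g (of_real t * z)"
  have ai: "?F absolutely_integrable_on {0<..<1}"
    by (rule hilbert_integrand_integrable[OF f _ p fin z]) (auto intro: holomorphic_on_deriv_disc[OF g])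
  then have "?F integrable_on {0<..<1}" by (rule set_lebesgue_integral_eq_integral(1))
  then show "?F integrable_on {0..1}" by (simp add: integrable_on_open_interval_real)
  have "integrable (lebesgue_on {0<..<1}) ?F" using ai by (intro absolutely_integrable_imp_integrable) auto
  then have "hilbert_op g f z = integral {0<..<1} ?F"
    unfolding hilbert_op_def by (intro lebesgue_integral_eq_integral) auto
  then show "hilbert_op g f z = integral {0..1} ?F" by (simp add: integral_open_interval_real)
qed

text \<open>Up to T < 1 the integrand is continuous on a compact interval, so differentiation under
  the integral and the main estimate apply without any knowledge of f near 1.\<close>

definition truncated_hilbert_op :: "(complex \<Rightarrow> complex) \<Rightarrow> (complex \<Rightarrow> complex) \<Rightarrow> real \<Rightarrow> complex \<Rightarrow> complex" where
  "truncated_hilbert_op g f T z = integral {0..T} (\<lambda>t. f (of_real t) * deriv g (of_real t * z))"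

lemma truncated_hilbert_op_holomorphic:
  assumes f: "continuous_on (ball 0 1) f" and g: "g holomorphic_on ball 0 1" and T: "0 \<le> T" "T < 1"
  shows "truncated_hilbert_op g f T holomorphic_on ball 0 1"
proof -
  have G: "deriv g holomorphic_on ball 0 1" "continuous_on (ball 0 1) (deriv g)"
    by (rule holomorphic_on_deriv_disc[OF g])+
  have G': "continuous_on (ball 0 1) (deriv (deriv g))" by (rule holomorphic_on_deriv_disc[OF G(1)])
  have n: "norm (of_real t * x) < 1" if "norm x < 1" "t \<in> {0..T}" for t and x :: complex
    using that T by (intro norm_ray_less_1) auto
  have fT: "continuous_on S (\<lambda>t. f (of_real t))" if "S \<subseteq> {0..T}" for S
    by (intro continuous_on_compose2[OF f] continuous_intros) (use T that in auto)
  have "(\<lambda>z. integral (cbox 0 T) (\<lambda>t. f (of_real t) * deriv g (of_real t * z))) holomorphic_on ball 0 1"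
  proof (rule leibniz_rule_holomorphic[where fx = "\<lambda>x t. f (of_real t) * (deriv (deriv g) (of_real t * x) * of_real t)"])
    fix x :: complex and t :: real assume x: "x \<in> ball 0 1" and t: "t \<in> cbox 0 T"
    have "(deriv g has_field_derivative deriv (deriv g) (of_real t * x)) (at (of_real t * x))"
      using n[of x t] x t by (intro holomorphic_derivI[OF G(1)]) auto
    then have "((\<lambda>x. deriv g (of_real t * x)) has_field_derivative deriv (deriv g) (of_real t * x) * of_real t) (at x within ball 0 1)"
      by (rule DERIV_chain2) (auto intro!: derivative_eq_intros)
    then show "((\<lambda>x. f (of_real t) * deriv g (of_real t * x)) has_field_derivative f (of_real t) * (deriv (deriv g) (of_real t * x) * of_real t)) (at x within ball 0 1)"
      by (rule DERIV_cmult)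
  next
    fix x :: complex assume x: "x \<in> ball 0 1"
    have "continuous_on (cbox 0 T) (\<lambda>t. f (of_real t) * deriv g (of_real t * x))"
      using x T by (intro continuous_intros fT continuous_on_ray[OF G(2)]) auto
    then show "(\<lambda>t. f (of_real t) * deriv g (of_real t * x)) integrable_on cbox 0 T"
      by (rule integrable_continuous)
  next
    have "continuous_on (ball 0 1 \<times> cbox 0 T) (\<lambda>w. f (of_real (snd w)) * (deriv (deriv g) (of_real (snd w) * fst w) * of_real (snd w)))"
      by (intro continuous_intros continuous_on_compose2[OF G'] continuous_on_compose2[OF fT[of "{0..T}"]]) (use n in auto)
    then show "continuous_on (ball 0 1 \<times> cbox 0 T) (\<lambda>(x, t). f (of_real t) * (deriv (deriv g) (of_real t * x) * of_real t))"
      by (simp add: case_prod_beta')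
  qed auto
  then show ?thesis by (simp add: truncated_hilbert_op_def[abs_def])
qed

text \<open>The error is at most the tail of the integral of |f| times the supremum of |g'| on the
  smaller disc, hence uniform in z.\<close>

lemma truncated_hilbert_op_tendsto:
  assumes f: "continuous_on (ball 0 1) f" and g: "g holomorphic_on ball 0 1" and p: "1 < p"
    and fin: "nnint {0<..<1} (\<lambda>t. norm (f (of_real t)) powr p) < \<infinity>"
    and \<rho>: "\<rho> < 1"
  shows "uniform_limit (cball 0 \<rho>) (\<lambda>n. truncated_hilbert_op g f (approach_radius n)) (hilbert_op g f) sequentially"
proof -
  let ?G = "deriv g"
  have Gc: "continuous_on (ball 0 1) ?G" by (rule holomorphic_on_deriv_disc[OF g])
  have "compact (?G ` cball 0 \<rho>)" using \<rho> by (intro compact_continuous_image continuous_on_subset[OF Gc]) auto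
  then obtain M where M: "0 < M" "\<And>w. w \<in> cball 0 \<rho> \<Longrightarrow> norm (?G w) \<le> M"
    by (metis bounded_pos compact_imp_bounded imageI)
  \<comment> \<open>The constant 1 in place of g' yields integrability of f itself.\<close>
  have "(\<lambda>t. f (of_real t) * 1) absolutely_integrable_on {0<..<1}"
    using hilbert_integrand_integrable[OF f continuous_on_const p fin zero_less_one, of 0 1] by simp
  then have "(\<lambda>t. norm (f (of_real t))) absolutely_integrable_on {0<..<1}"
    using absolutely_integrable_norm by (simp add: o_def)
  then have "(\<lambda>t. norm (f (of_real t))) integrable_on {0<..<1}" by (rule set_lebesgue_integral_eq_integral(1))
  then have fi: "(\<lambda>t. norm (f (of_real t))) integrable_on {0..1}" by (simp add: integrable_on_open_interval_real)
  define I where "I T = integral {0..T} (\<lambda>t. norm (f (of_real t)))" for T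
  have "continuous_on {0..1} I" unfolding I_def by (rule indefinite_integral_continuous_1[OF fi])
  then have "(\<lambda>n. I (approach_radius n)) \<longlonglongrightarrow> I 1"
    using approach_radius by (intro continuous_on_tendsto_compose[of _ I, OF _ approach_radius_tendsto]) (auto simp: less_imp_le)
  then have lim: "(\<lambda>n. M * (I 1 - I (approach_radius n))) \<longlonglongrightarrow> M * (I 1 - I 1)" by (intro tendsto_intros)
  show ?thesis
  proof (rule uniform_limitI)
    fix e :: real assume "0 < e"
    with lim have "eventually (\<lambda>n. M * (I 1 - I (approach_radius n)) < e) sequentially"
      by (auto dest: order_tendstoD)
    then show "eventually (\<lambda>n. \<forall>z\<in>cball 0 \<rho>. dist (truncated_hilbert_op g f (approach_radius n) z) (hilbert_op g f z) < e) sequentially"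
    proof (rule eventually_mono, intro ballI)
      fix n and z :: complex
      assume n: "M * (I 1 - I (approach_radius n)) < e" and zz: "z \<in> cball 0 \<rho>"
      define T where "T = approach_radius n"
      have T: "0 \<le> T" "T \<le> 1" using approach_radius[of n] by (auto simp: T_def)
      let ?F = "\<lambda>t. f (of_real t) * ?G (of_real t * z)"
      have z: "norm z < 1" "norm z \<le> \<rho>" using zz \<rho> by auto
      note H = hilbert_op_eq_integral[OF f g p fin z(1)]
      have FT: "?F integrable_on {T..1}" using H(1) T by (auto intro: integrable_subinterval_real)
      have nT: "(\<lambda>t. M * norm (f (of_real t))) integrable_on {T..1}"
        using fi T by (intro integrable_on_mult_right) (auto intro: integrable_subinterval_real)
      have "hilbert_op g f z - truncated_hilbert_op g f T z = integral {T..1} ?F"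
        unfolding H(2) truncated_hilbert_op_def using Henstock_Kurzweil_Integration.integral_combine[OF T H(1)] by (simp add: algebra_simps)
      then have "dist (truncated_hilbert_op g f T z) (hilbert_op g f z) = norm (integral {T..1} ?F)"
        by (simp add: dist_norm norm_minus_commute)
      also have "\<dots> \<le> integral {T..1} (\<lambda>t. M * norm (f (of_real t)))"
      proof (rule integral_norm_bound_integral[OF FT nT])
        fix t assume t: "t \<in> {T..1}"
        have "norm (of_real t * z) \<le> 1 * norm z" using t T unfolding norm_mult by (intro mult_right_mono) auto
        then have "norm (?G (of_real t * z)) \<le> M" using z by (intro M) auto
        then show "norm (?F t) \<le> M * norm (f (of_real t))"
          unfolding norm_mult by (subst mult.commute) (intro mult_right_mono, auto)
      qed
      also have "\<dots> = M * (I 1 - I T)"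
        unfolding I_def using Henstock_Kurzweil_Integration.integral_combine[OF T fi] by simp
      also have "\<dots> < e" using n by (simp add: T_def)
      finally show "dist (truncated_hilbert_op g f (approach_radius n) z) (hilbert_op g f z) < e" unfolding T_def .
    qed
  qed
qed

text \<open>Weierstrass: a locally uniform limit of holomorphic functions. Differentiation under an
  integral reaching the endpoint 1 is thereby avoided.\<close>

lemma hilbert_op_holomorphic:
  assumes f: "continuous_on (ball 0 1) f" and g: "g holomorphic_on ball 0 1" and p: "1 < p"
    and fin: "nnint {0<..<1} (\<lambda>t. norm (f (of_real t)) powr p) < \<infinity>"
  shows "hilbert_op g f holomorphic_on ball 0 1"
proof (rule holomorphic_uniform_sequence)
  show "truncated_hilbert_op g f (approach_radius n) holomorphic_on ball 0 1" for n
    using approach_radius[of n] by (intro truncated_hilbert_op_holomorphic f g) auto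
  fix x :: complex assume x: "x \<in> ball 0 1"
  define d where "d = (1 - norm x) / 2"
  have d: "0 < d" "norm x + d < 1" using x by (auto simp: d_def field_simps)
  have sub: "cball x d \<subseteq> cball 0 (norm x + d)"
  proof
    fix w assume "w \<in> cball x d"
    then show "w \<in> cball 0 (norm x + d)" using norm_triangle_sub[of w x] by (auto simp: dist_norm norm_minus_commute)
  qed
  show "\<exists>d. 0 < d \<and> cball x d \<subseteq> ball 0 1 \<and> uniform_limit (cball x d) (\<lambda>n. truncated_hilbert_op g f (approach_radius n)) (hilbert_op g f) sequentially"
  proof (intro exI conjI)
    show "cball x d \<subseteq> ball 0 1" using sub d by (fastforce simp: subset_iff)
    show "uniform_limit (cball x d) (\<lambda>n. truncated_hilbert_op g f (approach_radius n)) (hilbert_op g f) sequentially"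
      by (rule uniform_limit_on_subset[OF truncated_hilbert_op_tendsto[OF f g p fin d(2)] sub])
  qed (rule d)
qed auto

text \<open>The summands A and 1 only enlarge the integrand; they bring it into the form treated by
  \<open>hilbert_main_estimate\<close>.\<close>

lemma norm_truncated_hilbert_op_le:
  assumes f: "continuous_on (ball 0 1) f" and g: "g holomorphic_on ball 0 1" and T: "0 \<le> T" "T < 1"
    and A: "0 \<le> A" and z: "norm z < 1"
  shows "norm (truncated_hilbert_op g f T z) \<le> primitive (\<lambda>t. (norm (disc_cut f (of_real t)) + A) * (norm (disc_cut (deriv g) (of_real t * z)) + 1)) T"
proof -
  have Gc: "continuous_on (ball 0 1) (deriv g)" by (rule holomorphic_on_deriv_disc[OF g])
  have cf: "continuous_on {0..T} (\<lambda>t. disc_cut f (of_real t))"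
    using continuous_on_disc_cut_ray[OF f T(2), of 1] by simp
  have cG: "continuous_on {0..T} (\<lambda>t. disc_cut (deriv g) (of_real t * z))"
    using z by (intro continuous_on_disc_cut_ray[OF Gc T(2)]) auto
  have eq: "f (of_real t) * deriv g (of_real t * z) = disc_cut f (of_real t) * disc_cut (deriv g) (of_real t * z)" if "t \<in> {0..T}" for t
    using that T z norm_ray_less_1[of z t] by auto
  have "truncated_hilbert_op g f T z = integral {0..T} (\<lambda>t. disc_cut f (of_real t) * disc_cut (deriv g) (of_real t * z))"
    unfolding truncated_hilbert_op_def by (rule integral_cong) (rule eq)
  also have "norm \<dots> \<le> integral {0..T} (\<lambda>t. (norm (disc_cut f (of_real t)) + A) * (norm (disc_cut (deriv g) (of_real t * z)) + 1))"
    using A by (intro integral_norm_bound_integral integrable_continuous_interval continuous_intros cf cG)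
      (auto simp: norm_mult intro!: mult_mono)
  also have "\<dots> = primitive (\<lambda>t. (norm (disc_cut f (of_real t)) + A) * (norm (disc_cut (deriv g) (of_real t * z)) + 1)) T"
    by (intro primitive_eq_integral[symmetric] continuous_intros cf cG)
  finally show ?thesis .
qed

text \<open>The main estimate needs a positive A, while the norm of f may vanish. It is therefore
  applied to every A strictly above the norm, and A is let down to the norm at the end.\<close>

lemma bounded_on_hardy_of_deriv_bound:
  fixes p q C :: real and g :: "complex \<Rightarrow> complex"
  assumes q: "1 < q" "q < p" and g: "g holomorphic_on ball 0 1" and C: "0 < C"
    and GC: "\<And>r. 0 < r \<Longrightarrow> r < 1 \<Longrightarrow> circle_powr q r (deriv g) \<le> ennreal (2 * pi * (C * (1 - r) powr (1 / q - 1)) powr q)"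
  shows "bounded_on_hardy p (hilbert_op g)"
proof -
  have p: "1 < p" using q by simp
  define q1 where "q1 = (p - 1) * q / (q - 1)"
  \<comment> \<open>The growth condition is to be raised from q to q1, and q < p gives (p - 1) / (q
    - 1) > 1.\<close>
  have q1: "q \<le> q1"
  proof -
    have "q * (q - 1) \<le> (p - 1) * q" using q by (simp add: mult.commute)
    then show ?thesis unfolding q1_def using q by (simp add: pos_le_divide_eq)
  qed
  have G: "deriv g holomorphic_on ball 0 1" by (rule holomorphic_on_deriv_disc[OF g])
  obtain D where D: "0 < D" "\<And>r. 0 < r \<Longrightarrow> r < 1 \<Longrightarrow> circle_powr q1 r (deriv g) \<le> ennreal (2 * pi * (D * (1 - r) powr (1 / q1 - 1)) powr q1)"
    using deriv_bound_larger_exponent[OF q(1) q1 G C GC] by blast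
  obtain M where M: "0 < M"
    "\<And>f A r T. f holomorphic_on ball 0 1 \<Longrightarrow> 0 < A \<Longrightarrow> 0 < r \<Longrightarrow> r < 1 \<Longrightarrow> 0 < T \<Longrightarrow> T < 1 \<Longrightarrow>
       (\<And>r. 0 < r \<Longrightarrow> r < 1 \<Longrightarrow> circle_powr p r f \<le> ennreal (2 * pi * A powr p)) \<Longrightarrow>
       nnint {0..2*pi} (\<lambda>\<theta>. primitive (\<lambda>t. (norm (disc_cut f (of_real t)) + A) *
           (norm (disc_cut (deriv g) (of_real t * (of_real r * cis \<theta>))) + 1)) T powr p) \<le> ennreal ((M * A) powr p)"
    using hilbert_main_estimate[OF q G C D(1) GC D(2)[unfolded q1_def]] by blast
  obtain E where E: "0 < E" "\<And>f A. f holomorphic_on ball 0 1 \<Longrightarrow> 0 < A \<Longrightarrow>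
       (\<And>r. 0 < r \<Longrightarrow> r < 1 \<Longrightarrow> circle_powr p r f \<le> ennreal (2 * pi * A powr p)) \<Longrightarrow>
       nnint {0<..<1} (\<lambda>t. norm (f (of_real t)) powr p) \<le> ennreal ((E * A) powr p)"
    using fejer_riesz[OF p] by blast
  have est: "hilbert_op g f holomorphic_on ball 0 1 \<and> (\<forall>r. 0 < r \<and> r < 1 \<longrightarrow> integral_mean p r (hilbert_op g f) \<le> M * A)"
    if fH: "f \<in> hardy p" and A: "hardy_norm p f < A" for f A
  proof -
    have f: "f holomorphic_on ball 0 1" using fH by (simp add: hardy_def)
    have fc: "continuous_on (ball 0 1) f" by (rule holomorphic_on_imp_continuous_on[OF f])
    have A0: "0 < A" using hardy_norm_nonneg[OF fH] A by simp
    have fA: "circle_powr p r f \<le> ennreal (2 * pi * A powr p)" if "0 < r" "r < 1" for r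
      using integral_mean_le_hardy_norm[OF fH that] A A0 p that by (subst integral_mean_le_iff[symmetric]) (auto intro: fc)
    have fin: "nnint {0<..<1} (\<lambda>t. norm (f (of_real t)) powr p) < \<infinity>"
      using E(2)[OF f A0 fA] by (auto intro: order_le_less_trans)
    have hol: "hilbert_op g f holomorphic_on ball 0 1" by (rule hilbert_op_holomorphic[OF fc g p fin])
    have "integral_mean p r (hilbert_op g f) \<le> M * A" if r: "0 < r" "r < 1" for r
    proof -
      have "circle_powr p r (hilbert_op g f) \<le> ennreal ((M * A) powr p)"
      proof (rule nn_integral_fatou_le[where u = "\<lambda>n \<theta>. norm (truncated_hilbert_op g f (approach_radius n) (of_real r * cis \<theta>)) powr p"])
        fix n
        have [measurable]: "(\<lambda>\<theta>. truncated_hilbert_op g f (approach_radius n) (of_real r * cis \<theta>)) \<in> borel_measurable borel"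
          using approach_radius[of n] r
          by (intro borel_measurable_circle holomorphic_on_imp_continuous_on truncated_hilbert_op_holomorphic fc g) auto
        show "(\<lambda>\<theta>. norm (truncated_hilbert_op g f (approach_radius n) (of_real r * cis \<theta>)) powr p) \<in> borel_measurable borel"
          by measurable
      next
        show "AE \<theta> in lborel. \<theta> \<in> {0..2*pi} \<longrightarrow> (\<lambda>n. norm (truncated_hilbert_op g f (approach_radius n) (of_real r * cis \<theta>)) powr p)
            \<longlonglongrightarrow> norm (hilbert_op g f (of_real r * cis \<theta>)) powr p"
        proof (intro AE_I2 impI)
          fix \<theta> :: real
          have "(\<lambda>n. truncated_hilbert_op g f (approach_radius n) (of_real r * cis \<theta>)) \<longlonglongrightarrow> hilbert_op g f (of_real r * cis \<theta>)"
            by (rule tendsto_uniform_limitI[OF truncated_hilbert_op_tendsto[OF fc g p fin r(2)]]) (use r in \<open>simp add: norm_mult\<close>)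
          then show "(\<lambda>n. norm (truncated_hilbert_op g f (approach_radius n) (of_real r * cis \<theta>)) powr p) \<longlonglongrightarrow> norm (hilbert_op g f (of_real r * cis \<theta>)) powr p"
            using p by (intro tendsto_powr' tendsto_intros) auto
        qed
        show "eventually (\<lambda>n. nnint {0..2*pi} (\<lambda>\<theta>. norm (truncated_hilbert_op g f (approach_radius n) (of_real r * cis \<theta>)) powr p)
            \<le> ennreal ((M * A) powr p)) sequentially"
        proof (intro always_eventually allI)
          fix n
          have "nnint {0..2*pi} (\<lambda>\<theta>. norm (truncated_hilbert_op g f (approach_radius n) (of_real r * cis \<theta>)) powr p)
            \<le> nnint {0..2*pi} (\<lambda>\<theta>. primitive (\<lambda>t. (norm (disc_cut f (of_real t)) + A) *
              (norm (disc_cut (deriv g) (of_real t * (of_real r * cis \<theta>))) + 1)) (approach_radius n) powr p)"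
            using approach_radius[of n] r A0 p
            by (intro nn_integral_mono mult_right_mono ennreal_leI powr_mono2 norm_truncated_hilbert_op_le[OF fc g]) (auto simp: norm_mult)
          also have "\<dots> \<le> ennreal ((M * A) powr p)" using approach_radius[of n] r by (intro M(2) f A0 fA)
          finally show "nnint {0..2*pi} (\<lambda>\<theta>. norm (truncated_hilbert_op g f (approach_radius n) (of_real r * cis \<theta>)) powr p)
            \<le> ennreal ((M * A) powr p)" .
        qed
      qed auto
      \<comment> \<open>The main estimate bounds the unnormalised integral; since 2 * pi \<ge> 1,
        the same M serves for the normalised mean.\<close>
      also have "\<dots> \<le> ennreal (2 * pi * (M * A) powr p)"
      proof (rule ennreal_leI)
        have "1 * (M * A) powr p \<le> 2 * pi * (M * A) powr p" using pi_gt3 by (intro mult_right_mono) auto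
        then show "(M * A) powr p \<le> 2 * pi * (M * A) powr p" by simp
      qed
      finally show ?thesis using r p M(1) A0
        by (subst integral_mean_le_iff) (auto intro: holomorphic_on_imp_continuous_on[OF hol])
    qed
    with hol show ?thesis by blast
  qed
  show ?thesis
    unfolding bounded_on_hardy_def
  proof (intro exI[of _ M] ballI conjI)
    fix f assume fH: "f \<in> hardy p"
    have 1: "hilbert_op g f \<in> hardy p"
      using est[OF fH, of "hardy_norm p f + 1"] by (intro hardyI(1)) auto
    show "hilbert_op g f \<in> hardy p" by (rule 1)
    show "hardy_norm p (hilbert_op g f) \<le> M * hardy_norm p f"
    proof (rule field_le_epsilon)
      fix e :: real assume e: "0 < e"
      \<comment> \<open>The excess e / M over the norm is scaled so that it contributes exactly
        e.\<close>
      have "hardy_norm p (hilbert_op g f) \<le> M * (hardy_norm p f + e / M)"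
        using est[OF fH, of "hardy_norm p f + e / M"] e M(1) by (intro hardyI(2)) auto
      then show "hardy_norm p (hilbert_op g f) \<le> M * hardy_norm p f + e" using M(1) by (simp add: distrib_left)
    qed
  qed
qed

theorem theorem2:
  fixes p :: real and g :: "complex \<Rightarrow> complex"
  assumes "2 < p"
    and "g holomorphic_on ball 0 1"
  shows "(bounded_on_hardy p (hilbert_op g) \<longrightarrow> g \<in> mean_lipschitz p (1 / p)) \<and>
         ((\<exists>q. 1 < q \<and> q < p \<and> g \<in> mean_lipschitz q (1 / q)) \<longrightarrow> bounded_on_hardy p (hilbert_op g))"
proof (intro conjI impI)
  assume "bounded_on_hardy p (hilbert_op g)"
  from deriv_bound_of_bounded[OF assms this] obtain C where "0 < C"
    "\<And>a. 0 < a \<Longrightarrow> a < 1 \<Longrightarrow> integral_mean p a (deriv g) \<le> C * (1 - a) powr (1 / p - 1)" by blast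
  then show "g \<in> mean_lipschitz p (1 / p)"
    using assms by (intro mean_lipschitz_of_deriv_bound[of p g C]) auto
next
  assume "\<exists>q. 1 < q \<and> q < p \<and> g \<in> mean_lipschitz q (1 / q)"
  then obtain q where q: "1 < q" "q < p" and gL: "g \<in> mean_lipschitz q (1 / q)" by blast
  then have gH: "g \<in> hardy q" and AE: "AE \<theta> in lebesgue_on {0..2*pi}. has_radial_limit g (cis \<theta>)"
    and lip: "modulus_of_continuity q g \<in> O[at_right 0](\<lambda>t. t powr (1 / q))" by (auto simp: mean_lipschitz_def)
  \<comment> \<open>The summand 1 makes the bound positive even for g = 0.\<close>
  define K where "K = hardy_norm q g + 1"
  have K: "0 < K" using hardy_norm_nonneg[OF gH] by (simp add: K_def)
  have gK: "circle_powr q r g \<le> ennreal (2 * pi * K powr q)" if "0 < r" "r < 1" for r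
    using integral_mean_le_hardy_norm[OF gH that] K q that
    by (subst integral_mean_le_iff[symmetric]) (auto simp: K_def intro: holomorphic_on_imp_continuous_on[OF assms(2)])
  obtain C where "0 < C" "\<And>r. 0 < r \<Longrightarrow> r < 1 \<Longrightarrow> circle_powr q r (deriv g) \<le> ennreal (2 * pi * (C * (1 - r) powr (1 / q - 1)) powr q)"
    using deriv_bound_of_lipschitz[OF q(1) assms(2) K gK AE lip] by blast
  then show "bounded_on_hardy p (hilbert_op g)"
    using bounded_on_hardy_of_deriv_bound[OF q assms(2)] by blast
qed

end
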